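(* For every prime $p>3$ and every prime $q>p^3$, the group $\mathbb{Z}_p^3\times\mathbb{Z}_q$ is a DCI-group.
   Context: Here $\mathbb{Z}_p^3$ is the elementary abelian group $\mathbb{Z}_p\times\mathbb{Z}_p\times\mathbb{Z}_p$. For a finite group $G$ and a subset $S\subseteq G$, the Cayley graph $Cay(G,S)$ is the directed graph with vertex set $G$ in which $g$ is adjacent to $h$ (there is an arc between $g$ and $h$ in the corresponding direction) if and only if $gh^{-1}\in S$. $Cay(G,S)$ is a CI-graph if for every $T\subseteq G$, the graphs $Cay(G,S)$ and $Cay(G,T)$ are isomorphic if and only if there is a group automorphism $\mu$ of $G$ with $S^{\mu}=T$. A group $G$ is a DCI-group if $Cay(G,S)$ is a CI-graph for every $S\subseteq G$. *)

theory Defs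
  imports
    "HOL-Computational_Algebra.Primes"
    "HOL-Algebra.Elementary_Groups"
    "Graph_Theory.Pair_Digraph"
    "Graph_Theory.Digraph_Isomorphism"
begin

definition cayley_digraph :: "('a, 'b) monoid_scheme \<Rightarrow> 'a set \<Rightarrow> 'a pair_pre_digraph" where
  "cayley_digraph G S =
     \<lparr>pverts = carrier G,
      parcs = {(g, h). g \<in> carrier G \<and> h \<in> carrier G \<and> g \<otimes>\<^bsub>G\<^esub> inv\<^bsub>G\<^esub> h \<in> S}\<rparr>"

definition cayley_CI :: "('a, 'b) monoid_scheme \<Rightarrow> 'a set \<Rightarrow> bool" where
  "cayley_CI G S \<longleftrightarrow>
     (\<forall>T. T \<subseteq> carrier G \<longrightarrow>
        (digraph_iso (with_proj (cayley_digraph G S)) (with_proj (cayley_digraph G T)) \<longleftrightarrow>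
         (\<exists>\<mu> \<in> iso G G. \<mu> ` S = T)))"

definition DCI_group :: "('a, 'b) monoid_scheme \<Rightarrow> bool" where
  "DCI_group G \<longleftrightarrow>
     group G \<and> finite (carrier G) \<and> (\<forall>S. S \<subseteq> carrier G \<longrightarrow> cayley_CI G S)"

text \<open>The library's digraph isomorphism carries separate vertex and arc maps. On Cayley digraphs,
  which have no parallel arcs, it amounts to a bijection of the vertices that preserves and
  reflects adjacency.\<close>

lemma digraph_iso_cayley_digraph_iff:
  "digraph_iso (with_proj (cayley_digraph G S)) (with_proj (cayley_digraph G T)) \<longleftrightarrow>
     (\<exists>f. bij_betw f (carrier G) (carrier G) \<and>
        (\<forall>g \<in> carrier G. \<forall>h \<in> carrier G.
           g \<otimes>\<^bsub>G\<^esub> inv\<^bsub>G\<^esub> h \<in> S \<longleftrightarrow> f g \<otimes>\<^bsub>G\<^esub> inv\<^bsub>G\<^esub> f h \<in> T))" (is "?L \<longleftrightarrow> ?R")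
proof
  let ?C = "\<lambda>S. with_proj (cayley_digraph G S)"
  assume ?L
  then obtain k where k: "pre_digraph.digraph_isomorphism (?C S) k" and eq: "?C T = app_iso k (?C S)"
    unfolding digraph_iso_def by blast
  let ?f = "iso_verts k"
  have inj: "inj_on ?f (carrier G)"
    and cmp: "\<And>a. a \<in> arcs (?C S) \<Longrightarrow>
      ?f (fst a) = iso_tail k (iso_arcs k a) \<and> ?f (snd a) = iso_head k (iso_arcs k a)"
    using k by (auto simp: pre_digraph.digraph_isomorphism_def cayley_digraph_def)
  have im: "?f ` carrier G = carrier G"
    using arg_cong[OF eq, of verts] by (simp add: cayley_digraph_def)
  have arcs: "iso_arcs k ` arcs (?C S) = arcs (?C T)"
    using arg_cong[OF eq, of arcs] by simp
  have ht: "iso_tail k = fst" "iso_head k = snd"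
    using arg_cong[OF eq, of tail] arg_cong[OF eq, of head] by simp_all
  have "iso_arcs k a = map_prod ?f ?f a" if "a \<in> arcs (?C S)" for a
    using cmp[OF that] ht by (simp add: prod_eq_iff)
  then have A: "map_prod ?f ?f ` arcs (?C S) = arcs (?C T)"
    unfolding arcs[symmetric] by (intro image_cong) simp_all
  have "g \<otimes>\<^bsub>G\<^esub> inv\<^bsub>G\<^esub> h \<in> S \<longleftrightarrow> ?f g \<otimes>\<^bsub>G\<^esub> inv\<^bsub>G\<^esub> ?f h \<in> T"
    if "g \<in> carrier G" "h \<in> carrier G" for g h
  proof -
    have "inj_on (map_prod ?f ?f) (carrier G \<times> carrier G)"
      using inj inj by (rule map_prod_inj_on)
    moreover have "arcs (?C S) \<subseteq> carrier G \<times> carrier G"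
      by (auto simp: cayley_digraph_def)
    ultimately have "(g, h) \<in> arcs (?C S) \<longleftrightarrow> map_prod ?f ?f (g, h) \<in> arcs (?C T)"
      unfolding A[symmetric] using that by (intro inj_on_image_mem_iff[symmetric]) auto
    moreover have "?f g \<in> carrier G" "?f h \<in> carrier G"
      using that im by blast+
    ultimately show ?thesis
      using that by (simp add: cayley_digraph_def)
  qed
  then show ?R
    using inj im unfolding bij_betw_def by blast
next
  let ?C = "\<lambda>S. with_proj (cayley_digraph G S)"
  assume ?R
  then obtain f where inj: "inj_on f (carrier G)" and im: "f ` carrier G = carrier G"
    and adj: "\<And>g h. g \<in> carrier G \<Longrightarrow> h \<in> carrier G \<Longrightarrow>
      g \<otimes>\<^bsub>G\<^esub> inv\<^bsub>G\<^esub> h \<in> S \<longleftrightarrow> f g \<otimes>\<^bsub>G\<^esub> inv\<^bsub>G\<^esub> f h \<in> T"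
    unfolding bij_betw_def by blast
  let ?k = "\<lparr>iso_verts = f, iso_arcs = map_prod f f, iso_head = snd, iso_tail = fst\<rparr>"
  have "wf_digraph (?C S)"
    by unfold_locales (auto simp: cayley_digraph_def)
  moreover have "inj_on (map_prod f f) (arcs (?C S))"
    using inj by (auto simp: inj_on_def cayley_digraph_def)
  ultimately have "pre_digraph.digraph_isomorphism (?C S) ?k"
    using inj by (auto simp: pre_digraph.digraph_isomorphism_def cayley_digraph_def)
  moreover have "arcs (?C T) = map_prod f f ` arcs (?C S)"
  proof (intro equalityI subsetI)
    fix a assume "a \<in> arcs (?C T)"
    then obtain x y where a: "a = (x, y)" "x \<in> carrier G" "y \<in> carrier G"
      "x \<otimes>\<^bsub>G\<^esub> inv\<^bsub>G\<^esub> y \<in> T"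
      by (auto simp: cayley_digraph_def)
    moreover from a have "x \<in> f ` carrier G" "y \<in> f ` carrier G"
      by (simp_all add: im)
    then obtain g h where "g \<in> carrier G" "h \<in> carrier G" "x = f g" "y = f h"
      by (elim imageE)
    ultimately show "a \<in> map_prod f f ` arcs (?C S)"
      using adj by (auto simp: cayley_digraph_def intro!: image_eqI[of _ _ "(g, h)"])
  next
    fix a assume "a \<in> map_prod f f ` arcs (?C S)"
    then show "a \<in> arcs (?C T)"
      using adj im by (auto simp: cayley_digraph_def)
  qed
  then have "?C T = app_iso ?k (?C S)"
    using im by (simp add: app_iso_def with_proj_def cayley_digraph_def)
  ultimately show ?L
    unfolding digraph_iso_def by blast
qed

end

theory Submission
  imports
    Defs
    "HOL-Combinatorics.Permutations"
    "HOL-Algebra.Sylow"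
    "HOL-Number_Theory.Cong"
begin

text \<open>Let \<open>A\<close> be the automorphism group of \<open>Cay(G,S)\<close> and let \<open>G\<close> act on itself by translations. Following
  Babai, an isomorphism \<open>f\<close> from \<open>Cay(G,S)\<close> to \<open>Cay(G,T)\<close> can be replaced by a group automorphism as soon as the
  regular groups \<open>G\<close> and \<open>f\<^sup>-\<^sup>1 G f\<close> are conjugate in \<open>A\<close>.

  Write these groups as \<open>P \<times> \<langle>z\<rangle>\<close> and \<open>P' \<times> \<langle>z'\<rangle>\<close> with \<open>z\<close> and \<open>z'\<close> of order \<open>q\<close>. Since \<open>|G| < q\<^sup>2\<close>, Sylow's
  theorem allows us to assume that \<open>z\<close> and \<open>z'\<close> commute and have the same orbits. Let \<open>E\<close> consist of the
  automorphisms that commute with \<open>z\<close> and fix all its orbits, and call two points similar if they have the same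
  stabiliser in \<open>E\<close>. The colour of a pair of dissimilar points depends on their \<open>z\<close>-orbits only. Both groups
  normalise \<open>E\<close>, so by Sylow's theorem for \<open>p\<close> we may assume that \<open>P\<close> and \<open>P'\<close> lie in a common \<open>p\<close>-group \<open>R\<close>, which
  leaves invariant a transversal \<open>V\<close> of the \<open>z\<close>-orbits. Elements of \<open>R\<close>, glued along similarity classes, give
  an automorphism conjugating \<open>\<langle>z'\<rangle>\<close> to \<open>\<langle>z\<rangle>\<close>; the delicate case is that of classes meeting \<open>V\<close> in \<open>p\<^sup>2\<close> points.

  Once \<open>z = z'\<close>, it remains to conjugate two regular elementary abelian groups of order \<open>p\<^sup>3\<close> on \<open>V\<close> by
  permutations preserving the induced colouring. By Sylow they generate a \<open>p\<close>-group, and a central element of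
  it lies in both. Similarity with respect to this central element in the role of \<open>z\<close> leaves three cases according to the
  size of the classes, and in each case the groups can be made to share a subgroup of order \<open>p\<^sup>2\<close>.\<close>

text \<open>An element of \<open>E\<close> acts on each orbit of \<open>z\<close> as a power of
  \<open>z\<close>, but the exponent may vary with the orbit. As \<open>z\<close> has prime order,
  an element fixing \<open>v\<close> and moving \<open>w\<close> rotates the whole orbit of
  \<open>w\<close>; this is why colours between dissimilar points only see orbits. Similar points
  always share the exponent. Different automorphisms may thus be used on different classes, and the
  only obstruction to gluing is the colours between classes. The natural candidate on the class of
  \<open>g w\<close> is \<open>g' \<circ> pinv g\<close> with \<open>g \<in> P\<close>,
  \<open>g' \<in> P'\<close> and \<open>g w = g' w\<close>. It is harmless if a class meets
  \<open>V\<close> in at most \<open>p\<close> points, since an element of a \<open>p\<close>-group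
  fixing one of them fixes all, and if there is only one class. On \<open>p ^ 2\<close> points it
  may fix one point and still move others inside blocks of size \<open>p\<close>. Then either the
  drift of the candidate is shown not to affect colours between classes, or a nontrivial point
  stabiliser makes colours inside classes so symmetric that a simpler map works.\<close>

abbreviation pinv :: "('a \<Rightarrow> 'a) \<Rightarrow> 'a \<Rightarrow> 'a" where
  "pinv \<equiv> inv_into UNIV"

text \<open>Permutations of a set are total functions that fix every point outside the set.\<close>

definition perm_grp :: "('a \<Rightarrow> 'a) set \<Rightarrow> bool" where
  "perm_grp A \<longleftrightarrow> id \<in> A \<and> (\<forall>f\<in>A. \<forall>g\<in>A. f \<circ> g \<in> A) \<and> (\<forall>f\<in>A. bij f \<and> pinv f \<in> A)"

definition orb :: "('a \<Rightarrow> 'a) set \<Rightarrow> 'a \<Rightarrow> 'a set" where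
  "orb K v = (\<lambda>g. g v) ` K"

text \<open>For \<open>z\<close> of finite order the nonnegative powers already form a
  group.\<close>

definition cyc :: "('a \<Rightarrow> 'a) \<Rightarrow> ('a \<Rightarrow> 'a) set" where
  "cyc z = range (\<lambda>n. z ^^ n)"

text \<open>The arcs of a Cayley digraph are a colouring by truth values; more colours are needed because the
  colouring induced on a transversal takes functions as values.\<close>

definition Auts :: "'a set \<Rightarrow> ('a \<Rightarrow> 'a \<Rightarrow> 'c) \<Rightarrow> ('a \<Rightarrow> 'a) set" where
  "Auts X col = {f. f permutes X \<and> (\<forall>a\<in>X. \<forall>b\<in>X. col (f a) (f b) = col a b)}"

subsection \<open>Permutation groups\<close>

abbreviation conj_by :: "('a \<Rightarrow> 'a) \<Rightarrow> ('a \<Rightarrow> 'a) set \<Rightarrow> ('a \<Rightarrow> 'a) set" where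
  "conj_by a A \<equiv> (\<lambda>f. a \<circ> f \<circ> pinv a) ` A"

text \<open>Gives access to Lagrange's and Sylow's theorems, which are stated for monoid
  records.\<close>

abbreviation perm_monoid :: "('a \<Rightarrow> 'a) set \<Rightarrow> ('a \<Rightarrow> 'a) monoid" where
  "perm_monoid A \<equiv> \<lparr>carrier = A, mult = (\<circ>), one = id\<rparr>"

lemma pinv_simps:
  assumes "bij f"
  shows "f (pinv f x) = x" "pinv f (f x) = x" "f \<circ> pinv f = id" "pinv f \<circ> f = id"
  using assms by (auto simp: bij_def surj_f_inv_f fun_eq_iff)

lemma pinv_unique:
  assumes "bij f" "f \<circ> g = id"
  shows "pinv f = g"
  using assms by (metis inv_unique_comp bij_def comp_id fun.map_comp id_comp pinv_simps(4))

lemma perm_grp_id: "perm_grp A \<Longrightarrow> id \<in> A"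
  and perm_grp_comp: "perm_grp A \<Longrightarrow> f \<in> A \<Longrightarrow> g \<in> A \<Longrightarrow> f \<circ> g \<in> A"
  and perm_grp_inv: "perm_grp A \<Longrightarrow> f \<in> A \<Longrightarrow> pinv f \<in> A"
  and perm_grp_bij: "perm_grp A \<Longrightarrow> f \<in> A \<Longrightarrow> bij f"
  by (auto simp: perm_grp_def)

lemma perm_grp_pow: "perm_grp A \<Longrightarrow> f \<in> A \<Longrightarrow> f ^^ n \<in> A"
  by (induction n) (auto simp: perm_grp_id perm_grp_comp)

lemma perm_grp_cyc_sub: "perm_grp A \<Longrightarrow> f \<in> A \<Longrightarrow> cyc f \<subseteq> A"
  by (auto simp: cyc_def perm_grp_pow)

lemma perm_grp_simps:
  assumes "perm_grp A" "f \<in> A"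
  shows "f (pinv f x) = x" "pinv f (f x) = x"
  using pinv_simps[OF perm_grp_bij[OF assms]] by auto

lemma perm_grpI:
  assumes "id \<in> A" "\<And>f g. f \<in> A \<Longrightarrow> g \<in> A \<Longrightarrow> f \<circ> g \<in> A" "\<And>f. f \<in> A \<Longrightarrow> bij f"
    "\<And>f. f \<in> A \<Longrightarrow> pinv f \<in> A"
  shows "perm_grp A"
  using assms by (auto simp: perm_grp_def)

text \<open>Left multiplication by \<open>f\<close> is injective on the finite set \<open>B\<close>,
  hence surjective, and so reaches \<open>id\<close>.\<close>

lemma finite_subgroupI:
  assumes A: "perm_grp A" "finite A" and B: "B \<subseteq> A" "id \<in> B" "\<And>f g. f \<in> B \<Longrightarrow> g \<in> B \<Longrightarrow> f \<circ> g \<in> B"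
  shows "perm_grp B"
proof (rule perm_grpI)
  show b: "bij f" if "f \<in> B" for f using perm_grp_bij[OF A(1)] B(1) that by blast
  show "pinv f \<in> B" if f: "f \<in> B" for f
  proof -
    have "inj_on ((\<circ>) f) B" using bij_is_inj[OF b[OF f]] by (auto simp: inj_on_def fun_eq_iff)
    then have "(\<circ>) f ` B = B" using endo_inj_surj[OF finite_subset[OF B(1) A(2)]] B(3)[OF f] by blast
    then obtain g where "g \<in> B" "f \<circ> g = id" using B(2) by (metis imageE)
    then show ?thesis using pinv_unique[OF b[OF f]] by simp
  qed
qed (use B in auto)

lemma perm_grp_group:
  assumes "perm_grp A"
  shows "group (perm_monoid A)"
proof (rule groupI)
  fix x assume "x \<in> carrier (perm_monoid A)"
  then have "x \<in> A" by simp
  then have "pinv x \<in> A" "pinv x \<circ> x = id"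
    using perm_grp_inv[OF assms] pinv_simps(4)[OF perm_grp_bij[OF assms]] by blast+
  then show "\<exists>y\<in>carrier (perm_monoid A).
      y \<otimes>\<^bsub>perm_monoid A\<^esub> x = \<one>\<^bsub>perm_monoid A\<^esub>"
    by (intro bexI[of _ "pinv x"]) simp_all
qed (simp_all add: comp_assoc perm_grp_id[OF assms] perm_grp_comp[OF assms])

lemma m_inv_perm_grp:
  assumes "perm_grp A" "f \<in> A"
  shows "m_inv (perm_monoid A) f = pinv f"
  using assms pinv_simps[OF perm_grp_bij[OF assms]]
  by (intro group.inv_equality[OF perm_grp_group]) (auto simp: perm_grp_inv)

lemma perm_grp_subgroup_iff:
  assumes "perm_grp A" 
  shows "subgroup B (perm_monoid A) \<longleftrightarrow> B \<subseteq> A \<and> perm_grp B"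
proof
  assume S: "subgroup B (perm_monoid A)"
  have sub: "B \<subseteq> A" using subgroup.subset[OF S] by simp
  moreover have "perm_grp B"
  proof (rule perm_grpI)
    show "id \<in> B" using subgroup.one_closed[OF S] by simp
    show "f \<circ> g \<in> B" if "f \<in> B" "g \<in> B" for f g using subgroup.m_closed[OF S that] by simp
    show "bij f" if "f \<in> B" for f using sub that perm_grp_bij[OF assms] by blast
    show "pinv f \<in> B" if "f \<in> B" for f
      using subgroup.m_inv_closed[OF S that] m_inv_perm_grp[OF assms, of f] sub that by (simp add: subset_iff)
  qed
  ultimately show "B \<subseteq> A \<and> perm_grp B" by simp
next
  assume B: "B \<subseteq> A \<and> perm_grp B"
  show "subgroup B (perm_monoid A)"
    using B m_inv_perm_grp[OF assms] perm_grp_id[of B] perm_grp_comp[of B] perm_grp_inv[of B]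
    by (intro subgroup.intro) (simp_all add: subset_iff)
qed

lemma perm_grp_lagrange:
  assumes "perm_grp A" "perm_grp B" "B \<subseteq> A"
  shows "card B dvd card A"
proof -
  have "subgroup B (perm_monoid A)"
    using assms perm_grp_subgroup_iff by blast
  from group.lagrange[OF perm_grp_group[OF assms(1)] this]
  show ?thesis by (metis dvd_triv_right order_def partial_object.select_convs(1))
qed

lemma card_subgroup_prime_power:
  assumes "perm_grp A" "perm_grp B" "B \<subseteq> A" "card A = p ^ n" "prime (p::nat)"
  shows "\<exists>m\<le>n. card B = p ^ m"
  using perm_grp_lagrange[OF assms(1-3)] assms(4,5) divides_primepow_nat by auto

lemma conj_pow:
  assumes "bij a"
  shows "(a \<circ> f \<circ> pinv a) ^^ n = a \<circ> f ^^ n \<circ> pinv a"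
proof (induction n)
  case 0
  then show ?case using pinv_simps[OF assms] by simp
next
  case (Suc n)
  then show ?case using pinv_simps[OF assms] by (simp add: fun_eq_iff)
qed

lemma pinv_comp: "bij f \<Longrightarrow> bij g \<Longrightarrow> pinv (f \<circ> g) = pinv g \<circ> pinv f"
  by (rule o_inv_distrib)

lemma perm_grp_conj:
  assumes "perm_grp A" "bij a"
  shows "perm_grp (conj_by a A)"
proof (rule perm_grpI)
  note a = pinv_simps[OF assms(2)]
  show "id \<in> conj_by a A"
    using perm_grp_id[OF assms(1)] a by (auto intro!: image_eqI[of _ _ id])
  show "f \<circ> g \<in> conj_by a A"
    if fg: "f \<in> conj_by a A" "g \<in> conj_by a A" for f g
  proof -
    from fg obtain f' g' where "f' \<in> A" "g' \<in> A" "f = a \<circ> f' \<circ> pinv a" "g = a \<circ> g' \<circ> pinv a" by auto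
    moreover from this have "f \<circ> g = a \<circ> (f' \<circ> g') \<circ> pinv a" using a by (auto simp: fun_eq_iff)
    ultimately show ?thesis using perm_grp_comp[OF assms(1)] by blast
  qed
  have b: "bij (pinv a)" using assms(2) by (simp add: bij_imp_bij_inv)
  show "bij f" if "f \<in> conj_by a A" for f
    using that b assms(2) perm_grp_bij[OF assms(1)] by (auto intro!: bij_comp)
  show "pinv f \<in> conj_by a A" if f: "f \<in> conj_by a A" for f
  proof -
    from f obtain f' where f': "f' \<in> A" "f = a \<circ> f' \<circ> pinv a" by auto
    have "bij f" using f' b assms(2) perm_grp_bij[OF assms(1) f'(1)] by (auto intro!: bij_comp)
    moreover have "f \<circ> (a \<circ> pinv f' \<circ> pinv a) = id"
      using a perm_grp_simps[OF assms(1) f'(1)] f'(2) by (auto simp: fun_eq_iff)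
    ultimately have "pinv f = a \<circ> pinv f' \<circ> pinv a" by (rule pinv_unique)
    then show ?thesis using perm_grp_inv[OF assms(1) f'(1)] by blast
  qed
qed

lemma card_conj:
  assumes "bij a"
  shows "card (conj_by a A) = card A"
proof (rule card_image, rule inj_onI)
  fix f g assume "a \<circ> f \<circ> pinv a = a \<circ> g \<circ> pinv a"
  then have "pinv a \<circ> (a \<circ> f \<circ> pinv a) \<circ> a = pinv a \<circ> (a \<circ> g \<circ> pinv a) \<circ> a" by simp
  then show "f = g" using pinv_simps[OF assms] by (simp add: fun_eq_iff)
qed

lemma orbI: "g \<in> K \<Longrightarrow> w = g v \<Longrightarrow> w \<in> orb K v"
  by (auto simp: orb_def)

lemma orb_refl: "perm_grp K \<Longrightarrow> v \<in> orb K v"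
  by (rule orbI[OF perm_grp_id]) simp_all

lemma orb_sym:
  assumes "perm_grp K" "v \<in> orb K w"
  shows "w \<in> orb K v"
proof -
  obtain g where "g \<in> K" "v = g w" using assms by (auto simp: orb_def)
  then show ?thesis using perm_grp_simps(2)[OF assms(1)] perm_grp_inv[OF assms(1)]
    by (intro orbI[of "pinv g"]) auto
qed

lemma orb_trans:
  assumes "perm_grp K" "u \<in> orb K v" "v \<in> orb K w"
  shows "u \<in> orb K w"
proof -
  obtain g h where "g \<in> K" "u = g v" "h \<in> K" "v = h w" using assms by (auto simp: orb_def)
  then show ?thesis using perm_grp_comp[OF assms(1)] by (intro orbI[of "g \<circ> h"]) auto
qed

lemma orb_eq:
  assumes "perm_grp K" "w \<in> orb K v"
  shows "orb K w = orb K v"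
  using orb_trans[OF assms(1) _ assms(2)] orb_trans[OF assms(1) _ orb_sym[OF assms]] by (intro equalityI subsetI)

lemma orb_moved:
  assumes "perm_grp K" "k \<in> K"
  shows "k x \<in> orb K y \<longleftrightarrow> x \<in> orb K y"
proof -
  have k: "k x \<in> orb K x" using assms(2) by (rule orbI) simp
  show ?thesis using orb_trans[OF assms(1) k] orb_trans[OF assms(1) orb_sym[OF assms(1) k]] by metis
qed

lemma orb_cyc_iff: "w \<in> orb (cyc z) v \<longleftrightarrow> (\<exists>n. w = (z ^^ n) v)"
  by (auto simp: orb_def cyc_def)

subsection \<open>Actions of groups of prime power order\<close>

text \<open>The action is abstract because the same counting is applied to points, to sets of
  orbits, and to cosets under conjugation or multiplication.\<close>

locale finite_action =
  fixes R :: "('a \<Rightarrow> 'a) set" and act :: "('a \<Rightarrow> 'a) \<Rightarrow> 'e \<Rightarrow> 'e" and E :: "'e set"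
  assumes grp: "perm_grp R" and fin_R: "finite R" and fin_E: "finite E"
    and act_closed: "g \<in> R \<Longrightarrow> x \<in> E \<Longrightarrow> act g x \<in> E"
    and act_id: "x \<in> E \<Longrightarrow> act id x = x"
    and act_comp: "g \<in> R \<Longrightarrow> h \<in> R \<Longrightarrow> x \<in> E \<Longrightarrow> act (g \<circ> h) x = act g (act h x)"
begin

lemma act_inv: "g \<in> R \<Longrightarrow> x \<in> E \<Longrightarrow> act (pinv g) (act g x) = x"
  using act_comp[of "pinv g" g x] perm_grp_inv[OF grp] act_id pinv_simps(4)[OF perm_grp_bij[OF grp]]
  by simp

text \<open>Orbit-stabiliser theorem: \<open>c y\<close> is a chosen element taking \<open>x\<close>
  to \<open>y\<close>, and every element of \<open>R\<close> is uniquely some \<open>c y\<close>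
  composed with an element of the stabiliser of \<open>x\<close>.\<close>

lemma card_orbit_dvd:
  assumes x: "x \<in> E"
  shows "card ((\<lambda>g. act g x) ` R) dvd card R"
proof -
  let ?O = "(\<lambda>g. act g x) ` R"
  let ?S = "{g \<in> R. act g x = x}"
  have "\<forall>y\<in>?O. \<exists>g. g \<in> R \<and> act g x = y" by auto
  then obtain c where c: "\<And>y. y \<in> ?O \<Longrightarrow> c y \<in> R \<and> act (c y) x = y" by metis
  have "bij_betw (\<lambda>(y, s). c y \<circ> s) (?O \<times> ?S) R"
  proof (rule bij_betwI')
    fix a b assume ab: "a \<in> ?O \<times> ?S" "b \<in> ?O \<times> ?S"
    obtain y s y' s' where [simp]: "a = (y, s)" "b = (y', s')" by fastforce
    have y: "y \<in> ?O" "y' \<in> ?O" and s: "s \<in> R" "act s x = x" "s' \<in> R" "act s' x = x" using ab by auto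
    have "y = y' \<and> s = s'" if eq: "c y \<circ> s = c y' \<circ> s'"
    proof -
      have "act (c y \<circ> s) x = y" "act (c y' \<circ> s') x = y'"
        using c[OF y(1)] c[OF y(2)] s act_comp x by auto
      then have "y = y'" using eq by simp
      moreover have "inj (c y)" using c[OF y(1)] perm_grp_bij[OF grp] bij_is_inj by blast
      ultimately show ?thesis using eq by (auto simp: fun_eq_iff inj_def)
    qed
    then show "((case a of (y, s) \<Rightarrow> c y \<circ> s) = (case b of (y, s) \<Rightarrow> c y \<circ> s)) = (a = b)" by auto
  next
    fix a assume "a \<in> ?O \<times> ?S"
    then show "(case a of (y, s) \<Rightarrow> c y \<circ> s) \<in> R" using c perm_grp_comp[OF grp] by auto
  next
    fix g assume g: "g \<in> R"
    let ?y = "act g x"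
    have y: "?y \<in> ?O" using g by auto
    have cy: "c ?y \<in> R" "act (c ?y) x = ?y" using c[OF y] by auto
    have "act (pinv (c ?y) \<circ> g) x = x"
      using act_inv[OF cy(1) x] act_comp[OF perm_grp_inv[OF grp cy(1)] g x] cy(2) by simp
    moreover have "c ?y \<circ> (pinv (c ?y) \<circ> g) = g"
      using pinv_simps(3)[OF perm_grp_bij[OF grp cy(1)]] by (simp add: comp_assoc[symmetric])
    moreover have "pinv (c ?y) \<circ> g \<in> R" using cy g grp perm_grp_comp perm_grp_inv by blast
    ultimately show "\<exists>a\<in>?O \<times> ?S. g = (case a of (y, s) \<Rightarrow> c y \<circ> s)"
      using y by (intro bexI[of _ "(?y, pinv (c ?y) \<circ> g)"]) auto
  qed
  then have "card R = card (?O \<times> ?S)" by (rule bij_betw_same_card[symmetric])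
  then show ?thesis by (simp add: card_cartesian_product)
qed

lemma orbit_eq:
  assumes "x \<in> E" "y \<in> (\<lambda>g. act g x) ` R"
  shows "(\<lambda>g. act g y) ` R = (\<lambda>g. act g x) ` R"
proof -
  obtain h where h: "h \<in> R" "y = act h x" using assms by auto
  have "act g y \<in> (\<lambda>g. act g x) ` R" if "g \<in> R" for g
    using that h act_comp[OF that h(1) assms(1)] perm_grp_comp[OF grp that h(1)] by (metis image_eqI)
  moreover have "act g x \<in> (\<lambda>g. act g y) ` R" if "g \<in> R" for g
  proof -
    have y: "y \<in> E" using h act_closed assms(1) by simp
    have "act g x = act (g \<circ> pinv h) y"
      using act_comp[OF that perm_grp_inv[OF grp h(1)] y] act_inv[OF h(1) assms(1)] h(2) by simp
    then show ?thesis using that h perm_grp_comp[OF grp] perm_grp_inv[OF grp] by blast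
  qed
  ultimately show ?thesis by blast
qed

text \<open>The moved points form a union of orbits whose sizes are powers of \<open>p\<close> other
  than 1.\<close>

lemma moved_card_dvd:
  assumes "prime (p::nat)" "card R = p ^ n"
  shows "p dvd card {x \<in> E. \<exists>g\<in>R. act g x \<noteq> x}"
proof -
  let ?M = "{x \<in> E. \<exists>g\<in>R. act g x \<noteq> x}"
  let ?O = "\<lambda>x. (\<lambda>g. act g x) ` R"
  have refl: "x \<in> ?O x" if "x \<in> E" for x using perm_grp_id[OF grp] act_id[OF that] by force
  have sub: "?O x \<subseteq> ?M" if x: "x \<in> ?M" for x
  proof
    fix y assume y: "y \<in> ?O x"
    then have yE: "y \<in> E" using act_closed x by auto
    show "y \<in> ?M"
    proof (rule ccontr)
      assume "y \<notin> ?M"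
      then have "?O y \<subseteq> {y}" using yE by auto
      then have "?O x \<subseteq> {y}" using orbit_eq[OF _ y] x by auto
      moreover have "x \<in> ?O x" using refl x by auto
      ultimately show False using x by auto
    qed
  qed
  have U: "?M = \<Union> (?O ` ?M)" using sub refl by blast
  have "p dvd card (\<Union> (?O ` ?M))"
  proof (rule dvd_partition)
    show "finite (\<Union> (?O ` ?M))" unfolding U[symmetric] using fin_E by simp
    show "\<forall>c\<in>?O ` ?M. p dvd card c"
    proof
      fix c assume "c \<in> ?O ` ?M"
      then obtain x where x: "x \<in> ?M" "c = ?O x" by auto
      have "card c dvd p ^ n" using card_orbit_dvd x assms by auto
      then obtain k where k: "card c = p ^ k" using assms(1) divides_primepow_nat by blast
      have "x \<in> c" using refl x by auto
      moreover obtain g where "g \<in> R" "act g x \<noteq> x" using x by auto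
      moreover from this have "act g x \<in> c" using x by auto
      ultimately have "card c \<noteq> 1" by (auto simp: card_1_singleton_iff)
      then show "p dvd card c" using k by (cases k) auto
    qed
    show "\<forall>c1\<in>?O ` ?M. \<forall>c2\<in>?O ` ?M. c1 \<noteq> c2 \<longrightarrow> c1 \<inter> c2 = {}"
    proof (intro ballI impI)
      fix c1 c2 assume c: "c1 \<in> ?O ` ?M" "c2 \<in> ?O ` ?M" "c1 \<noteq> c2"
      show "c1 \<inter> c2 = {}"
      proof (rule ccontr)
        assume "c1 \<inter> c2 \<noteq> {}"
        then obtain y where y: "y \<in> c1" "y \<in> c2" by blast
        obtain x1 x2 where x: "x1 \<in> E" "x2 \<in> E" "c1 = ?O x1" "c2 = ?O x2" using c by blast
        have "c1 = ?O y" using orbit_eq[OF x(1)] y(1) unfolding x(3) by simp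
        moreover have "c2 = ?O y" using orbit_eq[OF x(2)] y(2) unfolding x(4) by simp
        ultimately have "c1 = c2" by simp
        then show False using c by simp
      qed
    qed
  qed
  then show ?thesis unfolding U[symmetric] .
qed

lemma ex_fixed:
  assumes "prime (p::nat)" "card R = p ^ n" "\<not> p dvd card E"
  obtains x where "x \<in> E" "\<And>g. g \<in> R \<Longrightarrow> act g x = x"
proof -
  have "{x \<in> E. \<exists>g\<in>R. act g x \<noteq> x} \<noteq> E"
    using moved_card_dvd[OF assms(1,2)] assms(3) by (intro notI) simp
  then show ?thesis using that by blast
qed

lemma ex_other_fixed:
  assumes "prime (p::nat)" "card R = p ^ n" "p dvd card E" "x0 \<in> E" "\<And>g. g \<in> R \<Longrightarrow> act g x0 = x0"
  obtains x where "x \<in> E" "x \<noteq> x0" "\<And>g. g \<in> R \<Longrightarrow> act g x = x"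
proof -
  let ?M = "{x \<in> E. \<exists>g\<in>R. act g x \<noteq> x}"
  have "?M \<noteq> E - {x0}"
  proof
    assume "?M = E - {x0}"
    then have d: "p dvd card (E - {x0})" using moved_card_dvd[OF assms(1,2)] by simp
    have "card E = card (E - {x0}) + 1" using card_Suc_Diff1[OF fin_E assms(4)] by simp
    then have "p dvd card (E - {x0}) + 1" using assms(3) by simp
    then have "p dvd 1" using dvd_add_right_iff[OF d, of 1] by blast
    then show False using assms(1) by auto
  qed
  moreover have "?M \<subseteq> E - {x0}" using assms(5) by auto
  ultimately obtain x where "x \<in> E - {x0}" "x \<notin> ?M" by blast
  then show ?thesis using that[of x] by simp
qed

lemma all_fixed:
  assumes "prime (p::nat)" "card R = p ^ n" "card E < p" "x \<in> E" "g \<in> R"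
  shows "act g x = x"
proof -
  let ?O = "(\<lambda>g. act g x) ` R"
  have "card ?O dvd p ^ n" using card_orbit_dvd assms by auto
  then obtain k where k: "card ?O = p ^ k" using assms(1) divides_primepow_nat by blast
  have "?O \<subseteq> E" using assms act_closed by auto
  then have "card ?O < p" using card_mono[OF fin_E] assms(3) by (meson le_less_trans)
  have "k = 0" 
  proof (rule ccontr)
    assume "k \<noteq> 0"
    then have "p ^ 1 \<le> p ^ k" using prime_gt_0_nat[OF assms(1)] by (intro power_increasing) auto
    then show False using k \<open>card ?O < p\<close> by simp
  qed
  then have "card ?O = 1" using k by simp
  then obtain y where "?O = {y}" by (auto simp: card_1_singleton_iff)
  moreover have "x \<in> ?O" using perm_grp_id[OF grp] act_id[OF assms(4)] by force
  moreover have "act g x \<in> ?O" using assms by auto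
  ultimately show ?thesis by simp
qed

end

text \<open>\<open>R\<close> acts by conjugation on the cosets of \<open>K\<close> in
  \<open>N\<close>. Their number is a power of \<open>p\<close> other than 1 and \<open>K\<close>
  itself is fixed, so a second coset is fixed, and any \<open>f\<close> in it commutes with
  \<open>R\<close> modulo \<open>K\<close>. For \<open>N = R\<close> and \<open>K = {id}\<close>
  this is the nontriviality of the centre.\<close>

lemma central_mod:
  assumes R: "perm_grp R" "finite R" "card R = p ^ n" "prime (p::nat)"
    and N: "perm_grp N" "N \<subseteq> R" "\<And>r f. r \<in> R \<Longrightarrow> f \<in> N \<Longrightarrow> r \<circ> f \<circ> pinv r \<in> N"
    and K: "perm_grp K" "K \<subseteq> N" "K \<noteq> N" "\<And>r f. r \<in> R \<Longrightarrow> f \<in> K \<Longrightarrow> r \<circ> f \<circ> pinv r \<in> K"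
  obtains f where "f \<in> N" "f \<notin> K" "\<And>r. r \<in> R \<Longrightarrow> \<exists>e\<in>K. r \<circ> f = e \<circ> f \<circ> r"
proof -
  let ?G = "(perm_monoid N)"
  let ?c = "\<lambda>f. (\<lambda>e. e \<circ> f) ` K"
  let ?C = "?c ` N"
  let ?act = "\<lambda>r C. conj_by r C"
  have rc: "rcosets\<^bsub>?G\<^esub> K = ?C" by (auto simp: RCOSETS_def r_coset_def)
  have finN: "finite N" using N(2) R(2) finite_subset by blast
  have "subgroup K ?G" using perm_grp_subgroup_iff[OF N(1)] K by blast
  from group.lagrange[OF perm_grp_group[OF N(1)] this]
  have "card ?C * card K = card N" unfolding rc by (simp add: order_def)
  then have "card ?C dvd card R" using perm_grp_lagrange[OF R(1) N(1,2)] by (metis dvd_mult_left)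
  then obtain k where k: "card ?C = p ^ k" using R(3,4) divides_primepow_nat by auto
  have KC: "K \<in> ?C" using perm_grp_id[OF N(1)] by (intro image_eqI[of _ _ id]) auto
  obtain f0 where f0: "f0 \<in> N" "f0 \<notin> K" using K(2,3) by blast
  have "f0 \<in> ?c f0" using perm_grp_id[OF K(1)] by (intro image_eqI[of _ _ id]) auto
  then have "?c f0 \<noteq> K" using f0(2) by blast
  moreover have "?c f0 \<in> ?C" using f0(1) by (rule imageI)
  ultimately have "card ?C \<noteq> 1" using KC by (metis card_1_singletonE singletonD)
  then have pC: "p dvd card ?C" using k by (cases k) auto
  have conj: "?act r (?c f) = ?c (r \<circ> f \<circ> pinv r)" if r: "r \<in> R" and f: "f \<in> N" for r f
  proof -
    note rs = pinv_simps[OF perm_grp_bij[OF R(1) r]]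
    have 1: "r \<circ> (e \<circ> f) \<circ> pinv r = (r \<circ> e \<circ> pinv r) \<circ> (r \<circ> f \<circ> pinv r)" for e
      using rs by (simp add: fun_eq_iff)
    have 2: "e \<circ> (r \<circ> f \<circ> pinv r) = r \<circ> ((pinv r \<circ> e \<circ> pinv (pinv r)) \<circ> f) \<circ> pinv r" for e
      using rs pinv_unique[OF bij_imp_bij_inv[OF perm_grp_bij[OF R(1) r]], of r] by (simp add: fun_eq_iff)
    show ?thesis
    proof (intro equalityI subsetI)
      fix x assume "x \<in> ?act r (?c f)"
      then obtain e where e: "e \<in> K" "x = r \<circ> (e \<circ> f) \<circ> pinv r" by blast
      then show "x \<in> ?c (r \<circ> f \<circ> pinv r)" using 1[of e] K(4)[OF r e(1)] by blast
    next
      fix x assume "x \<in> ?c (r \<circ> f \<circ> pinv r)"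
      then obtain e where e: "e \<in> K" "x = e \<circ> (r \<circ> f \<circ> pinv r)" by blast
      show "x \<in> ?act r (?c f)" unfolding e(2) 2[of e]
        using K(4)[OF perm_grp_inv[OF R(1) r] e(1)] by blast
    qed
  qed
  interpret finite_action R ?act ?C
  proof
    show "perm_grp R" "finite R" "finite ?C" using R finN by auto
    show "?act g x \<in> ?C" if "g \<in> R" "x \<in> ?C" for g x using that conj N(3) by auto
    show "?act id x = x" if "x \<in> ?C" for x by simp
    show "?act (g \<circ> h) x = ?act g (?act h x)" if "g \<in> R" "h \<in> R" for g h x
      using pinv_comp[OF perm_grp_bij[OF R(1) that(1)] perm_grp_bij[OF R(1) that(2)]]
      by (simp add: image_image comp_assoc)
  qed
  have fixK: "?act g K = K" if "g \<in> R" for g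
    using conj[OF that perm_grp_id[OF N(1)]] pinv_simps[OF perm_grp_bij[OF R(1) that]] by simp
  obtain C where C: "C \<in> ?C" "C \<noteq> K" "\<And>g. g \<in> R \<Longrightarrow> ?act g C = C"
    by (rule ex_other_fixed[OF R(4,3) pC KC fixK], assumption, rule that)
  obtain f where f: "f \<in> N" "C = ?c f" using C(1) by (rule imageE)
  have fC: "f \<in> C" unfolding f(2) using perm_grp_id[OF K(1)] by (intro image_eqI[of _ _ id]) auto
  have "f \<notin> K"
  proof
    assume fK: "f \<in> K"
    have "?c f = K"
    proof (intro equalityI subsetI)
      fix x assume "x \<in> ?c f" then show "x \<in> K" using fK perm_grp_comp[OF K(1)] by blast
    next
      fix x assume x: "x \<in> K"
      have "x = (x \<circ> pinv f) \<circ> f" using pinv_simps[OF perm_grp_bij[OF K(1) fK]] by (simp add: fun_eq_iff)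
      then show "x \<in> ?c f" using perm_grp_comp[OF K(1) x perm_grp_inv[OF K(1) fK]] by blast
    qed
    then show False using C(2) f(2) by simp
  qed
  moreover have "\<exists>e\<in>K. r \<circ> f = e \<circ> f \<circ> r" if r: "r \<in> R" for r
  proof -
    have "r \<circ> f \<circ> pinv r \<in> C" using C(3)[OF r] fC by blast
    then obtain e where e: "e \<in> K" "r \<circ> f \<circ> pinv r = e \<circ> f" unfolding f(2) by blast
    have "r \<circ> f = r \<circ> f \<circ> pinv r \<circ> r"
      using pinv_simps[OF perm_grp_bij[OF R(1) r]] by (simp add: fun_eq_iff)
    then show ?thesis using e by metis
  qed
  ultimately show ?thesis using that f(1) by blast
qed

section \<open>Semiregular groups, blocks and Sylow conjugacy\<close>

lemma card_orb_free:
  assumes "\<And>k. k \<in> K \<Longrightarrow> k x = x \<Longrightarrow> k = id" "perm_grp K"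
  shows "card (orb K x) = card K"
proof -
  have "inj_on (\<lambda>k. k x) K"
  proof (rule inj_onI)
    fix k l assume kl: "k \<in> K" "l \<in> K" "k x = l x"
    then have "(pinv l \<circ> k) x = x" using perm_grp_simps[OF assms(2) kl(2)] by simp
    then have "pinv l \<circ> k = id" using assms(1) perm_grp_comp[OF assms(2) perm_grp_inv[OF assms(2) kl(2)] kl(1)] by blast
    then have "l \<circ> (pinv l \<circ> k) = l" by simp
    then show "k = l" using pinv_simps[OF perm_grp_bij[OF assms(2) kl(2)]] by (simp add: fun_eq_iff)
  qed
  then show ?thesis unfolding orb_def by (rule card_image)
qed

lemma card_free_orbits:
  assumes K: "perm_grp K" and X: "finite X" "\<And>k x. k \<in> K \<Longrightarrow> x \<in> X \<Longrightarrow> k x \<in> X"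
    and free: "\<And>k x. k \<in> K \<Longrightarrow> x \<in> X \<Longrightarrow> k x = x \<Longrightarrow> k = id"
  shows "card K * card (orb K ` X) = card X"
proof -
  have U: "\<Union> (orb K ` X) = X"
    using X(2) orb_refl[OF K] by (auto simp: orb_def)
  have "card K * card (orb K ` X) = card (\<Union> (orb K ` X))"
  proof (rule card_partition)
    show "finite (orb K ` X)" using X by simp
    show "finite (\<Union> (orb K ` X))" unfolding U by (rule X)
    show "card c = card K" if "c \<in> orb K ` X" for c
      using that card_orb_free[OF free K] by auto
    show "c1 \<inter> c2 = {}" if c: "c1 \<in> orb K ` X" "c2 \<in> orb K ` X" "c1 \<noteq> c2" for c1 c2
    proof (rule ccontr)
      assume "c1 \<inter> c2 \<noteq> {}"
      then obtain y where y: "y \<in> c1" "y \<in> c2" by blast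
      obtain x1 x2 where x: "c1 = orb K x1" "c2 = orb K x2" using c by blast
      have "c1 = orb K y" "c2 = orb K y"
        using orb_eq[OF K, of y x1] orb_eq[OF K, of y x2] y unfolding x by simp_all
      then show False using c(3) by simp
    qed
  qed
  then show ?thesis unfolding U .
qed

lemma image_orb:
  assumes R: "perm_grp R" and r: "r \<in> R" and x: "x \<in> X"
    and RX: "\<And>r x. r \<in> R \<Longrightarrow> x \<in> X \<Longrightarrow> r x \<in> X"
    and KX: "\<And>k x. k \<in> K \<Longrightarrow> x \<in> X \<Longrightarrow> k x \<in> X"
    and eq: "\<And>r k x. r \<in> R \<Longrightarrow> k \<in> K \<Longrightarrow> x \<in> X \<Longrightarrow> r (k x) \<in> orb K (r x)"
  shows "r ` orb K x = orb K (r x)"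
proof (intro equalityI subsetI)
  fix y assume "y \<in> r ` orb K x"
  then show "y \<in> orb K (r x)" using eq[OF r _ x] by (auto simp: orb_def)
next
  fix y assume "y \<in> orb K (r x)"
  then obtain k where k: "k \<in> K" "y = k (r x)" by (auto simp: orb_def)
  have "pinv r y \<in> orb K (pinv r (r x))" unfolding k(2)
    by (rule eq[OF perm_grp_inv[OF R r] k(1) RX[OF r x]])
  then have "pinv r y \<in> orb K x" using perm_grp_simps[OF R r] by simp
  then show "y \<in> r ` orb K x" using perm_grp_simps[OF R r] by (intro image_eqI[of _ _ "pinv r y"]) auto
qed

text \<open>The orbits of \<open>K\<close> are at most \<open>p\<close> blocks for \<open>R\<close>.
  The elements preserving the block of \<open>w\<close> form a \<open>p\<close>-group acting on
  fewer than \<open>p\<close> other blocks, hence trivially. With \<open>K = {id}\<close> this says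
  that in a \<open>p\<close>-group acting on at most \<open>p\<close> points, an element fixing one
  point fixes all.\<close>

lemma block_fix:
  assumes R: "perm_grp R" "finite R" "card R = p ^ n" "prime (p::nat)"
    and K: "perm_grp K" and X: "finite X" "\<And>k x. k \<in> K \<Longrightarrow> x \<in> X \<Longrightarrow> k x \<in> X"
    and free: "\<And>k x. k \<in> K \<Longrightarrow> x \<in> X \<Longrightarrow> k x = x \<Longrightarrow> k = id"
    and le: "card X \<le> p * card K"
    and RX: "\<And>r x. r \<in> R \<Longrightarrow> x \<in> X \<Longrightarrow> r x \<in> X"
    and eq: "\<And>r k x. r \<in> R \<Longrightarrow> k \<in> K \<Longrightarrow> x \<in> X \<Longrightarrow> r (k x) \<in> orb K (r x)"
    and r0: "r0 \<in> R" "w \<in> X" "r0 w \<in> orb K w" and y: "y \<in> X"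
  shows "r0 y \<in> orb K y"
proof -
  have img: "r ` orb K x = orb K (r x)" if "r \<in> R" "x \<in> X" for r x
    by (rule image_orb[where R = R and X = X]) (use that R(1) RX X(2) eq in auto)
  let ?R = "{r \<in> R. r w \<in> orb K w}"
  \<comment> \<open>Leaving out the block of \<open>w\<close> brings the number of blocks below
    \<open>p\<close>, as \<open>all_fixed\<close> requires.\<close>
  let ?E = "orb K ` X - {orb K w}"
  have blk: "r w \<in> orb K w \<longleftrightarrow> r ` orb K w = orb K w" if "r \<in> R" for r
    using img[OF that r0(2)] orb_eq[OF K] orb_refl[OF K] by metis
  have gR: "perm_grp ?R"
  proof (rule finite_subgroupI[OF R(1,2)])
    show "id \<in> ?R" using perm_grp_id[OF R(1)] orb_refl[OF K] by simp
    show "f \<circ> g \<in> ?R" if fg: "f \<in> ?R" "g \<in> ?R" for f g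
    proof -
      have c: "f \<circ> g \<in> R" using perm_grp_comp[OF R(1)] fg by simp
      have "(f \<circ> g) ` orb K w = f ` (g ` orb K w)" by (rule image_comp[symmetric])
      also have "\<dots> = orb K w" using blk[of f] blk[of g] fg by simp
      finally show ?thesis using blk[OF c] c by (intro CollectI conjI) simp_all
    qed
  qed auto
  obtain m where m: "card ?R = p ^ m" using card_subgroup_prime_power[OF R(1) gR _ R(3,4)] by auto
  interpret finite_action ?R "\<lambda>r B. r ` B" ?E
  proof
    show "perm_grp ?R" by (rule gR)
    show "finite ?R" "finite ?E" using R X by auto
    show "g ` B \<in> ?E" if g: "g \<in> ?R" and B: "B \<in> ?E" for g B
    proof -
      obtain x where x: "x \<in> X" "B = orb K x" using B by blast
      have "g ` B = orb K (g x)" using img[of g x] g x by simp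
      moreover have "g x \<in> X" using RX g x by simp
      moreover have "g ` B \<noteq> orb K w"
      proof
        assume "g ` B = orb K w"
        moreover have "g ` orb K w = orb K w" using g blk[of g] by simp
        ultimately have "g ` B = g ` orb K w" by simp
        then have "B = orb K w" using perm_grp_bij[OF gR g] by (simp add: inj_image_eq_iff bij_is_inj)
        then show False using B by simp
      qed
      ultimately show ?thesis by blast
    qed
    show "id ` B = B" for B :: "'a set" by simp
    show "(g \<circ> h) ` B = g ` h ` B" for g h and B :: "'a set" by (simp add: image_comp)
  qed
  have "card K * card (orb K ` X) = card X" by (rule card_free_orbits[OF K X(1)]) (use X(2) free in auto)
  moreover have "card K > 0"
  proof -
    have "orb K w \<subseteq> X" using X(2) r0(2) by (auto simp: orb_def)
    then have "finite (orb K w)" using X(1) finite_subset by blast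
    then have "card (orb K w) > 0" using orb_refl[OF K, of w] by (auto simp: card_gt_0_iff)
    moreover have "card (orb K w) = card K" by (rule card_orb_free[OF _ K]) (use free r0(2) in blast)
    ultimately show ?thesis by simp
  qed
  ultimately have "card (orb K ` X) \<le> p" using le by (metis mult.commute mult_le_cancel1)
  moreover have "card (orb K ` X) = Suc (card ?E)" using X(1) r0(2) by (intro card_Suc_Diff1[symmetric]) auto
  ultimately have "card ?E < p" by simp
  from all_fixed[OF R(4) m this, of "orb K y" r0]
  have "r0 ` orb K y = orb K y"
    using r0 y blk[of r0] by (cases "orb K y = orb K w") auto
  then show ?thesis using orb_refl[OF K] by blast
qed

text \<open>A Sylow subgroup \<open>S\<close> has index prime to \<open>p\<close>, so a
  \<open>p\<close>-subgroup acting on its cosets by right multiplication fixes some coset of an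
  element \<open>g\<close>, and \<open>g\<close> conjugates it into \<open>S\<close>. Conjugating
  back by \<open>pinv g1\<close> makes \<open>R\<close> contain \<open>Y1\<close> itself.\<close>

lemma sylow_conj:
  assumes A: "perm_grp A" "finite A" "prime (p::nat)"
    and Y1: "perm_grp Y1" "Y1 \<subseteq> A" "card Y1 = p ^ n1"
    and Y2: "perm_grp Y2" "Y2 \<subseteq> A" "card Y2 = p ^ n2"
  obtains g R n where "g \<in> A" "perm_grp R" "R \<subseteq> A" "card R = p ^ n" "Y1 \<subseteq> R"
    "\<And>y. y \<in> Y2 \<Longrightarrow> g \<circ> y \<circ> pinv g \<in> R"
proof -
  let ?G = "(perm_monoid A)"
  have "card A \<noteq> 0" using A(2) perm_grp_id[OF A(1)] by auto
  then obtain m where m: "card A = p ^ multiplicity p (card A) * m" "\<not> p dvd m"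
    using multiplicity_decompose'[of "card A" p] A(3) by (metis not_prime_unit)
  define k where "k = multiplicity p (card A)"
  have "\<exists>S. subgroup S ?G \<and> card S = p ^ k"
    using A m(1) perm_grp_group[OF A(1)] unfolding k_def
    by (intro sylow_thm[where m = m]) (simp_all add: order_def)
  then obtain S where S0: "subgroup S ?G" and S: "card S = p ^ k" by blast
  have S1: "perm_grp S" "S \<subseteq> A" using perm_grp_subgroup_iff[OF A(1)] S0 by blast+
  let ?c = "\<lambda>f. (\<lambda>e. e \<circ> f) ` S"
  let ?C = "?c ` A"
  have "card (rcosets\<^bsub>?G\<^esub> S) * card S = card A"
    using group.lagrange[OF perm_grp_group[OF A(1)] S0] by (simp add: order_def)
  moreover have "rcosets\<^bsub>?G\<^esub> S = ?C" by (auto simp: RCOSETS_def r_coset_def)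
  ultimately have "card ?C * p ^ k = p ^ k * m" using S m(1) unfolding k_def by simp
  then have "card ?C = m" using prime_gt_0_nat[OF A(3)] by simp
  then have nd: "\<not> p dvd card ?C" using m by simp
  have main: "\<exists>g\<in>A. \<forall>y\<in>Y. g \<circ> y \<circ> pinv g \<in> S" if Y: "perm_grp Y" "Y \<subseteq> A" "card Y = p ^ i" for Y i
  proof -
    \<comment> \<open>The inverse turns right multiplication into a left action.\<close>
    let ?act = "\<lambda>y C. (\<lambda>f. f \<circ> pinv y) ` C"
    interpret finite_action Y ?act ?C
    proof
      show "perm_grp Y" "finite Y" "finite ?C" using Y A finite_subset by auto
      show "?act y C \<in> ?C" if y: "y \<in> Y" and C: "C \<in> ?C" for y C
      proof -
        obtain f where f: "f \<in> A" "C = ?c f" using C by blast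
        have "?act y C = ?c (f \<circ> pinv y)" unfolding f(2) by (simp add: image_image comp_assoc)
        moreover have "f \<circ> pinv y \<in> A"
          using perm_grp_comp[OF A(1) f(1)] perm_grp_inv[OF A(1)] y Y(2) by blast
        ultimately show ?thesis by blast
      qed
      show "?act id x = x" for x by simp
      show "?act (g \<circ> h) x = ?act g (?act h x)" if "g \<in> Y" "h \<in> Y" for g h x
        using pinv_comp[OF perm_grp_bij[OF Y(1) that(1)] perm_grp_bij[OF Y(1) that(2)]]
        by (simp add: image_image comp_assoc)
    qed
    obtain C where C: "C \<in> ?C" "\<And>y. y \<in> Y \<Longrightarrow> ?act y C = C"
      by (rule ex_fixed[OF A(3) Y(3) nd], rule that)
    obtain g where g: "g \<in> A" "C = ?c g" using C(1) by (rule imageE)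
    have "g \<circ> y \<circ> pinv g \<in> S" if y: "y \<in> Y" for y
    proof -
      have "g \<in> C" unfolding g(2) using perm_grp_id[OF S1(1)] by (intro image_eqI[of _ _ id]) auto
      then have "g \<circ> pinv (pinv y) \<in> C" using C(2)[OF perm_grp_inv[OF Y(1) y]] by blast
      then obtain e where e: "e \<in> S" "g \<circ> pinv (pinv y) = e \<circ> g" unfolding g(2) by blast
      have "pinv (pinv y) = y" using perm_grp_bij[OF Y(1) y] by (rule inv_inv_eq)
      then have "g \<circ> y \<circ> pinv g = e \<circ> (g \<circ> pinv g)" using e(2) by (simp add: comp_assoc[symmetric])
      then show ?thesis using e(1) pinv_simps[OF perm_grp_bij[OF A(1) g(1)]] by simp
    qed
    then show ?thesis using g(1) by blast
  qed
  obtain g1 where g1: "g1 \<in> A" "\<And>y. y \<in> Y1 \<Longrightarrow> g1 \<circ> y \<circ> pinv g1 \<in> S" using main[OF Y1] by blast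
  obtain g2 where g2: "g2 \<in> A" "\<And>y. y \<in> Y2 \<Longrightarrow> g2 \<circ> y \<circ> pinv g2 \<in> S" using main[OF Y2] by blast
  note b1 = perm_grp_bij[OF A(1) g1(1)] and b2 = perm_grp_bij[OF A(1) g2(1)]
  have i1: "pinv g1 \<in> A" and bi1: "bij (pinv g1)" and ii: "pinv (pinv g1) = g1"
    using perm_grp_inv[OF A(1) g1(1)] bij_imp_bij_inv[OF b1] inv_inv_eq[OF b1] by auto
  let ?R = "conj_by (pinv g1) S"
  have "pinv g1 \<circ> g2 \<in> A" using perm_grp_comp[OF A(1) i1 g2(1)] .
  moreover have "perm_grp ?R" by (rule perm_grp_conj[OF S1(1) bi1])
  moreover have "?R \<subseteq> A"
  proof
    fix x assume "x \<in> ?R"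
    then obtain f where f: "f \<in> S" "x = pinv g1 \<circ> f \<circ> g1" unfolding ii by blast
    then have "f \<in> A" using S1(2) by blast
    then show "x \<in> A" unfolding f(2) using i1 g1(1) perm_grp_comp[OF A(1)] by metis
  qed
  moreover have "card ?R = p ^ k" using card_conj[OF bi1, of S] S by simp
  moreover have "Y1 \<subseteq> ?R"
  proof
    fix y assume "y \<in> Y1"
    from g1(2)[OF this] show "y \<in> ?R" unfolding ii
      by (rule rev_image_eqI) (use pinv_simps[OF b1] in \<open>simp add: fun_eq_iff\<close>)
  qed
  moreover have "(pinv g1 \<circ> g2) \<circ> y \<circ> pinv (pinv g1 \<circ> g2) \<in> ?R" if "y \<in> Y2" for y
  proof -
    have "pinv (pinv g1 \<circ> g2) = pinv g2 \<circ> g1" using pinv_comp[OF bi1 b2] ii by simp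
    then show ?thesis unfolding ii
      by (intro rev_image_eqI[OF g2(2)[OF that]]) (simp add: comp_assoc)
  qed
  ultimately show ?thesis using that by blast
qed

subsection \<open>Automorphisms of coloured relations\<close>

lemma Auts_permutes: "f \<in> Auts X col \<Longrightarrow> f permutes X"
  and Auts_col: "f \<in> Auts X col \<Longrightarrow> a \<in> X \<Longrightarrow> b \<in> X \<Longrightarrow> col (f a) (f b) = col a b"
  by (auto simp: Auts_def)

lemma Auts_in: "f \<in> Auts X col \<Longrightarrow> f a \<in> X \<longleftrightarrow> a \<in> X"
  using permutes_in_image[OF Auts_permutes] .

lemma perm_grp_Auts: "perm_grp (Auts X col)"
proof (rule perm_grpI)
  show "id \<in> Auts X col" by (simp add: Auts_def)
  show "f \<circ> g \<in> Auts X col" if "f \<in> Auts X col" "g \<in> Auts X col" for f g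
    using that permutes_compose[of g X f] by (auto simp: Auts_def permutes_in_image)
  show "bij f" if "f \<in> Auts X col" for f using that permutes_bij by (auto simp: Auts_def)
  show "pinv f \<in> Auts X col" if f: "f \<in> Auts X col" for f
  proof -
    have i: "pinv f permutes X" using permutes_inv[OF Auts_permutes[OF f]] .
    have "col (pinv f a) (pinv f b) = col a b" if "a \<in> X" "b \<in> X" for a b
    proof -
      have "col (f (pinv f a)) (f (pinv f b)) = col (pinv f a) (pinv f b)"
        by (rule Auts_col[OF f]) (use that permutes_in_image[OF i] in auto)
      then show ?thesis using permutes_inverses[OF Auts_permutes[OF f]] by simp
    qed
    then show ?thesis using i by (auto simp: Auts_def)
  qed
qed

lemma finite_Auts: "finite X \<Longrightarrow> finite (Auts X col)"
  by (rule finite_subset[OF _ finite_permutations[of X]]) (auto simp: Auts_def)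

text \<open>Colours inside a class are preserved because one automorphism serves the whole class,
  and injectivity holds because \<open>F x x\<close> stays in the class of \<open>x\<close>. Only
  colours between classes need an argument in each application.\<close>

lemma glue:
  assumes X: "finite X" and F: "\<And>x. x \<in> X \<Longrightarrow> F x \<in> Auts X col"
    and eqF: "\<And>x y. x \<in> X \<Longrightarrow> y \<in> X \<Longrightarrow> sim x y \<Longrightarrow> F x = F y"
    and simF: "\<And>x. x \<in> X \<Longrightarrow> sim x (F x x)"
    and sym: "\<And>x y. x \<in> X \<Longrightarrow> y \<in> X \<Longrightarrow> sim x y \<Longrightarrow> sim y x"
    and trans: "\<And>x y z. x \<in> X \<Longrightarrow> y \<in> X \<Longrightarrow> z \<in> X \<Longrightarrow> sim x y \<Longrightarrow> sim y z \<Longrightarrow> sim x z"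
    and cross: "\<And>x y. x \<in> X \<Longrightarrow> y \<in> X \<Longrightarrow> \<not> sim x y \<Longrightarrow> col (F x x) (F y y) = col x y"
  shows "(\<lambda>x. if x \<in> X then F x x else x) \<in> Auts X col"
proof -
  let ?a = "\<lambda>x. if x \<in> X then F x x else x"
  have cl: "F x x \<in> X" if "x \<in> X" for x using Auts_in[OF F[OF that]] that by simp
  have "inj_on ?a X"
  proof (rule inj_onI)
    fix x y assume x: "x \<in> X" and y: "y \<in> X" and "?a x = ?a y"
    then have e: "F x x = F y y" by simp
    have "sim x y" using trans[OF x cl[OF x] y simF[OF x]] sym[OF y cl[OF y] simF[OF y]] e by simp
    then have "F x x = F x y" using eqF[OF x y] e by simp
    moreover have "inj (F x)" using permutes_inj[OF Auts_permutes[OF F[OF x]]] .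
    ultimately show "x = y" by (simp add: inj_def)
  qed
  moreover have "?a ` X \<subseteq> X" using cl by auto
  ultimately have "bij_betw ?a X X" using X endo_inj_surj unfolding bij_betw_def by blast
  then have "?a permutes X" by (rule bij_imp_permutes) simp
  moreover have "col (?a x) (?a y) = col x y" if "x \<in> X" "y \<in> X" for x y
    using that cross[OF that] eqF[OF that] Auts_col[OF F that] by (cases "sim x y") auto
  ultimately show ?thesis by (simp add: Auts_def)
qed

section \<open>Powers of a permutation of prime order\<close>

lemma pow_mod_period:
  assumes "z ^^ r = id"
  shows "z ^^ (r * n) = id" "z ^^ (m + r * n) = z ^^ m"
proof -
  show "z ^^ (r * n) = id" using assms by (simp add: funpow_mult[symmetric])
  then show "z ^^ (m + r * n) = z ^^ m" by (simp add: funpow_add)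
qed

lemma pow_generates:
  assumes "prime (r::nat)" "z ^^ r = id" "\<not> r dvd n"
  obtains k where "(z ^^ n) ^^ k = z"
proof -
  have "coprime n r" using assms(1,3) by (metis coprime_commute prime_imp_coprime)
  then obtain k where k: "[n * k = Suc 0] (mod r)" using cong_solve_coprime_nat by blast
  have "Suc 0 mod r = Suc 0" using prime_gt_1_nat[OF assms(1)] by simp
  then have "n * k mod r = Suc 0" using k by (simp add: cong_def)
  then have "n * k = Suc 0 + r * (n * k div r)" by (metis mod_mult_div_eq)
  then have "z ^^ (n * k) = z ^^ Suc 0" using pow_mod_period(2)[OF assms(2)] by metis
  then have "(z ^^ n) ^^ k = z" by (simp add: funpow_mult)
  then show ?thesis using that by blast
qed

lemma bij_period: "z ^^ r = id \<Longrightarrow> r > 0 \<Longrightarrow> bij z"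
  by (rule o_bij[of "z ^^ (r - 1)"]) (metis Suc_diff_1 funpow_Suc_right, metis Suc_diff_1 funpow.simps(2))

lemma perm_grp_cyc:
  assumes "z ^^ r = id" "r > 0"
  shows "perm_grp (cyc z)"
proof (rule perm_grpI)
  show "id \<in> cyc z" unfolding cyc_def by (rule range_eqI[of _ _ 0]) simp
  show "f \<circ> g \<in> cyc z" if "f \<in> cyc z" "g \<in> cyc z" for f g
    using that unfolding cyc_def by (auto simp: funpow_add[symmetric])
  show b: "bij f" if "f \<in> cyc z" for f
    using that bij_fn[OF bij_period[OF assms]] by (auto simp: cyc_def)
  show "pinv f \<in> cyc z" if f: "f \<in> cyc z" for f
  proof -
    obtain n where n: "f = z ^^ n" using f by (auto simp: cyc_def)
    have "n + (r - 1) * n = r * n" using assms(2) by (simp add: algebra_simps)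
    then have "f \<circ> z ^^ ((r - 1) * n) = id"
      unfolding n funpow_add[symmetric] using pow_mod_period(1)[OF assms(1)] by simp
    then have "pinv f = z ^^ ((r - 1) * n)" by (rule pinv_unique[OF b[OF f]])
    then show ?thesis by (auto simp: cyc_def)
  qed
qed

lemma cyc_self: "z ^^ n \<in> cyc z" "z \<in> cyc z"
  unfolding cyc_def by (auto intro: range_eqI[of _ _ 1])

lemma comm_pow: "f \<circ> z = z \<circ> f \<Longrightarrow> f ((z ^^ n) x) = (z ^^ n) (f x)"
  by (induction n) (auto simp: fun_eq_iff)

lemma comm_inv:
  assumes "bij f" "f \<circ> g = g \<circ> f"
  shows "pinv f \<circ> g = g \<circ> pinv f"
proof
  fix x
  have "pinv f (g (f (pinv f x))) = pinv f (f (g (pinv f x)))" using assms(2) by (simp add: fun_eq_iff)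
  then show "(pinv f \<circ> g) x = (g \<circ> pinv f) x" using pinv_simps[OF assms(1)] by simp
qed

lemma card_cyc_prime:
  assumes "prime r" "z ^^ r = id" "z \<noteq> id"
  shows "card (cyc z) = r" "finite (cyc z)"
proof -
  have r: "r > 0" using prime_gt_0_nat[OF assms(1)] .
  note G = perm_grp_cyc[OF assms(2) r]
  have c: "cyc z = (\<lambda>n. z ^^ n) ` {..<r}"
  proof (intro equalityI subsetI)
    fix f assume "f \<in> cyc z"
    then obtain n where "f = z ^^ n" by (auto simp: cyc_def)
    also have "\<dots> = z ^^ (n mod r)"
      using pow_mod_period(2)[OF assms(2), of "n mod r" "n div r"] by simp
    finally show "f \<in> (\<lambda>n. z ^^ n) ` {..<r}" using r by auto
  qed (auto simp: cyc_def)
  have "inj_on (\<lambda>n. z ^^ n) {..<r}"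
  proof (rule linorder_inj_onI)
    fix m n assume mn: "m < n" "m \<in> {..<r}" "n \<in> {..<r}"
    show "z ^^ m \<noteq> z ^^ n"
    proof
      assume e: "z ^^ m = z ^^ n"
      have "z ^^ n = z ^^ m \<circ> z ^^ (n - m)" using mn(1) by (simp add: funpow_add[symmetric])
      then have "pinv (z ^^ m) \<circ> z ^^ m = pinv (z ^^ m) \<circ> (z ^^ m \<circ> z ^^ (n - m))" using e by simp
      then have d: "z ^^ (n - m) = id"
        using pinv_simps(4)[OF perm_grp_bij[OF G cyc_self(1)[of m]]] by (simp add: comp_assoc[symmetric])
      have "\<not> r dvd n - m"
      proof
        assume "r dvd n - m"
        then have "r \<le> n - m" using mn(1) by (intro dvd_imp_le) auto
        then show False using mn by auto
      qed
      from pow_generates[OF assms(1,2) this] obtain k where "(z ^^ (n - m)) ^^ k = z" .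
      then show False using d assms(3) by simp
    qed
  qed (simp add: linear)
  then show "card (cyc z) = r" unfolding c by (simp add: card_image)
  show "finite (cyc z)" unfolding c by simp
qed

text \<open>Such a map acts on each orbit of \<open>z\<close> in \<open>X\<close> as one power of
  \<open>z\<close>, with an exponent that may depend on the orbit.\<close>

definition blockE :: "'a set \<Rightarrow> ('a \<Rightarrow> 'a \<Rightarrow> 'c) \<Rightarrow> ('a \<Rightarrow> 'a) \<Rightarrow> ('a \<Rightarrow> 'a) set" where
  "blockE X col z = {f \<in> Auts X col. f \<circ> z = z \<circ> f \<and> (\<forall>v\<in>X. f v \<in> orb (cyc z) v)}"

subsection \<open>Similarity of points under a semiregular permutation\<close>

text \<open>As \<open>r\<close> is prime, every power of \<open>z\<close> other than
  \<open>id\<close> moves all points of \<open>X\<close>. The locale is used with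
  \<open>r = q\<close> on the vertices and with \<open>r = p\<close> on a transversal.\<close>

locale block_perm =
  fixes X :: "'a set" and col :: "'a \<Rightarrow> 'a \<Rightarrow> 'c" and z :: "'a \<Rightarrow> 'a" and r :: nat
  assumes finX: "finite X" and prime_r: "prime r" and z_aut: "z \<in> Auts X col"
    and z_pow: "z ^^ r = id" and z_free: "v \<in> X \<Longrightarrow> z v \<noteq> v"
begin

abbreviation "E \<equiv> blockE X col z"

text \<open>One inclusion of stabilisers is enough: on \<open>X\<close> the relation turns out to be
  symmetric.\<close>

definition sim :: "'a \<Rightarrow> 'a \<Rightarrow> bool" where
  "sim v w \<longleftrightarrow> (\<forall>f\<in>E. f v = v \<longrightarrow> f w = w)"

lemma r_pos: "r > 0" using prime_gt_0_nat[OF prime_r] .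

lemma cyc_grp: "perm_grp (cyc z)" by (rule perm_grp_cyc[OF z_pow r_pos])

lemma pow_aut: "z ^^ n \<in> Auts X col" by (rule perm_grp_pow[OF perm_grp_Auts z_aut])

lemma pow_in: "(z ^^ n) v \<in> X \<longleftrightarrow> v \<in> X" by (rule Auts_in[OF pow_aut])

lemma orb_in: "w \<in> orb (cyc z) v \<Longrightarrow> v \<in> X \<Longrightarrow> w \<in> X"
  using pow_in by (auto simp: orb_cyc_iff)

lemma pow_fixD:
  assumes "v \<in> X" "(z ^^ n) v = v"
  shows "r dvd n" "z ^^ n = id"
proof -
  show d: "r dvd n"
  proof (rule ccontr)
    assume "\<not> r dvd n"
    from pow_generates[OF prime_r z_pow this] obtain k where k: "(z ^^ n) ^^ k = z" .
    have "((z ^^ n) ^^ i) v = v" for i using assms(2) by (induction i) auto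
    then have "z v = v" using k by metis
    then show False using z_free assms(1) by blast
  qed
  then show "z ^^ n = id" using pow_mod_period(1)[OF z_pow] by (auto elim: dvdE)
qed

lemma cyc_free: "k \<in> cyc z \<Longrightarrow> v \<in> X \<Longrightarrow> k v = v \<Longrightarrow> k = id"
  using pow_fixD by (auto simp: cyc_def)

lemma pow_eqD:
  assumes "v \<in> X" "(z ^^ n) v = (z ^^ m) v"
  shows "z ^^ n = z ^^ m"
proof -
  have "(pinv (z ^^ m) \<circ> z ^^ n) v = v" 
    using assms(2) perm_grp_simps[OF cyc_grp cyc_self(1)[of m]] by simp
  then have "pinv (z ^^ m) \<circ> z ^^ n = id"
    using cyc_free[OF perm_grp_comp[OF cyc_grp perm_grp_inv[OF cyc_grp cyc_self(1)] cyc_self(1)] assms(1)] by blast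
  then have "z ^^ m \<circ> (pinv (z ^^ m) \<circ> z ^^ n) = z ^^ m" by simp
  then show ?thesis using perm_grp_simps[OF cyc_grp cyc_self(1)[of m]] by (auto simp: fun_eq_iff)
qed

lemma card_cyc:
  assumes "v \<in> X"
  shows "card (cyc z) = r" "finite (cyc z)"
proof -
  have "z \<noteq> id" using z_free[OF assms] by auto
  then show "card (cyc z) = r" "finite (cyc z)" by (rule card_cyc_prime[OF prime_r z_pow])+
qed

lemma E_aut: "f \<in> E \<Longrightarrow> f \<in> Auts X col"
  and E_comm: "f \<in> E \<Longrightarrow> f \<circ> z = z \<circ> f"
  and E_orb: "f \<in> E \<Longrightarrow> v \<in> X \<Longrightarrow> f v \<in> orb (cyc z) v"
  by (auto simp: blockE_def)

lemma E_pow: assumes "f \<in> E" "v \<in> X" obtains n where "f v = (z ^^ n) v"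
  using E_orb[OF assms] by (auto simp: orb_cyc_iff)

lemma pow_E: "z ^^ n \<in> E"
proof -
  have "z ^^ n \<circ> z = z \<circ> z ^^ n" by (metis funpow.simps(2) funpow_Suc_right)
  then show ?thesis using pow_aut by (auto simp: blockE_def orb_cyc_iff)
qed

lemma E_grp: "perm_grp E"
proof (rule finite_subgroupI[OF perm_grp_Auts finite_Auts[OF finX]])
  show "E \<subseteq> Auts X col" using E_aut by blast
  show "id \<in> E" using pow_E[of 0] by simp
  show "f \<circ> g \<in> E" if f: "f \<in> E" and g: "g \<in> E" for f g
  proof -
    have "f \<circ> g \<in> Auts X col" using perm_grp_comp[OF perm_grp_Auts] E_aut f g by blast
    moreover have "(f \<circ> g) \<circ> z = z \<circ> (f \<circ> g)" using E_comm[OF f] E_comm[OF g] by (simp add: fun_eq_iff)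
    moreover have "(f \<circ> g) v \<in> orb (cyc z) v" if v: "v \<in> X" for v
      using orb_trans[OF cyc_grp E_orb[OF f] E_orb[OF g v]] Auts_in[OF E_aut[OF g]] v by simp
    ultimately show ?thesis by (auto simp: blockE_def)
  qed
qed

lemma E_fix_orb:
  assumes "f \<in> E" "f v = (z ^^ c) v"
  shows "f ((z ^^ n) v) = (z ^^ c) ((z ^^ n) v)"
proof -
  have "f ((z ^^ n) v) = (z ^^ n) ((z ^^ c) v)" using comm_pow[OF E_comm[OF assms(1)]] assms(2) by simp
  also have "\<dots> = (z ^^ c) ((z ^^ n) v)" by (metis add.commute comp_apply funpow_add)
  finally show ?thesis .
qed

lemma sim_refl: "sim v v" by (simp add: sim_def)

lemma sim_trans: "sim u v \<Longrightarrow> sim v w \<Longrightarrow> sim u w" by (auto simp: sim_def)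

text \<open>Dividing \<open>f\<close> by \<open>z ^^ c\<close> gives an element of \<open>E\<close>
  fixing \<open>v\<close>, hence also \<open>w\<close>: similar points share the exponent.\<close>

lemma sim_pow_eq:
  assumes "v \<in> X" "sim v w" "f \<in> E" "f v = (z ^^ c) v"
  shows "f w = (z ^^ c) w"
proof -
  have "pinv (z ^^ c) \<circ> f \<in> E" using perm_grp_comp[OF E_grp perm_grp_inv[OF E_grp pow_E] assms(3)] .
  moreover have "(pinv (z ^^ c) \<circ> f) v = v" using assms(4) perm_grp_simps[OF E_grp pow_E] by simp
  ultimately have "(pinv (z ^^ c) \<circ> f) w = w" using assms(2) unfolding sim_def by blast
  then show ?thesis using perm_grp_simps[OF E_grp pow_E[of c]] by (metis comp_apply)
qed

lemma sim_sym:
  assumes "v \<in> X" "w \<in> X" "sim v w"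
  shows "sim w v"
  unfolding sim_def
proof (intro ballI impI)
  fix f assume f: "f \<in> E" "f w = w"
  obtain c where c: "f v = (z ^^ c) v" using E_pow[OF f(1) assms(1)] .
  have "(z ^^ c) w = w" using sim_pow_eq[OF assms(1,3) f(1) c] f(2) by simp
  then have "z ^^ c = id" by (rule pow_fixD(2)[OF assms(2)])
  then show "f v = v" using c by simp
qed

lemma sim_pow: "v \<in> X \<Longrightarrow> sim v ((z ^^ n) v)"
  unfolding sim_def by (metis comm_pow E_comm)

lemma sim_orb: "v \<in> X \<Longrightarrow> w \<in> orb (cyc z) v \<Longrightarrow> sim v w"
  using sim_pow by (auto simp: orb_cyc_iff)

text \<open>Some \<open>f \<in> E\<close> fixes \<open>v\<close> and moves \<open>w\<close>. It acts
  on the orbit of \<open>w\<close> as a power of \<open>z\<close> with exponent prime to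
  \<open>r\<close>, hence transitively, so the colours between \<open>v\<close> and that orbit are
  constant.\<close>

lemma col_nsim:
  assumes v: "v \<in> X" and w: "w \<in> X" and ns: "\<not> sim v w"
  shows "col v ((z ^^ n) w) = col v w" "col ((z ^^ n) w) v = col w v"
proof -
  obtain f where f: "f \<in> E" "f v = v" "f w \<noteq> w" using ns by (auto simp: sim_def)
  obtain c where c: "f w = (z ^^ c) w" using E_pow[OF f(1) w] .
  have "\<not> r dvd c"
  proof
    assume "r dvd c"
    then have "z ^^ c = id" using pow_mod_period(1)[OF z_pow] by (auto elim: dvdE)
    then show False using c f(3) by simp
  qed
  from pow_generates[OF prime_r z_pow this] obtain k where k: "(z ^^ c) ^^ k = z" .
  have fw: "f (((z ^^ c) ^^ i) w) = ((z ^^ c) ^^ Suc i) w" for i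
    using E_fix_orb[OF f(1) c, of "c * i"] unfolding funpow_mult[symmetric] by simp
  have in_X: "((z ^^ c) ^^ i) w \<in> X" for i using pow_in w by (simp add: funpow_mult)
  have *: "col v (((z ^^ c) ^^ i) w) = col v w \<and> col (((z ^^ c) ^^ i) w) v = col w v" for i
  proof (induction i)
    case (Suc i)
    then show ?case
      using Auts_col[OF E_aut[OF f(1)] v in_X[of i]] Auts_col[OF E_aut[OF f(1)] in_X[of i] v] f(2) fw[of i] by simp
  qed simp
  have "(z ^^ c) ^^ (k * n) = z ^^ n" using k by (metis funpow_mult)
  then show "col v ((z ^^ n) w) = col v w" "col ((z ^^ n) w) v = col w v" using *[of "k * n"] by simp_all
qed

lemma col_nsim_orb:
  assumes "v \<in> X" "w \<in> X" "\<not> sim v w" "v' \<in> orb (cyc z) v" "w' \<in> orb (cyc z) w"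
  shows "col v' w' = col v w"
proof -
  obtain m n where mn: "v' = (z ^^ m) v" "w' = (z ^^ n) w" using assms(4,5) by (auto simp: orb_cyc_iff)
  have v': "v' \<in> X" using mn assms(1) pow_in by simp
  have "\<not> sim v' w" using sim_trans[OF sim_orb[OF assms(1,4)]] assms(3) by blast
  then have "col v' w' = col v' w" using col_nsim(1)[OF v' assms(2)] mn(2) by simp
  moreover have "\<not> sim w v" using assms sim_sym by blast
  then have "col v' w = col v w" using col_nsim(2)[OF assms(2,1)] mn(1) by simp
  ultimately show ?thesis by simp
qed

text \<open>The normaliser of \<open>E\<close>. Its elements need not commute with \<open>z\<close>,
  yet they permute the orbits of \<open>z\<close> and the similarity classes, which is what gluing
  requires.\<close>

definition N :: "('a \<Rightarrow> 'a) set" where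
  "N = {h \<in> Auts X col. (\<forall>f\<in>E. h \<circ> f \<circ> pinv h \<in> E \<and> pinv h \<circ> f \<circ> h \<in> E)}"

lemma N_grp: "perm_grp N"
proof (rule finite_subgroupI[OF perm_grp_Auts finite_Auts[OF finX]])
  show "N \<subseteq> Auts X col" by (auto simp: N_def)
  show "id \<in> N" using perm_grp_id[OF perm_grp_Auts] by (simp add: N_def)
  show "f \<circ> g \<in> N" if f: "f \<in> N" and g: "g \<in> N" for f g
  proof -
    have fg: "f \<in> Auts X col" "g \<in> Auts X col" using f g by (auto simp: N_def)
    note i = pinv_comp[OF perm_grp_bij[OF perm_grp_Auts fg(1)] perm_grp_bij[OF perm_grp_Auts fg(2)]]
    have "(f \<circ> g) \<circ> e \<circ> pinv (f \<circ> g) \<in> E" if "e \<in> E" for e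
    proof -
      have "f \<circ> (g \<circ> e \<circ> pinv g) \<circ> pinv f \<in> E" using f g that by (simp add: N_def)
      then show ?thesis unfolding i by (simp add: comp_assoc)
    qed
    moreover have "pinv (f \<circ> g) \<circ> e \<circ> (f \<circ> g) \<in> E" if "e \<in> E" for e
    proof -
      have "pinv g \<circ> (pinv f \<circ> e \<circ> f) \<circ> g \<in> E" using f g that by (simp add: N_def)
      then show ?thesis unfolding i by (simp add: comp_assoc)
    qed
    ultimately show ?thesis using perm_grp_comp[OF perm_grp_Auts fg] by (simp add: N_def)
  qed
qed

lemma N_aut: "h \<in> N \<Longrightarrow> h \<in> Auts X col" by (simp add: N_def)

lemma N_sim:
  assumes "h \<in> N" "sim v w"
  shows "sim (h v) (h w)"
  unfolding sim_def
proof (intro ballI impI)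
  fix f assume f: "f \<in> E" "f (h v) = h v"
  note h = perm_grp_simps[OF N_grp assms(1)]
  have "pinv h \<circ> f \<circ> h \<in> E" using assms(1) f(1) by (simp add: N_def)
  moreover have "(pinv h \<circ> f \<circ> h) v = v" using f(2) h by simp
  ultimately have "(pinv h \<circ> f \<circ> h) w = w" using assms(2) unfolding sim_def by blast
  then show "f (h w) = h w" using h(1)[of "f (h w)"] by simp
qed

lemma N_sim_iff: "h \<in> N \<Longrightarrow> sim (h v) (h w) \<longleftrightarrow> sim v w"
  using N_sim[of h v w] N_sim[OF perm_grp_inv[OF N_grp], of h "h v" "h w"] perm_grp_simps[OF N_grp] by auto

lemma N_orb:
  assumes "h \<in> N" "v \<in> X" "w \<in> orb (cyc z) v"
  shows "h w \<in> orb (cyc z) (h v)"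
proof -
  obtain n where n: "w = (z ^^ n) v" using assms(3) by (auto simp: orb_cyc_iff)
  have "h \<circ> z ^^ n \<circ> pinv h \<in> E" using assms(1) pow_E by (simp add: N_def)
  from E_orb[OF this, of "h v"] show ?thesis
    using n perm_grp_simps[OF N_grp assms(1)] Auts_in[OF N_aut[OF assms(1)]] assms(2) by simp
qed

lemma comm_N:
  assumes h: "h \<in> Auts X col" and c: "h \<circ> z = z \<circ> h"
  shows "h \<in> N"
proof -
  have main: "g \<circ> f \<circ> pinv g \<in> E" if g: "g \<in> Auts X col" "g \<circ> z = z \<circ> g" and f: "f \<in> E" for f g
  proof -
    note b = perm_grp_bij[OF perm_grp_Auts g(1)]
    have i: "pinv g \<in> Auts X col" by (rule perm_grp_inv[OF perm_grp_Auts g(1)])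
    have ci: "pinv g \<circ> z = z \<circ> pinv g" by (rule comm_inv[OF b g(2)])
    have "g \<circ> f \<circ> pinv g \<in> Auts X col"
      using perm_grp_comp[OF perm_grp_Auts perm_grp_comp[OF perm_grp_Auts g(1) E_aut[OF f]] i] .
    moreover have "(g \<circ> f \<circ> pinv g) \<circ> z = z \<circ> (g \<circ> f \<circ> pinv g)"
      using ci g(2) E_comm[OF f] by (simp add: fun_eq_iff)
    moreover have "(g \<circ> f \<circ> pinv g) v \<in> orb (cyc z) v" if v: "v \<in> X" for v
    proof -
      have "pinv g v \<in> X" using Auts_in[OF i] v by simp
      then obtain n where "f (pinv g v) = (z ^^ n) (pinv g v)" using E_pow[OF f] by blast
      then have "(g \<circ> f \<circ> pinv g) v = (z ^^ n) v" using comm_pow[OF g(2)] pinv_simps[OF b] by simp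
      then show ?thesis by (auto simp: orb_cyc_iff)
    qed
    ultimately show ?thesis by (simp add: blockE_def)
  qed
  note b = perm_grp_bij[OF perm_grp_Auts h]
  show ?thesis
    using main[OF h c] main[OF perm_grp_inv[OF perm_grp_Auts h] comm_inv[OF b c]] h inv_inv_eq[OF b]
    by (simp add: N_def)
qed

text \<open>On each orbit \<open>t\<close> is a power of \<open>z\<close> with exponent prime to
  \<open>r\<close>, because it has no fixed point there; so \<open>z\<close> is in turn a power of
  \<open>t\<close> on that orbit. Elements of \<open>E\<close> commute with \<open>t\<close> since
  both act as powers of \<open>z\<close> orbit by orbit.\<close>

lemma block_perm_E:
  assumes t: "t \<in> E" and free: "\<And>v. v \<in> X \<Longrightarrow> t v \<noteq> v"
  shows "block_perm X col t r" "\<And>v. v \<in> X \<Longrightarrow> z v \<in> orb (cyc t) v" "E \<subseteq> blockE X col t"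
proof -
  have pw: "(t ^^ i) v = ((z ^^ c) ^^ i) v" if "t v = (z ^^ c) v" for c v i
  proof (induction i)
    case (Suc i)
    have "t (((z ^^ c) ^^ i) v) = (z ^^ c) (((z ^^ c) ^^ i) v)"
      using E_fix_orb[OF t that, of "c * i"] unfolding funpow_mult[symmetric] .
    then show ?case using Suc by simp
  qed simp
  have "(t ^^ r) v = v" for v
  proof (cases "v \<in> X")
    case True
    obtain c where c: "t v = (z ^^ c) v" using E_pow[OF t True] .
    have "(z ^^ c) ^^ r = id" using pow_mod_period(1)[OF z_pow, of c] by (simp add: funpow_mult mult.commute)
    then show ?thesis using pw[OF c, of r] by simp
  next
    case False
    then have "t v = v" using permutes_not_in[OF Auts_permutes[OF E_aut[OF t]]] by blast
    then have "(t ^^ i) v = v" for i by (induction i) auto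
    then show ?thesis .
  qed
  then have tr: "t ^^ r = id" by (simp add: fun_eq_iff)
  show bp: "block_perm X col t r"
    by unfold_locales (use finX prime_r E_aut[OF t] tr free in auto)
  have tg: "perm_grp (cyc t)" by (rule perm_grp_cyc[OF tr r_pos])
  show zt: "z v \<in> orb (cyc t) v" if v: "v \<in> X" for v
  proof -
    obtain c where c: "t v = (z ^^ c) v" using E_pow[OF t v] .
    have "\<not> r dvd c"
    proof
      assume "r dvd c"
      then have "z ^^ c = id" using pow_mod_period(1)[OF z_pow] by (auto elim: dvdE)
      then show False using c free[OF v] by simp
    qed
    from pow_generates[OF prime_r z_pow this] obtain k where k: "(z ^^ c) ^^ k = z" .
    have "z v = (t ^^ k) v" using pw[OF c, of k] k by simp
    then show ?thesis by (auto simp: orb_cyc_iff)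
  qed
  have zn: "(z ^^ n) v \<in> orb (cyc t) v" if v: "v \<in> X" for v n
  proof (induction n)
    case 0
    then show ?case using orb_refl[OF tg] by simp
  next
    case (Suc n)
    then show ?case using orb_trans[OF tg zt[of "(z ^^ n) v"] Suc] v pow_in by simp
  qed
  show "E \<subseteq> blockE X col t"
  proof
    fix f assume f: "f \<in> E"
    have "f (t v) = t (f v)" for v
    proof (cases "v \<in> X")
      case True
      obtain c where c: "t v = (z ^^ c) v" using E_pow[OF t True] .
      obtain m where m: "f v = (z ^^ m) v" using E_pow[OF f True] .
      show ?thesis using E_fix_orb[OF f m, of c] E_fix_orb[OF t c, of m] c m
        by (metis E_comm comm_pow t)
    next
      case False
      then show ?thesis using permutes_not_in[OF Auts_permutes[OF E_aut[OF f]]]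
          permutes_not_in[OF Auts_permutes[OF E_aut[OF t]]] by metis
    qed
    moreover have "f v \<in> orb (cyc t) v" if v: "v \<in> X" for v
    proof -
      obtain m where "f v = (z ^^ m) v" using E_pow[OF f v] .
      then show ?thesis using zn[OF v] by simp
    qed
    ultimately show "f \<in> blockE X col t" using E_aut[OF f] by (auto simp: blockE_def fun_eq_iff)
  qed
qed

text \<open>The roles of \<open>z\<close> and \<open>t\<close> can be exchanged, so similarity and
  the normaliser are the same for both.\<close>

lemma blockE_eq:
  assumes t: "t \<in> E" and free: "\<And>v. v \<in> X \<Longrightarrow> t v \<noteq> v"
  shows "blockE X col t = E"
proof -
  interpret t: block_perm X col t r by (rule block_perm_E(1)[OF assms])
  have "z \<in> blockE X col t" using block_perm_E(3)[OF assms] pow_E[of 1] by auto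
  then show ?thesis using t.block_perm_E(3)[OF _ z_free] block_perm_E(3)[OF assms] by blast
qed

end

subsection \<open>Regular elementary abelian groups\<close>

text \<open>The elements of \<open>P\<close> may also move points outside \<open>X\<close>: a group of permutations of all vertices will be
  used as a regular group on a transversal.\<close>

definition reg :: "nat \<Rightarrow> 'a set \<Rightarrow> ('a \<Rightarrow> 'a) set \<Rightarrow> bool" where
  "reg p X P \<longleftrightarrow> perm_grp P \<and> finite X \<and> (\<forall>f\<in>P. \<forall>g\<in>P. f \<circ> g = g \<circ> f) \<and> (\<forall>f\<in>P. f ^^ p = id) \<and>
     (\<forall>f\<in>P. \<forall>x\<in>X. f x \<in> X) \<and> (\<forall>a\<in>X. \<forall>b\<in>X. \<exists>f\<in>P. b = f a) \<and>
     (\<forall>f\<in>P. \<forall>x\<in>X. f x = x \<longrightarrow> f = id)"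

lemma regD:
  assumes "reg p X P"
  shows "perm_grp P" "finite X" "\<And>f g x. f \<in> P \<Longrightarrow> g \<in> P \<Longrightarrow> f (g x) = g (f x)" "\<And>f. f \<in> P \<Longrightarrow> f ^^ p = id"
    "\<And>f x. f \<in> P \<Longrightarrow> x \<in> X \<Longrightarrow> f x \<in> X" "\<And>a b. a \<in> X \<Longrightarrow> b \<in> X \<Longrightarrow> \<exists>f\<in>P. b = f a"
    "\<And>f x. f \<in> P \<Longrightarrow> x \<in> X \<Longrightarrow> f x = x \<Longrightarrow> f = id"
  using assms by (auto simp: reg_def fun_eq_iff)

lemma reg_comm: "reg p X P \<Longrightarrow> f \<in> P \<Longrightarrow> g \<in> P \<Longrightarrow> f \<circ> g = g \<circ> f"
  using regD(3) by (auto simp: fun_eq_iff)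

lemma reg_eqD:
  assumes "reg p X P" "f \<in> P" "g \<in> P" "x \<in> X" "f x = g x"
  shows "f = g"
proof -
  note G = regD(1)[OF assms(1)]
  have "pinv g \<circ> f \<in> P" using perm_grp_comp[OF G perm_grp_inv[OF G assms(3)] assms(2)] .
  moreover have "(pinv g \<circ> f) x = x" using assms(5) perm_grp_simps[OF G assms(3)] by simp
  ultimately have "pinv g \<circ> f = id" using regD(7)[OF assms(1) _ assms(4)] by blast
  then have "g (pinv g (f y)) = g y" for y by (metis comp_apply id_apply)
  then show ?thesis using perm_grp_simps[OF G assms(3)] by (simp add: fun_eq_iff)
qed

lemma reg_orb: "reg p X P \<Longrightarrow> w \<in> X \<Longrightarrow> orb P w = X"
  using regD(5,6) by (fastforce simp: orb_def)

lemma card_reg: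
  assumes "reg p X P" "w \<in> X"
  shows "card P = card X" "finite P"
proof -
  have "card (orb P w) = card P"
    by (rule card_orb_free[OF _ regD(1)[OF assms(1)]]) (use regD(7)[OF assms(1)] assms(2) in blast)
  then show c: "card P = card X" using reg_orb[OF assms] by simp
  have "card X > 0" using regD(2)[OF assms(1)] assms(2) by (auto simp: card_gt_0_iff)
  then show "finite P" using c by (simp add: card_ge_0_finite)
qed

text \<open>A map commuting with a transitive group is determined by the image of one point, and the
  abelian group \<open>P\<close> itself contains an element with that image.\<close>

lemma reg_central:
  assumes "reg p X P" "w \<in> X" "n w \<in> X" "\<And>f x. f \<in> P \<Longrightarrow> x \<in> X \<Longrightarrow> n (f x) = f (n x)"
  obtains g where "g \<in> P" "\<And>x. x \<in> X \<Longrightarrow> n x = g x"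
proof -
  obtain g where g: "g \<in> P" "n w = g w" using regD(6)[OF assms(1-3)] by blast
  have "n x = g x" if x: "x \<in> X" for x
  proof -
    obtain f where f: "f \<in> P" "x = f w" using regD(6)[OF assms(1,2) x] by blast
    show ?thesis using assms(4)[OF f(1) assms(2)] f(2) g regD(3)[OF assms(1) g(1) f(1)] by simp
  qed
  then show ?thesis using that g(1) by blast
qed

text \<open>The powers of \<open>h\<close> represent the \<open>p\<close> cosets of
  \<open>U\<close>: the points \<open>u ((h ^^ k) x)\<close> with \<open>k < p\<close> are distinct,
  and there are \<open>card X\<close> of them.\<close>

lemma index_cosets:
  assumes P: "reg p X P" and p: "prime p" and U: "perm_grp U" "U \<subseteq> P" and idx: "card X = p * card U"
    and h: "h \<in> P" "h \<notin> U" and x: "x \<in> X" and y: "y \<in> X"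
  obtains k u where "u \<in> U" "y = u ((h ^^ k) x)"
proof -
  note G = regD(1)[OF P]
  have hp: "h ^^ p = id" using regD(4)[OF P h(1)] .
  have hk: "h ^^ k \<in> P" for k by (rule perm_grp_pow[OF G h(1)])
  have nU: "h ^^ d \<notin> U" if d: "\<not> p dvd d" for d
  proof
    assume "h ^^ d \<in> U"
    moreover obtain k where "(h ^^ d) ^^ k = h" using pow_generates[OF p hp d] .
    ultimately show False using h(2) perm_grp_pow[OF U(1)] by metis
  qed
  let ?f = "\<lambda>(k, u). u ((h ^^ k) x)"
  \<comment> \<open>A collision would put a power of \<open>h\<close> with exponent prime to
    \<open>p\<close> into \<open>U\<close>.\<close>
  have aux: "k = k'"
    if k: "k \<le> k'" "k' < p" and u: "u \<in> U" "u' \<in> U" and e: "u ((h ^^ k) x) = u' ((h ^^ k') x)" for k k' u u'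
  proof (rule ccontr)
    assume "k \<noteq> k'"
    then have nd: "\<not> p dvd k' - k" using k by (auto dest: dvd_imp_le)
    have "h ^^ k' = h ^^ (k' - k) \<circ> h ^^ k" using k(1) by (simp add: funpow_add[symmetric])
    then have "(pinv u' \<circ> u) ((h ^^ k) x) = (h ^^ (k' - k)) ((h ^^ k) x)"
      using e perm_grp_simps[OF U(1) u(2)] by simp
    moreover have c: "pinv u' \<circ> u \<in> U" using perm_grp_comp[OF U(1) perm_grp_inv[OF U(1) u(2)] u(1)] .
    ultimately have "pinv u' \<circ> u = h ^^ (k' - k)"
      using reg_eqD[OF P _ hk] c U(2) regD(5)[OF P hk x] by blast
    then show False using c nU[OF nd] by simp
  qed
  have inj: "inj_on ?f ({..<p} \<times> U)"
  proof (rule inj_onI, clarify)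
    fix k u k' u' assume k: "k < p" "k' < p" and u: "u \<in> U" "u' \<in> U" and e: "u ((h ^^ k) x) = u' ((h ^^ k') x)"
    have "k = k'"
    proof (cases "k \<le> k'")
      case True then show ?thesis using aux[OF True k(2) u e] by simp
    next
      case False then show ?thesis using aux[OF _ k(1) u(2,1) e[symmetric]] by simp
    qed
    moreover from this have "u = u'" using e reg_eqD[OF P _ _ regD(5)[OF P hk x]] u U(2) by blast
    ultimately show "k = k' \<and> u = u'" by simp
  qed
  have sub: "?f ` ({..<p} \<times> U) \<subseteq> X" using U(2) regD(5)[OF P] hk x by auto
  have "card (?f ` ({..<p} \<times> U)) = card X" using inj idx by (simp add: card_image card_cartesian_product)
  then have "?f ` ({..<p} \<times> U) = X" by (rule card_subset_eq[OF regD(2)[OF P] sub])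
  then have "y \<in> ?f ` ({..<p} \<times> U)" using y by simp
  then show ?thesis using that by auto
qed

text \<open>On each \<open>U\<close>-orbit \<open>s\<close> acts as some element of \<open>U\<close>. Comparing two orbits, and moving the comparison
  around by \<open>P\<close>, makes the colour between different orbits invariant under the quotients of these elements,
  and walking from the orbit of \<open>v1\<close> to that of \<open>v2\<close> in steps of \<open>h\<close> composes the quotients to \<open>g\<close>.\<close>

lemma shift_invariance:
  assumes p: "prime p" and P: "reg p X P" and U: "perm_grp U" "U \<subseteq> P" and idx: "card X = p * card U"
    and colP: "\<And>f a b. f \<in> P \<Longrightarrow> a \<in> X \<Longrightarrow> b \<in> X \<Longrightarrow> col (f a) (f b) = col a b"
    and cols: "\<And>a b. a \<in> X \<Longrightarrow> b \<in> X \<Longrightarrow> col (s a) (s b) = col a b"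
    and sU: "\<And>u a. u \<in> U \<Longrightarrow> a \<in> X \<Longrightarrow> s (u a) = u (s a)"
    and so: "\<And>a. a \<in> X \<Longrightarrow> s a \<in> orb U a"
    and v1: "v1 \<in> X" "s v1 = v1" and v2: "v2 \<in> X" "g \<in> U" "s v2 = g v2"
    and x: "x \<in> X" and y: "y \<in> X" "y \<notin> orb U x"
  shows "col x (g y) = col x y"
proof -
  note G = regD(1)[OF P]
  note PX = regD(5)[OF P]
  have UX: "u a \<in> X" if "u \<in> U" "a \<in> X" for u a using that U(2) PX by blast
  obtain h where h: "h \<in> P" "y = h x" using regD(6)[OF P x y(1)] by blast
  have hU: "h \<notin> U" using h(2) y(2) by (auto simp: orb_def)
  have hk: "h ^^ k \<in> P" for k by (rule perm_grp_pow[OF G h(1)])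
  have hv: "(h ^^ k) v1 \<in> X" for k using PX hk v1(1) by blast
  \<comment> \<open>Here \<open>c\<close> is the element of \<open>U\<close> as which
    \<open>s\<close> acts at \<open>(h ^^ k) v1\<close>. The induction shows that applying
    \<open>c\<close> does not change colours from one \<open>U\<close>-orbit to the next one in
    direction \<open>h\<close>.\<close>
  have main: "\<forall>c\<in>U. s ((h ^^ k) v1) = c ((h ^^ k) v1) \<longrightarrow> (\<forall>a\<in>X. \<forall>u\<in>U. col a (c (u (h a))) = col a (u (h a)))" for k
  proof (induction k)
    case 0
    show ?case
    proof (intro ballI impI)
      fix c a u assume c: "c \<in> U" "s ((h ^^ 0) v1) = c ((h ^^ 0) v1)"
      then have "c = id" using regD(7)[OF P _ v1(1)] v1(2) U(2) by auto
      then show "col a (c (u (h a))) = col a (u (h a))" by simp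
    qed
  next
    case (Suc k)
    show ?case
    proof (intro ballI impI)
      fix c a u assume c: "c \<in> U" "s ((h ^^ Suc k) v1) = c ((h ^^ Suc k) v1)" and a: "a \<in> X" and u: "u \<in> U"
      obtain d where d: "d \<in> U" "s ((h ^^ k) v1) = d ((h ^^ k) v1)"
        using so[OF hv[of k]] by (auto simp: orb_def)
      have IH: "col a (d (u (h a))) = col a (u (h a))" using Suc.IH d a u by blast
      obtain f where f: "f \<in> P" "(h ^^ k) v1 = f a" using regD(6)[OF P a hv[of k]] by blast
      let ?b = "(h ^^ k) v1" and ?e = "u ((h ^^ Suc k) v1)"
      have du: "d \<circ> u \<in> U" using perm_grp_comp[OF U(1) d(1) u] .
      have b': "d ?e \<in> X" "?e \<in> X" using UX[OF d(1)] UX[OF u] hv by blast+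
      have hb: "(h ^^ Suc k) v1 = f (h a)" using f regD(3)[OF P h(1) f(1)] by simp
      \<comment> \<open>Applying \<open>s\<close> moves the first point by \<open>d\<close> and
        contributes \<open>c\<close> at the second; then \<open>d\<close> cancels, being an
        automorphism. This trades \<open>d\<close> for \<open>c\<close>, and the induction
        hypothesis removes \<open>d\<close>.\<close>
      have "col ?b (d ?e) = col (s ?b) (s (d ?e))" using cols[OF hv b'(1)] by simp
      also have "s (d ?e) = d (u (c ((h ^^ Suc k) v1)))" using sU[OF d(1) b'(2)] sU[OF u hv] c(2) by metis
      also have "s ?b = d ?b" by (rule d(2))
      also have "col (d ?b) (d (u (c ((h ^^ Suc k) v1)))) = col ?b (u (c ((h ^^ Suc k) v1)))"
        by (rule colP) (use d(1) U(2) hv UX u c(1) in blast)+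
      finally have 1: "col ?b (d (u ((h ^^ Suc k) v1))) = col ?b (u (c ((h ^^ Suc k) v1)))" .
      have t: "f (v (h a)) = v (f (h a))" if "v \<in> U" for v using regD(3)[OF P f(1)] that U(2) by blast
      have ha: "h a \<in> X" using PX h(1) a by blast
      have "col a (d (u (h a))) = col (f a) (f (d (u (h a))))"
        by (rule colP[symmetric]) (use f(1) a UX d(1) u ha in blast)+
      also have "f (d (u (h a))) = d (u (f (h a)))" using t[OF du] by simp
      finally have 2: "col a (d (u (h a))) = col ?b (d (u ((h ^^ Suc k) v1)))" using f(2) hb by simp
      have uc: "c (u (h a)) = u (c (h a))" using regD(3)[OF P, of c u] c(1) u U(2) by blast
      have "col a (u (c (h a))) = col (f a) (f (u (c (h a))))"
        by (rule colP[symmetric]) (use f(1) a UX c(1) u ha in blast)+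
      also have "f (u (c (h a))) = u (c (f (h a)))" using t[OF perm_grp_comp[OF U(1) u c(1)]] by simp
      finally have 3: "col a (u (c (h a))) = col ?b (u (c ((h ^^ Suc k) v1)))" using f(2) hb by simp
      show "col a (c (u (h a))) = col a (u (h a))" unfolding uc using 1 2 3 IH by simp
    qed
  qed
  obtain k u where k: "u \<in> U" "v2 = u ((h ^^ k) v1)" using index_cosets[OF P p U idx h(1) hU v1(1) v2(1)] .
  have "u (s ((h ^^ k) v1)) = g (u ((h ^^ k) v1))" using v2(3) sU[OF k(1) hv] k(2) by simp
  also have "\<dots> = u (g ((h ^^ k) v1))" using regD(3)[OF P, of g u] v2(2) k(1) U(2) by blast
  finally have "s ((h ^^ k) v1) = g ((h ^^ k) v1)"
    using perm_grp_simps(2)[OF U(1) k(1)] by metis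
  then have "col x (g (id (h x))) = col x (id (h x))" using main[of k] v2(2) x perm_grp_id[OF U(1)] by blast
  then show ?thesis using h(2) by simp
qed

text \<open>Modulo \<open>U\<close> the element \<open>x\<close> has order \<open>p\<close>, so the
  two exponents are congruent modulo \<open>p\<close>. The congruence is expressed through all
  \<open>t\<close> with \<open>t ^^ p = id\<close>, in order to carry it from \<open>x\<close> to
  its counterpart in another group.\<close>

lemma index_key:
  assumes P: "reg p X P" and p: "prime p" and U: "perm_grp U" "U \<subseteq> P" and x: "x \<in> P" "x \<notin> U"
    and u: "u \<in> U" and w: "w \<in> X" and e: "(x ^^ j) w = u ((x ^^ k) w)"
  shows "u = id" and "\<And>t. t ^^ p = id \<Longrightarrow> t ^^ j = t ^^ k"
proof -
  note G = regD(1)[OF P]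
  note xp = regD(4)[OF P x(1)]
  have xk: "x ^^ k \<in> P" for k by (rule perm_grp_pow[OF G x(1)])
  have uP: "u \<in> P" using u U(2) by blast
  have "x ^^ j = u \<circ> x ^^ k"
    by (rule reg_eqD[OF P xk perm_grp_comp[OF G uP xk] w]) (use e in simp)
  \<comment> \<open>The exponent \<open>(p - 1) * k\<close> stands for \<open>-k\<close>.\<close>
  then have "x ^^ j \<circ> x ^^ ((p - 1) * k) = u \<circ> (x ^^ k \<circ> x ^^ ((p - 1) * k))" by (simp add: comp_assoc)
  moreover have pk: "k + (p - 1) * k = p * k" using prime_gt_0_nat[OF p] by (simp add: algebra_simps)
  ultimately have j: "x ^^ (j + (p - 1) * k) = u"
    using pow_mod_period(1)[OF xp, of k] by (simp add: funpow_add[symmetric])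
  have "p dvd j + (p - 1) * k"
  proof (rule ccontr)
    assume "\<not> p dvd j + (p - 1) * k"
    from pow_generates[OF p xp this] obtain i where "(x ^^ (j + (p - 1) * k)) ^^ i = x" .
    then have "x \<in> U" using j perm_grp_pow[OF U(1) u] by metis
    then show False using x(2) by blast
  qed
  then obtain c where c: "j + (p - 1) * k = p * c" by (elim dvdE)
  show "u = id" using j pow_mod_period(1)[OF xp, of c] c by simp
  show "t ^^ j = t ^^ k" if t: "t ^^ p = id" for t :: "'b \<Rightarrow> 'b"
  proof -
    have "t ^^ j = t ^^ (j + p * k)" using pow_mod_period(2)[OF t] by simp
    also have "j + p * k = k + p * c" using c pk by linarith
    also have "t ^^ (k + p * c) = t ^^ k" by (rule pow_mod_period(2)[OF t])
    finally show ?thesis .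
  qed
qed

text \<open>The conjugating permutation maps \<open>u (x ^^ k) w\<close> to \<open>u (x' ^^ k) w\<close> for \<open>u \<in> U\<close>, where \<open>x\<close> generates \<open>P\<close>
  over \<open>U\<close> and \<open>x'\<close> is the element of \<open>P'\<close> with \<open>x' w = x w\<close>.\<close>

lemma regular_conj:
  assumes p: "prime p" and w: "w \<in> X" and P: "reg p X P" "P \<subseteq> Auts X col" and P': "reg p X P'" "P' \<subseteq> Auts X col"
    and U: "perm_grp U" "U \<subseteq> P" "U \<subseteq> P'" and idx: "card X = p * card U"
    and same: "\<And>f f' y. f \<in> P \<Longrightarrow> f' \<in> P' \<Longrightarrow> f' w = f w \<Longrightarrow> y \<in> X \<Longrightarrow> f' y \<in> orb U (f y)"
  shows "\<exists>a\<in>Auts X col. conj_by a P' = P"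
proof -
  note G = regD(1)[OF P(1)] and G' = regD(1)[OF P'(1)]
  note finX = regD(2)[OF P(1)]
  have PX: "f y \<in> X" if "f \<in> P \<union> P'" "y \<in> X" for f y using that regD(5)[OF P(1)] regD(5)[OF P'(1)] by blast
  have "card U < card P"
  proof -
    have "card P = p * card U" using card_reg[OF P(1) w] idx by simp
    moreover have "card P > 0" using card_reg(2)[OF P(1) w] perm_grp_id[OF G] by (auto simp: card_gt_0_iff)
    ultimately show ?thesis using n_less_m_mult_n[of "card U" p] prime_gt_1_nat[OF p] by simp
  qed
  then have "U \<noteq> P" by blast
  then obtain x where x: "x \<in> P" "x \<notin> U" using U(2) by blast
  have xw: "x w \<in> X" using PX x(1) w by blast
  obtain x' where x': "x' \<in> P'" "x w = x' w" using regD(6)[OF P'(1) w xw] by blast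
  have xk: "x ^^ k \<in> P" for k by (rule perm_grp_pow[OF G x(1)])
  have xk': "x' ^^ k \<in> P'" for k by (rule perm_grp_pow[OF G' x'(1)])
  have xkw: "(x ^^ k) w \<in> X" "(x' ^^ k) w \<in> X" for k using PX xk xk' w by blast+
  have Ucomm: "u (f y) = f (u y)" if "u \<in> U" "f \<in> P \<union> P'" for u f y
    using that U regD(3)[OF P(1)] regD(3)[OF P'(1)] by blast
  \<comment> \<open>\<open>s\<close> measures how \<open>x'\<close> deviates from \<open>x\<close>.
    It fixes \<open>x w\<close>, which provides the fixed point needed for
    \<open>shift_invariance\<close>.\<close>
  define s where "s = x' \<circ> pinv x"
  have ix: "pinv x \<in> P" by (rule perm_grp_inv[OF G x(1)])
  have sA: "s \<in> Auts X col" unfolding s_def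
    using perm_grp_comp[OF perm_grp_Auts] x'(1) P'(2) ix P(2) by blast
  have sU: "s (u y) = u (s y)" if "u \<in> U" for u y
    unfolding s_def using Ucomm[OF that] ix x'(1) by simp
  have so: "s y \<in> orb U y" if y: "y \<in> X" for y
  proof -
    have "pinv x y \<in> X" using PX ix y by blast
    from same[OF x(1) x'(1) x'(2)[symmetric] this] show ?thesis
      unfolding s_def using perm_grp_simps[OF G x(1)] by simp
  qed
  have sxw: "s (x w) = x w" unfolding s_def using perm_grp_simps(2)[OF G x(1), of w] x'(2) by simp
  \<comment> \<open>The elements of \<open>U\<close> that may be applied to one
    \<open>U\<close>-orbit alone without changing colours between orbits.\<close>
  define L where "L = {g \<in> U. \<forall>a\<in>X. \<forall>b\<in>X. b \<notin> orb U a \<longrightarrow> col a (g b) = col a b}"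
  have LU: "g \<in> U" if "g \<in> L" for g using that by (simp add: L_def)
  have colL: "col a (g b) = col a b" if "g \<in> L" "a \<in> X" "b \<in> X" "b \<notin> orb U a" for g a b
    using that by (simp add: L_def)
  have UX: "u y \<in> X" if "u \<in> U" "y \<in> X" for u y using that PX U(2) by blast
  have Lcomp: "g \<circ> h \<in> L" if g: "g \<in> L" and h: "h \<in> L" for g h
  proof -
    have "col a ((g \<circ> h) b) = col a b" if ab: "a \<in> X" "b \<in> X" "b \<notin> orb U a" for a b
    proof -
      have "h b \<in> X" "h b \<notin> orb U a" using UX[OF LU[OF h] ab(2)] ab(3) orb_moved[OF U(1) LU[OF h]] by auto
      then show ?thesis using colL[OF g ab(1)] colL[OF h ab] by simp
    qed
    then show ?thesis using perm_grp_comp[OF U(1) LU[OF g] LU[OF h]] unfolding L_def by blast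
  qed
  have sL: "g \<in> L" if y: "y \<in> X" and g: "g \<in> U" "s y = g y" for y g
  proof -
    have "col a (g b) = col a b" if ab: "a \<in> X" "b \<in> X" "b \<notin> orb U a" for a b
    proof (rule shift_invariance[OF p P(1) U(1,2) idx _ _ _ _ xw sxw y g ab])
      show "col (f a) (f b) = col a b" if "f \<in> P" "a \<in> X" "b \<in> X" for f a b
        by (rule Auts_col[OF subsetD[OF P(2) that(1)] that(2,3)])
      show "col (s a) (s b) = col a b" if "a \<in> X" "b \<in> X" for a b by (rule Auts_col[OF sA that])
      show "s (u a) = u (s a)" if "u \<in> U" for u a by (rule sU[OF that])
      show "s a \<in> orb U a" if "a \<in> X" for a by (rule so[OF that])
    qed
    then show ?thesis using g by (simp add: L_def)
  qed
  \<comment> \<open>The deviation of \<open>x' ^^ k\<close> from \<open>x ^^ k\<close> at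
    \<open>w\<close> is a product of values of \<open>s\<close> along the way, each of which lies in
    \<open>L\<close>.\<close>
  have uk: "\<exists>u\<in>L. (x' ^^ k) w = u ((x ^^ k) w)" for k
  proof (induction k)
    case 0
    have "id \<in> L" using perm_grp_id[OF U(1)] by (simp add: L_def)
    then show ?case by (intro bexI[of _ id]) auto
  next
    case (Suc k)
    obtain u where u: "u \<in> L" "(x' ^^ k) w = u ((x ^^ k) w)" using Suc.IH by blast
    let ?y = "(x ^^ Suc k) w"
    obtain g where g: "g \<in> U" "s ?y = g ?y" using so[OF xkw(1)[of "Suc k"]] by (auto simp: orb_def)
    have gL: "g \<in> L" by (rule sL[OF xkw(1) g])
    have "g ?y = x' ((x ^^ k) w)" using g(2) perm_grp_simps[OF G x(1)] unfolding s_def by simp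
    then have "u (g ?y) = x' (u ((x ^^ k) w))" using Ucomm[OF LU[OF u(1)]] x'(1) by simp
    then have "(x' ^^ Suc k) w = (u \<circ> g) ?y" using u(2) by simp
    then show ?case using Lcomp[OF u(1) gL] by blast
  qed
  \<comment> \<open>\<open>Q\<close> sees only the orbit \<open>B\<close>, so the choice made in
    \<open>F\<close> is constant on orbits of \<open>U\<close>.\<close>
  define Q where "Q B g \<longleftrightarrow> g \<in> L \<and> (\<exists>k. (x ^^ k) w \<in> B \<and> (x' ^^ k) w = g ((x ^^ k) w))" for B g
  define F where "F y = (SOME g. Q (orb U y) g)" for y
  have rep: "\<exists>u\<in>U. \<exists>k. y = u ((x ^^ k) w)" if "y \<in> X" for y
    using index_cosets[OF P(1) p U(1,2) idx x w that] by blast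
  have FQ: "Q (orb U y) (F y)" if y: "y \<in> X" for y
  proof -
    obtain u k where k: "u \<in> U" "y = u ((x ^^ k) w)" using rep[OF y] by blast
    then have "(x ^^ k) w \<in> orb U y" using orb_sym[OF U(1) orbI[OF k]] by simp
    moreover obtain g where "g \<in> L" "(x' ^^ k) w = g ((x ^^ k) w)" using uk by blast
    ultimately have "Q (orb U y) g" unfolding Q_def by blast
    then show ?thesis unfolding F_def by (rule someI[of "Q (orb U y)"])
  qed
  have FL: "F y \<in> L" if "y \<in> X" for y using FQ[OF that] by (simp add: Q_def)
  define a where "a = (\<lambda>y. if y \<in> X then F y y else y)"
  have aA: "a \<in> Auts X col" unfolding a_def
  proof (rule glue[where F = F and sim = "\<lambda>u v. v \<in> orb U u"])
    show "finite X" by (rule finX)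
    show "F y \<in> Auts X col" if "y \<in> X" for y using LU[OF FL[OF that]] U(2) P(2) by blast
    show "F y = F y'" if "y' \<in> orb U y" for y y' unfolding F_def using orb_eq[OF U(1) that] by simp
    show "F y y \<in> orb U y" if "y \<in> X" for y using orbI[OF LU[OF FL[OF that]]] by blast
    show "y \<in> orb U y'" if "y' \<in> orb U y" for y y' using orb_sym[OF U(1) that] .
    show "y'' \<in> orb U y" if "y' \<in> orb U y" "y'' \<in> orb U y'" for y y' y'' using orb_trans[OF U(1) that(2,1)] .
    show "col (F y y) (F y' y') = col y y'" if y: "y \<in> X" "y' \<in> X" and n: "y' \<notin> orb U y" for y y'
    proof -
      let ?g = "F y" and ?g' = "F y'"
      have g: "?g \<in> U" "?g' \<in> U" using LU FL y by blast+
      have e: "?g (pinv ?g (?g' y')) = ?g' y'" using perm_grp_simps[OF U(1) g(1)] by simp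
      have b: "pinv ?g (?g' y') \<in> X" "pinv ?g (?g' y') \<notin> orb U y"
        using UX[OF perm_grp_inv[OF U(1) g(1)] UX[OF g(2) y(2)]] n
          orb_moved[OF U(1) perm_grp_inv[OF U(1) g(1)]] orb_moved[OF U(1) g(2)] by auto
      \<comment> \<open>Removing \<open>?g\<close> from both arguments leaves elements of
        \<open>L\<close> acting on the second argument only.\<close>
      have "?g \<in> Auts X col" using g U(2) P(2) by blast
      from Auts_col[OF this y(1) b(1)] have "col (?g y) (?g' y') = col y (pinv ?g (?g' y'))" unfolding e .
      also have "\<dots> = col y (?g' y')" using colL[OF FL[OF y(1)] y(1) b] unfolding e by simp
      also have "\<dots> = col y y'" by (rule colL[OF FL[OF y(2)] y n])
      finally show ?thesis .
    qed
  qed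
  have key: "(x' ^^ j) w = u ((x' ^^ k) w)" if "u \<in> U" "(x ^^ j) w = u ((x ^^ k) w)" for j k u
  proof -
    note ik = index_key[OF P(1) p U(1,2) x that(1) w that(2)]
    show ?thesis using ik(1) ik(2)[OF regD(4)[OF P'(1) x'(1)]] by simp
  qed
  have a_rep: "a (u ((x ^^ k) w)) = u ((x' ^^ k) w)" if u: "u \<in> U" for u k
  proof -
    let ?y = "u ((x ^^ k) w)"
    have y: "?y \<in> X" using UX[OF u xkw(1)] .
    obtain j where j: "(x ^^ j) w \<in> orb U ?y" "(x' ^^ j) w = F ?y ((x ^^ j) w)" using FQ[OF y] by (auto simp: Q_def)
    obtain v where v: "v \<in> U" "(x ^^ j) w = v ?y" using j(1) by (auto simp: orb_def)
    have "(x' ^^ j) w = (v \<circ> u) ((x' ^^ k) w)"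
      by (rule key[OF perm_grp_comp[OF U(1) v(1) u]]) (use v(2) in simp)
    then have "F ?y (v ?y) = v (u ((x' ^^ k) w))" using j(2) v(2) by simp
    moreover have "F ?y \<in> P \<union> P'" using LU[OF FL[OF y]] U(2) by blast
    from Ucomm[OF v(1) this] have "F ?y (v ?y) = v (F ?y ?y)" by (rule sym)
    ultimately have "F ?y ?y = u ((x' ^^ k) w)" using perm_grp_simps(2)[OF U(1) v(1)] by metis
    then show ?thesis unfolding a_def using y by simp
  qed
  have ab: "bij a" by (rule perm_grp_bij[OF perm_grp_Auts aA])
  have sub: "a \<circ> f \<circ> pinv a \<in> P'" if f: "f \<in> P" for f
  proof -
    obtain u k where uk: "u \<in> U" "f w = u ((x ^^ k) w)" using rep[of "f w"] PX f w by blast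
    have uP: "u \<in> P" "u \<in> P'" using uk(1) U by blast+
    have fe: "f = u \<circ> x ^^ k"
      by (rule reg_eqD[OF P(1) f perm_grp_comp[OF G uP(1) xk] w]) (use uk(2) in simp)
    have "a (f y) = u ((x' ^^ k) (a y))" if y: "y \<in> X" for y
    proof -
      obtain v j where v: "v \<in> U" "y = v ((x ^^ j) w)" using rep[OF y] by blast
      have "f y = (u \<circ> v) ((x ^^ (k + j)) w)"
        unfolding fe v(2) using Ucomm[OF v(1), of "x ^^ k"] xk by (simp add: funpow_add)
      then have "a (f y) = (u \<circ> v) ((x' ^^ (k + j)) w)"
        using a_rep[OF perm_grp_comp[OF U(1) uk(1) v(1)]] by metis
      also have "\<dots> = u ((x' ^^ k) (v ((x' ^^ j) w)))"
        using Ucomm[OF v(1), of "x' ^^ k"] xk' by (simp add: funpow_add)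
      finally show ?thesis using a_rep[OF v(1)] v(2) by simp
    qed
    moreover have "a (f y) = u ((x' ^^ k) (a y))" if y: "y \<notin> X" for y
      using permutes_not_in[OF Auts_permutes] y aA f P(2) xk' P'(2) uP(1) by (metis subsetD)
    ultimately have "a (f y) = u ((x' ^^ k) (a y))" for y by blast
    then have "a \<circ> f \<circ> pinv a = u \<circ> x' ^^ k" using pinv_simps[OF ab] by (simp add: fun_eq_iff)
    then show ?thesis using perm_grp_comp[OF G' uP(2) xk'] by simp
  qed
  have sub': "conj_by a P \<subseteq> P'" using sub by blast
  have "card (conj_by a P) = card P'"
    using card_conj[OF ab] card_reg(1)[OF P(1) w] card_reg(1)[OF P'(1) w] by simp
  then have im: "conj_by a P = P'" by (rule card_subset_eq[OF card_reg(2)[OF P'(1) w] sub'])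
  have "conj_by (pinv a) P' = P"
    unfolding im[symmetric] image_image inv_inv_eq[OF ab]
    using pinv_simps[OF ab] by (simp add: fun_eq_iff image_def comp_def)
  then show ?thesis using perm_grp_inv[OF perm_grp_Auts aA] by blast
qed

lemma Auts_eqI:
  assumes "f \<in> Auts X col" "g \<in> Auts X col" "\<And>x. x \<in> X \<Longrightarrow> f x = g x"
  shows "f = g"
proof
  fix x show "f x = g x"
    using assms(3) permutes_not_in[OF Auts_permutes[OF assms(1)]] permutes_not_in[OF Auts_permutes[OF assms(2)]]
    by (cases "x \<in> X") auto
qed

lemma conj_conj:
  assumes "bij a" "bij b"
  shows "conj_by a (conj_by b A) = conj_by (a \<circ> b) A"
  unfolding image_image pinv_comp[OF assms] by (simp add: comp_assoc)

lemma reg_conj_Auts: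
  assumes P: "reg p X P" and a: "a \<in> Auts X col"
  shows "reg p X (conj_by a P)"
proof -
  note b = perm_grp_bij[OF perm_grp_Auts a]
  note i = pinv_simps[OF b]
  have ia: "pinv a \<in> Auts X col" by (rule perm_grp_inv[OF perm_grp_Auts a])
  have inX: "a x \<in> X \<longleftrightarrow> x \<in> X" "pinv a x \<in> X \<longleftrightarrow> x \<in> X" for x using Auts_in[OF a] Auts_in[OF ia] by auto
  show ?thesis unfolding reg_def
  proof (intro conjI ballI impI)
    show "perm_grp (conj_by a P)" by (rule perm_grp_conj[OF regD(1)[OF P] b])
    show "finite X" by (rule regD(2)[OF P])
    show "f \<circ> g = g \<circ> f" if f: "f \<in> conj_by a P" "g \<in> conj_by a P" for f g
    proof -
      obtain f' g' where "f' \<in> P" "g' \<in> P" "f = a \<circ> f' \<circ> pinv a" "g = a \<circ> g' \<circ> pinv a" using f by blast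
      then show ?thesis using regD(3)[OF P, of f' g'] i by (simp add: fun_eq_iff)
    qed
    show "f ^^ p = id" if f: "f \<in> conj_by a P" for f
    proof -
      obtain f' where "f' \<in> P" "f = a \<circ> f' \<circ> pinv a" using f by blast
      then show ?thesis using conj_pow[OF b, where f = f' and n = p] regD(4)[OF P, of f'] i by simp
    qed
    show "f x \<in> X" if f: "f \<in> conj_by a P" and x: "x \<in> X" for f x
    proof -
      obtain f' where "f' \<in> P" "f = a \<circ> f' \<circ> pinv a" using f by blast
      then show ?thesis using inX regD(5)[OF P] x by simp
    qed
    show "\<exists>f\<in>conj_by a P. y = f x" if x: "x \<in> X" and y: "y \<in> X" for x y
    proof -
      have "pinv a x \<in> X" "pinv a y \<in> X" using inX x y by auto
      from regD(6)[OF P this] obtain f where f: "f \<in> P" "pinv a y = f (pinv a x)" by blast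
      then have "y = (a \<circ> f \<circ> pinv a) x" using i(1)[of y] by simp
      then show ?thesis using f(1) by blast
    qed
    show "f = id" if f: "f \<in> conj_by a P" and x: "x \<in> X" "f x = x" for f x
    proof -
      obtain f' where f': "f' \<in> P" "f = a \<circ> f' \<circ> pinv a" using f by blast
      have "f' (pinv a x) = pinv a x" using x(2) f'(2) i(2)[of "f' (pinv a x)"] by simp
      then have "f' = id" using regD(7)[OF P f'(1)] inX x(1) by blast
      then show ?thesis using f'(2) i by simp
    qed
  qed
qed

text \<open>These elements are the kernel of the action of \<open>R\<close> on the classes of an
  invariant equivalence, hence a normal subgroup.\<close>

lemma rel_kernel:
  assumes R: "perm_grp R" "finite R" and RX: "\<And>r x. r \<in> R \<Longrightarrow> x \<in> X \<Longrightarrow> r x \<in> X"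
    and refl: "\<And>x. x \<in> X \<Longrightarrow> e x x"
    and sym: "\<And>x y. x \<in> X \<Longrightarrow> y \<in> X \<Longrightarrow> e x y \<Longrightarrow> e y x"
    and trans: "\<And>x y t. x \<in> X \<Longrightarrow> y \<in> X \<Longrightarrow> t \<in> X \<Longrightarrow> e x y \<Longrightarrow> e y t \<Longrightarrow> e x t"
    and inv: "\<And>r x y. r \<in> R \<Longrightarrow> x \<in> X \<Longrightarrow> y \<in> X \<Longrightarrow> e x y \<Longrightarrow> e (r x) (r y)"
  shows "perm_grp {r \<in> R. \<forall>x\<in>X. e x (r x)}"
    and "\<And>r f. r \<in> R \<Longrightarrow> f \<in> {r \<in> R. \<forall>x\<in>X. e x (r x)} \<Longrightarrow> r \<circ> f \<circ> pinv r \<in> {r \<in> R. \<forall>x\<in>X. e x (r x)}"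
proof -
  let ?K = "{r \<in> R. \<forall>x\<in>X. e x (r x)}"
  show "perm_grp ?K"
  proof (rule finite_subgroupI[OF R])
    show "id \<in> ?K" using perm_grp_id[OF R(1)] refl by simp
    show "f \<circ> g \<in> ?K" if f: "f \<in> ?K" and g: "g \<in> ?K" for f g
    proof -
      have "e x (f (g x))" if x: "x \<in> X" for x
        by (rule trans[of x "g x"]) (use f g RX x in auto)
      then show ?thesis using perm_grp_comp[OF R(1)] f g by simp
    qed
  qed auto
  show "r \<circ> f \<circ> pinv r \<in> ?K" if r: "r \<in> R" and f: "f \<in> ?K" for r f
  proof -
    have "e x (r (f (pinv r x)))" if x: "x \<in> X" for x
    proof -
      have px: "pinv r x \<in> X" using RX[OF perm_grp_inv[OF R(1) r] x] .
      have "e (pinv r x) (f (pinv r x))" "f (pinv r x) \<in> X" using f px RX by auto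
      from inv[OF r px this(2,1)] show ?thesis using perm_grp_simps(1)[OF R(1) r] by simp
    qed
    moreover have "r \<circ> f \<circ> pinv r \<in> R" using perm_grp_comp[OF R(1) perm_grp_comp[OF R(1) r]] f perm_grp_inv[OF R(1) r] by simp
    ultimately show ?thesis by simp
  qed
qed

lemma subgroup_of_reg:
  assumes P: "reg p X P" "p > 0" and U: "U \<subseteq> P" "id \<in> U" "\<And>f g. f \<in> U \<Longrightarrow> g \<in> U \<Longrightarrow> f \<circ> g \<in> U"
  shows "perm_grp U"
proof (rule perm_grpI)
  show b: "bij f" if "f \<in> U" for f using perm_grp_bij[OF regD(1)[OF P(1)]] U(1) that by blast
  show "pinv f \<in> U" if f: "f \<in> U" for f
  proof -
    have "f ^^ n \<in> U" for n by (induction n) (simp_all only: funpow.simps U(2) U(3)[OF f])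
    moreover have "f \<circ> f ^^ (p - 1) = f ^^ p" using P(2) by (metis Suc_diff_1 funpow.simps(2))
    then have "pinv f = f ^^ (p - 1)" using pinv_unique[OF b[OF f]] regD(4)[OF P(1)] U(1) f by auto
    ultimately show ?thesis by metis
  qed
qed (use U in auto)

lemma gen2:
  assumes P: "reg p X P" "p > 0" and zy: "z \<in> P" "y \<in> P"
  defines "U \<equiv> {f. \<exists>i j. f = z ^^ i \<circ> y ^^ j}"
  shows "perm_grp U" "U \<subseteq> P" "card U \<le> p * p" "z \<in> U" "y \<in> U"
proof -
  note G = regD(1)[OF P(1)]
  have pw: "z ^^ i \<in> P" "y ^^ i \<in> P" for i using perm_grp_pow[OF G] zy by auto
  show sub: "U \<subseteq> P" using pw perm_grp_comp[OF G] by (auto simp: U_def)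
  show "z \<in> U" unfolding U_def by (rule CollectI, rule exI[of _ 1], rule exI[of _ 0]) simp
  show "y \<in> U" unfolding U_def by (rule CollectI, rule exI[of _ 0], rule exI[of _ 1]) simp
  show "perm_grp U"
  proof (rule subgroup_of_reg[OF P sub])
    show "id \<in> U" unfolding U_def by (rule CollectI, rule exI[of _ 0], rule exI[of _ 0]) simp
    show "f \<circ> g \<in> U" if fg: "f \<in> U" "g \<in> U" for f g
    proof -
      obtain i j k l where e: "f = z ^^ i \<circ> y ^^ j" "g = z ^^ k \<circ> y ^^ l" using fg unfolding U_def by blast
      have "f \<circ> g = z ^^ (i + k) \<circ> y ^^ (j + l)"
        unfolding e using regD(3)[OF P(1) pw(2)[of j] pw(1)[of k]] by (simp add: fun_eq_iff funpow_add)
      then show ?thesis unfolding U_def by blast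
    qed
  qed
  have "U \<subseteq> (\<lambda>(i, j). z ^^ i \<circ> y ^^ j) ` ({..<p} \<times> {..<p})"
  proof
    fix f assume "f \<in> U"
    then obtain i j where f: "f = z ^^ i \<circ> y ^^ j" unfolding U_def by blast
    have "z ^^ i = z ^^ (i mod p)" "y ^^ j = y ^^ (j mod p)"
      using pow_mod_period(2)[OF regD(4)[OF P(1) zy(1)], of "i mod p" "i div p"]
        pow_mod_period(2)[OF regD(4)[OF P(1) zy(2)], of "j mod p" "j div p"] by simp_all
    then have "f = (\<lambda>(i, j). z ^^ i \<circ> y ^^ j) (i mod p, j mod p)" using f by simp
    moreover have "(i mod p, j mod p) \<in> {..<p} \<times> {..<p}" using P(2) by simp
    ultimately show "f \<in> (\<lambda>(i, j). z ^^ i \<circ> y ^^ j) ` ({..<p} \<times> {..<p})" by (rule image_eqI)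
  qed
  then have "card U \<le> card ({..<p} \<times> {..<p})" by (rule surj_card_le[rotated]) simp
  then show "card U \<le> p * p" by (simp add: card_cartesian_product)
qed

section \<open>Twins and gluing along similarity classes\<close>

context block_perm
begin

definition twin :: "'a \<Rightarrow> 'a \<Rightarrow> bool" where
  "twin x x' \<longleftrightarrow> (\<forall>y\<in>X. \<not> sim x y \<longrightarrow> col x y = col x' y \<and> col y x = col y x')"

lemma twin_orb:
  assumes "x \<in> X" "x' \<in> orb (cyc z) x"
  shows "twin x x'"
  unfolding twin_def
proof (intro ballI impI conjI)
  fix y assume y: "y \<in> X" "\<not> sim x y"
  have yo: "y \<in> orb (cyc z) y" by (rule orb_refl[OF cyc_grp])
  show "col x y = col x' y" using col_nsim_orb[OF assms(1) y assms(2) yo] by simp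
  have "\<not> sim y x" using y sim_sym assms(1) by blast
  then show "col y x = col y x'" using col_nsim_orb[OF y(1) assms(1) _ yo assms(2)] by simp
qed

lemma twin_trans:
  assumes "x \<in> X" "x' \<in> X" "sim x x'" "twin x x'" "twin x' x''"
  shows "twin x x''"
  unfolding twin_def
proof (intro ballI impI)
  fix y assume y: "y \<in> X" "\<not> sim x y"
  then have "\<not> sim x' y" using sim_trans[OF assms(3)] by blast
  then show "col x y = col x'' y \<and> col y x = col y x''" using assms(4,5) y unfolding twin_def by auto
qed

text \<open>On the similarity class of \<open>g w\<close> the glued map is \<open>g' \<circ> pinv g\<close>. It preserves the colours inside the
  class because \<open>g\<close> and \<open>g'\<close> do, and those between classes because it moves every point to a twin.\<close>

lemma class_glue:
  assumes w: "w \<in> X" and PN: "P \<subseteq> N" "P' \<subseteq> N"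
    and rep: "\<And>x. x \<in> X \<Longrightarrow> \<exists>g\<in>P. \<exists>g'\<in>P'. g w = g' w \<and> sim x (g w)"
    and tw: "\<And>x g g'. x \<in> X \<Longrightarrow> g \<in> P \<Longrightarrow> g' \<in> P' \<Longrightarrow> g w = g' w \<Longrightarrow> sim x (g w) \<Longrightarrow> twin x (g' (pinv g x))"
  obtains a where "a \<in> Auts X col"
    "\<And>x. x \<in> X \<Longrightarrow> \<exists>g\<in>P. \<exists>g'\<in>P'. g w = g' w \<and> sim x (g w) \<and> (\<forall>u\<in>X. sim x u \<longrightarrow> a u = g' (pinv g u))"
proof -
  define C where "C x = {y \<in> X. sim x y}" for x
  have C_eq: "C x = C y" if "x \<in> X" "y \<in> X" "sim x y" for x y
    unfolding C_def using sim_trans[OF that(3)] sim_trans[OF sim_sym[OF that]] by blast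
  define ok where "ok B h \<longleftrightarrow> fst h \<in> P \<and> snd h \<in> P' \<and> fst h w = snd h w \<and> fst h w \<in> B" for B and h :: "('a \<Rightarrow> 'a) \<times> ('a \<Rightarrow> 'a)"
  \<comment> \<open>Choosing from the set \<open>C x\<close> instead of the point \<open>x\<close>
    makes the pair constant on each class.\<close>
  define h where "h x = (SOME k. ok (C x) k)" for x
  have h: "ok (C x) (h x)" if x: "x \<in> X" for x
  proof -
    obtain g g' where g: "g \<in> P" "g' \<in> P'" "g w = g' w" "sim x (g w)" using rep[OF x] by blast
    have "g w \<in> X" using Auts_in[OF N_aut] g(1) PN(1) w by blast
    then have "ok (C x) (g, g')" using g by (simp add: ok_def C_def)
    then show ?thesis unfolding h_def by (rule someI[of "ok (C x)"])
  qed
  define F where "F x = snd (h x) \<circ> pinv (fst (h x))" for x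
  have hN: "fst (h x) \<in> N" "snd (h x) \<in> N" "F x \<in> N" if x: "x \<in> X" for x
  proof -
    show 1: "fst (h x) \<in> N" "snd (h x) \<in> N" using h[OF x] PN by (auto simp: ok_def)
    show "F x \<in> N" unfolding F_def by (rule perm_grp_comp[OF N_grp 1(2) perm_grp_inv[OF N_grp 1(1)]])
  qed
  have hs: "fst (h x) w = snd (h x) w" "sim x (fst (h x) w)" "fst (h x) w \<in> X" "fst (h x) \<in> P" "snd (h x) \<in> P'" if "x \<in> X" for x
    using h[OF that] by (auto simp: ok_def C_def)
  \<comment> \<open>\<open>F x\<close> fixes the point \<open>fst (h x) w\<close>, which is similar
    to \<open>x\<close>, and it preserves similarity.\<close>
  have Fs: "sim x (F x x)" if x: "x \<in> X" for x
  proof -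
    have "sim (F x x) (F x (fst (h x) w))" by (rule N_sim[OF hN(3)[OF x] hs(2)[OF x]])
    moreover have "F x (fst (h x) w) = fst (h x) w"
      unfolding F_def using perm_grp_simps(2)[OF N_grp hN(1)[OF x], of w] hs(1)[OF x] by simp
    ultimately have "sim (F x x) (fst (h x) w)" by simp
    then have "sim (fst (h x) w) (F x x)" using sim_sym Auts_in[OF N_aut[OF hN(3)[OF x]]] x hs(3)[OF x] by blast
    then show ?thesis by (rule sim_trans[OF hs(2)[OF x]])
  qed
  have FX: "F x x \<in> X" if x: "x \<in> X" for x using Auts_in[OF N_aut[OF hN(3)[OF x]]] x by simp
  have tF: "twin x (F x x)" if x: "x \<in> X" for x
    unfolding F_def using tw[OF x hs(4,5,1,2)[OF x]] by simp
  define a where "a = (\<lambda>x. if x \<in> X then F x x else x)"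
  have F_eq: "F x = F y" if "x \<in> X" "y \<in> X" "sim x y" for x y
    unfolding F_def h_def using C_eq[OF that] by simp
  have "a \<in> Auts X col" unfolding a_def
  proof (rule glue[where F = F and sim = sim])
    show "col (F x x) (F y y) = col x y" if xy: "x \<in> X" "y \<in> X" "\<not> sim x y" for x y
    proof -
      have "col x y = col (F x x) y" using tF[OF xy(1)] xy(2,3) unfolding twin_def by blast
      moreover have "\<not> sim y (F x x)"
      proof
        assume "sim y (F x x)"
        then have "sim (F x x) y" using sim_sym[OF xy(2) FX[OF xy(1)]] by blast
        then show False using sim_trans[OF Fs[OF xy(1)]] xy(3) by blast
      qed
      then have "col (F x x) y = col (F x x) (F y y)" using tF[OF xy(2)] FX[OF xy(1)] unfolding twin_def by blast
      ultimately show ?thesis by simp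
    qed
  qed (use finX hN N_aut F_eq Fs sim_sym sim_trans in blast)+
  moreover have "\<exists>g\<in>P. \<exists>g'\<in>P'. g w = g' w \<and> sim x (g w) \<and> (\<forall>u\<in>X. sim x u \<longrightarrow> a u = g' (pinv g u))" if x: "x \<in> X" for x
  proof (intro bexI conjI ballI impI)
    show "a u = snd (h x) (pinv (fst (h x)) u)" if "u \<in> X" "sim x u" for u
    proof -
      have "a u = F u u" using that(1) by (simp add: a_def)
      also have "F u = F x" using F_eq[OF x that] by simp
      finally show ?thesis by (simp add: F_def)
    qed
  qed (use hs[OF x] in auto)
  ultimately show ?thesis by (rule that)
qed

end

text \<open>Common setting for both uses of similarity: \<open>V = X\<close> with
  \<open>r = p\<close> for the elementary abelian groups, and \<open>V\<close> a transversal with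
  \<open>r = q\<close> for the full groups. As \<open>P\<close> is transitive on \<open>V\<close>,
  it suffices to study the class of one base point \<open>w\<close>.\<close>

locale class_group = block_perm X col z r
  for X :: "'a set" and col :: "'a \<Rightarrow> 'a \<Rightarrow> 'c" and z r +
  fixes p :: nat and V P R w n
  assumes prime_p: "prime p" and VX: "V \<subseteq> X" and wV: "w \<in> V" and P: "reg p V P" and cardV: "card V = p ^ 3"
    and R: "perm_grp R" "R \<subseteq> N" "card R = p ^ n" and RV: "r' \<in> R \<Longrightarrow> v \<in> V \<Longrightarrow> r' v \<in> V" and PR: "P \<subseteq> R"
begin

abbreviation "Z \<equiv> cyc z"

text \<open>The stabiliser in \<open>P\<close> of the class of \<open>w\<close>. Since
  \<open>P\<close> is abelian, it stabilises the class of every point of \<open>V\<close>, and its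
  orbits on \<open>V\<close> are the traces of the classes.\<close>

definition "D = {g \<in> P. sim w (g w)}"

definition "C0 = {v \<in> V. sim w v}"

definition "S = {h \<in> R. sim w (h w)}"

lemma RA: "R \<subseteq> Auts X col" using R(2) N_aut by blast

lemma finR: "finite R" by (rule finite_subset[OF RA finite_Auts[OF finX]])

lemma wX: "w \<in> X" using wV VX by blast

lemma p_pos: "p > 0" by (rule prime_gt_0_nat[OF prime_p])

lemma PN: "P \<subseteq> N" using PR R(2) by blast

lemma R_orb: "h \<in> R \<Longrightarrow> v \<in> X \<Longrightarrow> u \<in> orb Z v \<Longrightarrow> h u \<in> orb Z (h v)"
  using N_orb R(2) by blast

lemma R_sim: "h \<in> R \<Longrightarrow> sim u v \<Longrightarrow> sim (h u) (h v)"
  using N_sim R(2) by blast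

lemma D_sub: "D \<subseteq> P" by (auto simp: D_def)

lemma D_grp: "perm_grp D"
proof (rule subgroup_of_reg[OF P p_pos D_sub])
  show "id \<in> D" using perm_grp_id[OF regD(1)[OF P]] sim_refl by (auto simp: D_def)
  show "f \<circ> g \<in> D" if f: "f \<in> D" and g: "g \<in> D" for f g
  proof -
    have "sim (f w) (f (g w))" using R_sim[of f] f g PR by (auto simp: D_def)
    then show ?thesis using f g sim_trans perm_grp_comp[OF regD(1)[OF P]] by (auto simp: D_def)
  qed
qed

lemma D_sim:
  assumes g: "g \<in> D" and v: "v \<in> V"
  shows "sim v (g v)"
proof -
  obtain f where f: "f \<in> P" "v = f w" using regD(6)[OF P wV v] by blast
  have "sim (f w) (f (g w))" using R_sim[of f] f(1) PR g by (auto simp: D_def)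
  then show "sim v (g v)" using regD(3)[OF P f(1), of g w] g f(2) by (simp add: D_def)
qed

lemma sim_D_iff:
  assumes "v \<in> V" "u \<in> V"
  shows "sim v u \<longleftrightarrow> u \<in> orb D v"
proof
  assume s: "sim v u"
  obtain f where f: "f \<in> P" "v = f w" using regD(6)[OF P wV assms(1)] by blast
  obtain g where g: "g \<in> P" "u = g v" using regD(6)[OF P assms] by blast
  have "sim (f w) (f (g w))" using s f g regD(3)[OF P f(1) g(1), of w] by simp
  then have "sim w (g w)" using N_sim_iff[of f] f(1) PN by blast
  then show "u \<in> orb D v" using g by (intro orbI[of g]) (auto simp: D_def)
next
  assume "u \<in> orb D v"
  then show "sim v u" using D_sim[OF _ assms(1)] by (auto simp: orb_def)
qed

lemma card_P: "card P = p ^ 3" "finite P"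
  using card_reg[OF P wV] cardV by simp_all

lemma card_D: obtains m where "m \<le> 3" "card D = p ^ m"
  using card_subgroup_prime_power[OF regD(1)[OF P] D_grp D_sub card_P(1) prime_p] by blast

lemma C0_orb: "C0 = orb D w"
  using sim_D_iff[OF wV] D_sub regD(5)[OF P _ wV] by (auto simp: C0_def orb_def)

lemma card_C0: "card C0 = card D"
  unfolding C0_orb by (rule card_orb_free[OF _ D_grp]) (use regD(7)[OF P _ wV] D_sub in blast)

lemma C0_V: "v \<in> C0 \<Longrightarrow> v \<in> V" and C0_sim: "v \<in> C0 \<Longrightarrow> sim w v"
  by (auto simp: C0_def)

lemma finC0: "finite C0" using finite_subset[OF _ regD(2)[OF P]] C0_V by blast

lemma w_C0: "w \<in> C0" using wV sim_refl by (simp add: C0_def)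

lemma S_C0:
  assumes h: "h \<in> S" and v: "v \<in> C0"
  shows "h v \<in> C0"
proof -
  have hR: "h \<in> R" "sim w (h w)" using h unfolding S_def by blast+
  have "sim w (h v)" by (rule sim_trans[OF hR(2) R_sim[OF hR(1) C0_sim[OF v]]])
  then show ?thesis using RV[OF hR(1) C0_V[OF v]] unfolding C0_def by blast
qed

lemma S_sub: "S \<subseteq> R" by (auto simp: S_def)

lemma S_grp: "perm_grp S"
proof (rule finite_subgroupI[OF R(1) finR S_sub])
  show "id \<in> S" unfolding S_def
    by (rule CollectI, rule conjI[OF perm_grp_id[OF R(1)]]) (simp only: id_apply sim_refl)
  show "f \<circ> g \<in> S" if f: "f \<in> S" and g: "g \<in> S" for f g
  proof -
    have fg: "f \<in> R" "g \<in> R" using f g unfolding S_def by blast+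
    have "f (g w) \<in> C0" using S_C0[OF f] S_C0[OF g] w_C0 by blast
    then show ?thesis using perm_grp_comp[OF R(1) fg] unfolding S_def C0_def
      by (simp only: mem_Collect_eq comp_apply)
  qed
qed

lemma finS: "finite S" using finite_subset[OF S_sub finR] .

lemma card_S: obtains l where "card S = p ^ l"
  using card_subgroup_prime_power[OF R(1) S_grp S_sub R(3) prime_p] by blast

lemma D_S: "D \<subseteq> S" using PR by (auto simp: D_def S_def)

lemma reg_C0: "reg p C0 D"
  unfolding reg_def
proof (intro conjI ballI impI)
  show "perm_grp D" by (rule D_grp)
  show "finite C0" by (rule finC0)
  show "f \<circ> g = g \<circ> f" if "f \<in> D" "g \<in> D" for f g using reg_comm[OF P] that D_sub by blast
  show "f ^^ p = id" if "f \<in> D" for f using regD(4)[OF P] that D_sub by blast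
  show "f x \<in> C0" if "f \<in> D" "x \<in> C0" for f x using S_C0[OF subsetD[OF D_S that(1)] that(2)] .
  show "\<exists>f\<in>D. y = f x" if x: "x \<in> C0" and y: "y \<in> C0" for x y
  proof -
    have "sim x y" using sim_trans[OF sim_sym[OF wX _ C0_sim[OF x]] C0_sim[OF y]] C0_V[OF x] VX by blast
    then have "y \<in> orb D x" using sim_D_iff[OF C0_V[OF x] C0_V[OF y]] by simp
    then show ?thesis by (auto simp: orb_def)
  qed
  show "f = id" if "f \<in> D" "x \<in> C0" "f x = x" for f x
    using regD(7)[OF P subsetD[OF D_sub that(1)] C0_V[OF that(2)] that(3)] .
qed

text \<open>Pulls the candidate \<open>g' \<circ> pinv g\<close> on the class of \<open>g w\<close>
  back to the class of \<open>w\<close>, where it becomes \<open>pinv g \<circ> g'\<close>, an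
  element of \<open>S\<close> fixing \<open>w\<close>.\<close>

lemma class_shift:
  assumes g: "g \<in> P" "g' \<in> R" "g w = g' w" and x: "x \<in> V" "sim x (g w)"
  shows "pinv g \<circ> g' \<in> S" "(pinv g \<circ> g') w = w" "pinv g x \<in> C0" "g' (pinv g x) = g ((pinv g \<circ> g') (pinv g x))"
proof -
  have gR: "g \<in> R" using g PR by auto
  have iR: "pinv g \<in> R" by (rule perm_grp_inv[OF R(1) gR])
  note gs = perm_grp_simps[OF R(1) gR]
  show rw: "(pinv g \<circ> g') w = w" using g(3) gs(2)[of w] by simp
  then show "pinv g \<circ> g' \<in> S" using perm_grp_comp[OF R(1) iR g(2)] sim_refl unfolding S_def by simp
  have "sim (pinv g x) w" using R_sim[OF iR x(2)] gs by simp
  then show "pinv g x \<in> C0" using sim_sym[OF _ wX] RV[OF iR x(1)] VX unfolding C0_def by blast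
  show "g' (pinv g x) = g ((pinv g \<circ> g') (pinv g x))" using gs by simp
qed

text \<open>Bounds the drift inside a class: with \<open>K\<close> trivial there is none, with
  \<open>K\<close> of order \<open>p\<close> it stays in blocks of size \<open>p\<close>.\<close>

lemma C0_block_fix:
  assumes K: "perm_grp K" "K \<subseteq> D" "card C0 \<le> p * card K"
    and eq: "\<And>h k v. h \<in> S \<Longrightarrow> k \<in> K \<Longrightarrow> v \<in> C0 \<Longrightarrow> h (k v) \<in> orb K (h v)"
    and h: "h \<in> S" "h w = w" and v: "v \<in> C0"
  shows "h v \<in> orb K v"
proof -
  obtain l where l: "card S = p ^ l" by (rule card_S)
  show ?thesis
  proof (rule block_fix[where R = S and X = C0 and w = w])
    show "perm_grp S" "finite S" "card S = p ^ l" "prime p" "perm_grp K" "finite C0"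
      by (fact S_grp finS l prime_p K(1) finC0)+
    show "k x \<in> C0" if "k \<in> K" "x \<in> C0" for k x using regD(5)[OF reg_C0 subsetD[OF K(2) that(1)] that(2)] .
    show "k = id" if "k \<in> K" "x \<in> C0" "k x = x" for k x
      using regD(7)[OF reg_C0 subsetD[OF K(2) that(1)] that(2,3)] .
    show "card C0 \<le> p * card K" by (rule K(3))
    show "r' x \<in> C0" if "r' \<in> S" "x \<in> C0" for r' x by (rule S_C0[OF that])
    show "r' (k x) \<in> orb K (r' x)" if "r' \<in> S" "k \<in> K" "x \<in> C0" for r' k x by (rule eq[OF that])
    show "h \<in> S" "w \<in> C0" "h w \<in> orb K w" "v \<in> C0" using h w_C0 v orb_refl[OF K(1)] by simp_all
  qed
qed

end

subsection \<open>Two regular elementary abelian groups of order \<open>p ^ 3\<close>\<close>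

text \<open>The vertex set is \<open>V\<close> itself and \<open>z\<close> belongs to
  \<open>P\<close>, so \<open>D\<close> contains \<open>Z\<close> and has order \<open>p\<close>,
  \<open>p ^ 2\<close> or \<open>p ^ 3\<close>.\<close>

locale elem_pair = class_group V col z p p V P R w n
  for V :: "'a set" and col :: "'a \<Rightarrow> 'a \<Rightarrow> 'c" and z p P R w n +
  fixes P' :: "('a \<Rightarrow> 'a) set"
  assumes P': "reg p V P'" and P'R: "P' \<subseteq> R"
    and zP: "z \<in> P" "z \<in> P'" and zc: "\<And>f. f \<in> R \<Longrightarrow> f \<circ> z = z \<circ> f"
begin

lemma Z_sub: "Z \<subseteq> P" "Z \<subseteq> P'"
  using perm_grp_cyc_sub regD(1)[OF P] regD(1)[OF P'] zP by blast+

lemma card_Z: "card Z = p" by (rule card_cyc(1)[OF wV])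

lemma Z_D: "Z \<subseteq> D"
  using perm_grp_cyc_sub[OF D_grp, of z] zP sim_pow[OF wV, of 1] by (auto simp: D_def)

lemma card_D_pos: obtains m where "m \<in> {1, 2, 3}" "card D = p ^ m"
proof -
  obtain m where m: "m \<le> 3" "card D = p ^ m" by (rule card_D)
  have "p \<le> card D" using card_mono[OF finite_subset[OF D_sub card_P(2)] Z_D] card_Z by simp
  then have "m \<noteq> 0" using m(2) prime_gt_1_nat[OF prime_r] by (intro notI) simp
  then have "m \<in> {1, 2, 3}" using m(1) by auto
  then show ?thesis using that m(2) by blast
qed

text \<open>An element \<open>f\<close> that commutes with \<open>R\<close> modulo the kernel of the
  action on \<open>Z\<close>-orbits agrees, up to those orbits, with an element of either regular
  group, because both are abelian and transitive.\<close>

lemma second_central: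
  obtains y y' where "y \<in> P" "y \<notin> Z" "y' \<in> P'" "\<And>v. v \<in> V \<Longrightarrow> y' v \<in> orb Z (y v)"
    "\<And>r v. r \<in> R \<Longrightarrow> v \<in> V \<Longrightarrow> r (y v) \<in> orb Z (y (r v))" "card D = p ^ 2 \<Longrightarrow> y \<in> D"
proof -
  \<comment> \<open>If classes have \<open>p ^ 2\<close> points, the central element is sought among
    those preserving every class, which yields \<open>y \<in> D\<close>. Otherwise the relation
    imposes nothing.\<close>
  define rel where "rel = (if card D = p ^ 2 then sim else (\<lambda>_ _. True))"
  define M where "M = {r \<in> R. \<forall>v\<in>V. rel v (r v)}"
  define K where "K = {r \<in> R. \<forall>v\<in>V. r v \<in> orb Z v}"
  have rel: "rel x x" if "x \<in> V" for x using sim_refl by (simp add: rel_def)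
  have rel_sym: "rel y x" if "x \<in> V" "y \<in> V" "rel x y" for x y
    using sim_sym[OF that(1,2)] that(3) by (simp add: rel_def split: if_splits)
  have rel_trans: "rel x t" if "x \<in> V" "y \<in> V" "t \<in> V" "rel x y" "rel y t" for x y t
    using sim_trans[of x y t] that(4,5) by (simp add: rel_def split: if_splits)
  have rel_inv: "rel (r x) (r y)" if "r \<in> R" "x \<in> V" "y \<in> V" "rel x y" for r x y
    using N_sim[OF subsetD[OF R(2) that(1)], of x y] that(4) by (simp add: rel_def split: if_splits)
  have M1: "perm_grp M" unfolding M_def
    by (rule rel_kernel(1)[where R = R and X = V and e = rel]) (fact R(1) finR RV rel rel_sym rel_trans rel_inv)+
  have M2: "r \<circ> f \<circ> pinv r \<in> M" if "r \<in> R" "f \<in> M" for r f unfolding M_def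
    by (rule rel_kernel(2)[where R = R and X = V and e = rel])
      (fact R(1) finR RV rel rel_sym rel_trans rel_inv that(1) that(2)[unfolded M_def])+
  have o1: "x \<in> orb Z x" if "x \<in> V" for x by (rule orb_refl[OF cyc_grp])
  have o2: "x \<in> orb Z y" if "x \<in> V" "y \<in> V" "y \<in> orb Z x" for x y by (rule orb_sym[OF cyc_grp that(3)])
  have o3: "t \<in> orb Z x" if "x \<in> V" "y \<in> V" "t \<in> V" "y \<in> orb Z x" "t \<in> orb Z y" for x y t
    by (rule orb_trans[OF cyc_grp that(5,4)])
  have o4: "r y \<in> orb Z (r x)" if "r \<in> R" "x \<in> V" "y \<in> V" "y \<in> orb Z x" for r x y by (rule R_orb[OF that(1,2,4)])
  have K1: "perm_grp K" unfolding K_def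
    by (rule rel_kernel(1)[where R = R and X = V and e = "\<lambda>x y. y \<in> orb Z x"]) (fact R(1) finR RV o1 o2 o3 o4)+
  have K2: "r \<circ> f \<circ> pinv r \<in> K" if "r \<in> R" "f \<in> K" for r f unfolding K_def
    by (rule rel_kernel(2)[where R = R and X = V and e = "\<lambda>x y. y \<in> orb Z x"])
      (fact R(1) finR RV o1 o2 o3 o4 that(1) that(2)[unfolded K_def])+
  have KM: "K \<subseteq> M"
    unfolding K_def M_def rel_def using sim_orb by auto
  define D' where "D' = (if card D = p ^ 2 then D else P)"
  have D'M: "D' \<subseteq> M" using D_sim D_sub PR by (auto simp: D'_def M_def rel_def)
  have "card D' > p"
  proof -
    have "p ^ 1 < p ^ 2" "p ^ 1 < p ^ 3" using prime_gt_1_nat[OF prime_r] by (intro power_strict_increasing; simp)+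
    then show ?thesis using card_reg(1)[OF P wV] cardV by (simp add: D'_def)
  qed
  moreover have "finite Z" by (rule card_cyc(2)[OF wV])
  ultimately have "\<not> D' \<subseteq> Z" using card_mono[of Z D'] card_Z by auto
  then obtain g where g: "g \<in> D'" "g \<notin> Z" by blast
  have gP: "g \<in> P" using g(1) D_sub by (auto simp: D'_def split: if_splits)
  have PK: "f \<in> Z" if f: "f \<in> P" "f \<in> K" for f
  proof -
    have "f w \<in> orb Z w" using f(2) wV by (simp add: K_def)
    then obtain t where t: "t \<in> Z" "f w = t w" by (auto simp: orb_def)
    have "f = t" by (rule reg_eqD[OF P f(1) _ wV]) (use t Z_sub in auto)
    then show ?thesis using t(1) by simp
  qed
  have "g \<notin> K" using PK gP g(2) by blast
  then have KneM: "K \<noteq> M" using g(1) D'M by blast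
  have MR: "M \<subseteq> R" by (auto simp: M_def)
  have "\<exists>f\<in>M. f \<notin> K \<and> (\<forall>r\<in>R. \<exists>e\<in>K. r \<circ> f = e \<circ> f \<circ> r)"
    by (rule central_mod[where R = R and N = M and K = K])
      (fact R(1) finR R(3) prime_r M1 M2 K1 K2 KM KneM MR | blast)+
  then obtain f where f: "f \<in> M" "f \<notin> K" "\<And>r. r \<in> R \<Longrightarrow> \<exists>e\<in>K. r \<circ> f = e \<circ> f \<circ> r" by blast
  have fR: "f \<in> R" using f(1) by (simp add: M_def)
  have rf: "r (f v) \<in> orb Z (f (r v))" if r: "r \<in> R" and v: "v \<in> V" for r v
  proof -
    obtain e where e: "e \<in> K" "r \<circ> f = e \<circ> f \<circ> r" using f(3)[OF r] by blast
    have "r (f v) = e (f (r v))" using e(2) by (metis comp_apply)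
    moreover have "f (r v) \<in> V" using RV fR r v by blast
    ultimately show ?thesis using e(1) by (simp add: K_def)
  qed
  have lift: "\<exists>y\<in>Q. f w = y w \<and> (\<forall>v\<in>V. f v \<in> orb Z (y v))" if Q: "reg p V Q" "Q \<subseteq> R" for Q
  proof -
    obtain y where y: "y \<in> Q" "f w = y w" using regD(6)[OF Q(1) wV RV[OF fR wV]] by blast
    have "f v \<in> orb Z (y v)" if v: "v \<in> V" for v
    proof -
      obtain h where h: "h \<in> Q" "v = h w" using regD(6)[OF Q(1) wV v] by blast
      have "h (f w) \<in> orb Z (f (h w))" using rf[OF _ wV] h(1) Q(2) by blast
      then have "f v \<in> orb Z (h (y w))" using orb_sym[OF cyc_grp] y(2) h(2) by simp
      then show ?thesis using regD(3)[OF Q(1) h(1) y(1)] h(2) by simp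
    qed
    then show ?thesis using y by blast
  qed
  obtain y where y: "y \<in> P" "f w = y w" "\<forall>v\<in>V. f v \<in> orb Z (y v)" using lift[OF P PR] by blast
  obtain y' where y': "y' \<in> P'" "f w = y' w" "\<forall>v\<in>V. f v \<in> orb Z (y' v)" using lift[OF P' P'R] by blast
  show ?thesis
  proof (rule that[OF y(1) _ y'(1)])
    show "y \<notin> Z"
    proof
      assume "y \<in> Z"
      then have "f v \<in> orb Z v" if "v \<in> V" for v
        using y(3) that orb_trans[OF cyc_grp _ orbI[of y Z]] by blast
      then show False using f(2) fR by (simp add: K_def)
    qed
    show "y' v \<in> orb Z (y v)" if "v \<in> V" for v
      using y(3) y'(3) that orb_sym[OF cyc_grp] orb_trans[OF cyc_grp] by blast
    show "r (y v) \<in> orb Z (y (r v))" if r: "r \<in> R" and v: "v \<in> V" for r v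
    proof -
      have fv: "f v \<in> V" using RV fR v by blast
      have "y v \<in> orb Z (f v)" using y(3) v orb_sym[OF cyc_grp] by blast
      then have "r (y v) \<in> orb Z (r (f v))" by (rule R_orb[OF r fv])
      moreover have "f (r v) \<in> orb Z (y (r v))" using y(3) RV r v by blast
      ultimately show ?thesis using rf[OF r v] orb_trans[OF cyc_grp] by blast
    qed
    show "y \<in> D" if "card D = p ^ 2"
      using f(1) wV y(1,2) that by (auto simp: M_def rel_def D_def)
  qed
qed

text \<open>Conjugation by \<open>b\<close> puts the group of order \<open>p ^ 2\<close> generated by \<open>z\<close> and \<open>y\<close> into both regular groups.\<close>

lemma finish:
  assumes y: "y \<in> P" "y \<notin> Z" and yR: "\<And>r v. r \<in> R \<Longrightarrow> v \<in> V \<Longrightarrow> r (y v) \<in> orb Z (y (r v))"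
    and b: "b \<in> Auts V col" "b \<circ> z = z \<circ> b" and y'': "y'' \<in> P'" "b \<circ> y = y'' \<circ> b"
    and bU: "\<And>v. v \<in> V \<Longrightarrow> b v \<in> orb {f. \<exists>i j. f = z ^^ i \<circ> y ^^ j} v"
  shows "\<exists>a\<in>Auts V col. conj_by a P' = P"
proof -
  define U where "U = {f. \<exists>i j. f = z ^^ i \<circ> y ^^ j}"
  note U = gen2[OF P r_pos zP(1) y(1), folded U_def]
  note bU = bU[folded U_def]
  have ZU: "Z \<subseteq> U" using perm_grp_cyc_sub[OF U(1,4)] .
  have finP: "finite P" by (rule card_reg(2)[OF P wV])
  have cardP: "card P = p ^ 3" using card_reg(1)[OF P wV] cardV by simp
  obtain k where k: "card U = p ^ k" using card_subgroup_prime_power[OF regD(1)[OF P] U(1,2) cardP prime_r] by blast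
  \<comment> \<open>\<open>U\<close> properly contains \<open>Z\<close> and has at most
    \<open>p ^ 2\<close> elements, so its order is exactly \<open>p ^ 2\<close>.\<close>
  have "card Z < card U"
    using psubset_card_mono[OF finite_subset[OF U(2) finP]] ZU U(5) y(2) by blast
  then have "p ^ 1 < p ^ k" using card_Z k by simp
  then have "1 < k" using power_less_imp_less_exp[OF prime_gt_1_nat[OF prime_r]] by blast
  moreover have "p ^ k \<le> p ^ 2" using U(3) k by (simp add: power2_eq_square)
  then have "k \<le> 2" using power_le_imp_le_exp[OF prime_gt_1_nat[OF prime_r]] by blast
  ultimately have cU: "card U = p ^ 2" using k by (metis Suc_1 Suc_leI le_antisym)
  then have idx: "card V = p * card U" using cardV by (simp add: power_numeral_reduce)
  have UV: "u v \<in> V" if "u \<in> U" "v \<in> V" for u v using that U(2) regD(5)[OF P] by blast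
  have orbZU: "x \<in> orb U v" if "x \<in> orb Z v" for x v using that ZU by (auto simp: orb_def)
  \<comment> \<open>The orbits of \<open>U\<close> are blocks for \<open>R\<close>: \<open>z\<close>
    commutes with \<open>R\<close>, and \<open>y\<close> does so up to
    \<open>Z\<close>-orbits.\<close>
  have RU: "r (u v) \<in> orb U (r v)" if r: "r \<in> R" and u: "u \<in> U" and v: "v \<in> V" for r u v
  proof -
    have ypow: "r ((y ^^ j) v) \<in> orb U (r v) \<and> (y ^^ j) v \<in> V" for j
    proof (induction j)
      case 0
      then show ?case using orb_refl[OF U(1)] v by simp
    next
      case (Suc j)
      then have IH: "r ((y ^^ j) v) \<in> orb U (r v)" "(y ^^ j) v \<in> V" by auto
      have "r (y ((y ^^ j) v)) \<in> orb U (y (r ((y ^^ j) v)))" using orbZU[OF yR[OF r IH(2)]] .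
      moreover have "y (r ((y ^^ j) v)) \<in> orb U (r v)" using orb_moved[OF U(1,5)] IH(1) by simp
      ultimately show ?case using orb_trans[OF U(1)] UV[OF U(5) IH(2)] by simp
    qed
    obtain i j where ij: "u = z ^^ i \<circ> y ^^ j" using u unfolding U_def by blast
    have "r (u v) = (z ^^ i) (r ((y ^^ j) v))" using comm_pow[OF zc[OF r]] ij by simp
    then show ?thesis using ypow orb_moved[OF U(1) perm_grp_pow[OF U(1,4)]] by simp
  qed
  note bb = perm_grp_bij[OF perm_grp_Auts b(1)]
  have ib: "pinv b \<in> Auts V col" by (rule perm_grp_inv[OF perm_grp_Auts b(1)])
  have iib: "pinv (pinv b) = b" by (rule inv_inv_eq[OF bb])
  note bs = pinv_simps[OF bb]
  let ?P = "conj_by (pinv b) P'"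
  have P'': "reg p V ?P" by (rule reg_conj_Auts[OF P' ib])
  have P''A: "?P \<subseteq> Auts V col"
    using P' P'R RA perm_grp_comp[OF perm_grp_Auts] ib b(1) unfolding iib by blast
  have "pinv b \<circ> z \<circ> b = z"
  proof
    fix x show "(pinv b \<circ> z \<circ> b) x = z x" using fun_cong[OF b(2), of x] bs(2)[of "z x"] by simp
  qed
  then have zP'': "z \<in> ?P" using zP(2) unfolding iib by (metis image_eqI)
  have "pinv b \<circ> y'' \<circ> b = y"
  proof
    fix x show "(pinv b \<circ> y'' \<circ> b) x = y x" using fun_cong[OF y''(2), of x] bs(2)[of "y x"] by simp
  qed
  then have yP'': "y \<in> ?P" using y''(1) unfolding iib by (metis image_eqI)
  have UP'': "U \<subseteq> ?P"
    using perm_grp_pow[OF regD(1)[OF P''] zP''] perm_grp_pow[OF regD(1)[OF P''] yP'']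
      perm_grp_comp[OF regD(1)[OF P'']] unfolding U_def by blast
  have orbR: "r v' \<in> orb U (r v)" if "r \<in> R" "v \<in> V" "v' \<in> orb U v" for r v v'
    using that RU by (auto simp: orb_def)
  have bV: "b v \<in> V" if "v \<in> V" for v using Auts_in[OF b(1)] that by simp
  have ibU: "pinv b v \<in> orb U v" if "v \<in> V" for v
    using bU[of "pinv b v"] Auts_in[OF ib] that bs orb_sym[OF U(1)] by metis
  \<comment> \<open>Since \<open>b\<close> moves points only within \<open>U\<close>-orbits,
    \<open>f''\<close> may be replaced by \<open>f' \<in> R\<close>. Then
    \<open>pinv f \<circ> f'\<close> preserves the \<open>U\<close>-orbit of \<open>w\<close>, one
    of \<open>p\<close> blocks, and therefore every \<open>U\<close>-orbit.\<close>
  have same: "f'' v \<in> orb U (f v)" if f: "f \<in> P" "f'' \<in> ?P" "f'' w = f w" and v: "v \<in> V" for f f'' v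
  proof -
    obtain f' where f': "f' \<in> P'" "f'' = pinv b \<circ> f' \<circ> b" using f(2) unfolding iib by blast
    have fR: "f \<in> R" "f' \<in> R" using f(1) f'(1) PR P'R by auto
    have "b (f w) = f' (b w)" using f(3) f'(2) bs(1)[of "f' (b w)"] by simp
    then have "f' (b w) \<in> orb U (f w)" using bU[OF regD(5)[OF P f(1) wV]] by simp
    moreover have "f' w \<in> orb U (f' (b w))" using orbR[OF fR(2) bV[OF wV] orb_sym[OF U(1) bU[OF wV]]] .
    ultimately have "f' w \<in> orb U (f w)" using orb_trans[OF U(1)] by blast
    then have "pinv f (f' w) \<in> orb U (pinv f (f w))"
      by (rule orbR[OF perm_grp_inv[OF R(1) fR(1)] regD(5)[OF P f(1) wV]])
    then have c: "(pinv f \<circ> f') w \<in> orb U w" using perm_grp_simps[OF R(1) fR(1)] by simp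
    have "(pinv f \<circ> f') v \<in> orb U v"
    proof (rule block_fix[where R = R and X = V and w = w])
      show "perm_grp R" "finite R" "card R = p ^ n" "prime p" "perm_grp U" "finite V"
        by (fact R(1) finR R(3) prime_r U(1) finX)+
      show "u x \<in> V" if "u \<in> U" "x \<in> V" for u x by (rule UV[OF that])
      show "u = id" if "u \<in> U" "x \<in> V" "u x = x" for u x using regD(7)[OF P] that U(2) by blast
      show "card V \<le> p * card U" using idx by simp
      show "pinv f \<circ> f' \<in> R" using perm_grp_comp[OF R(1) perm_grp_inv[OF R(1) fR(1)] fR(2)] .
    qed (use RV RU wV c v in auto)
    then have "f (pinv f (f' v)) \<in> orb U (f v)" using orbR[OF fR(1) v] by simp
    then have 1: "f' v \<in> orb U (f v)" using perm_grp_simps[OF R(1) fR(1)] by simp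
    have "f' (b v) \<in> orb U (f' v)" by (rule orbR[OF fR(2) v bU[OF v]])
    moreover have "pinv b (f' (b v)) \<in> orb U (f' (b v))" by (rule ibU[OF RV[OF fR(2) bV[OF v]]])
    ultimately show ?thesis using 1 orb_trans[OF U(1)] unfolding f'(2) by (metis comp_apply)
  qed
  have PA: "P \<subseteq> Auts V col" using PR P'R RA by blast
  have "\<exists>a\<in>Auts V col. conj_by a ?P = P"
    by (rule regular_conj[where P = P and P' = ?P and U = U and w = w and X = V])
      (fact prime_r wV P PA P'' P''A U(1,2) UP'' idx same)+
  then obtain a where a: "a \<in> Auts V col" "conj_by a ?P = P" by blast
  have "conj_by (a \<circ> pinv b) P' = P"
    using conj_conj[OF perm_grp_bij[OF perm_grp_Auts a(1)] perm_grp_bij[OF perm_grp_Auts ib], of P'] a(2) by simp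
  then show ?thesis using perm_grp_comp[OF perm_grp_Auts a(1) ib] by blast
qed

text \<open>By \<open>finish\<close> it is enough to find \<open>b\<close> that commutes with
  \<open>z\<close>, conjugates \<open>y\<close> to an element of \<open>P'\<close> and stays within
  orbits of \<open>U\<close>. The construction depends on the class size.\<close>

lemma elem_pair_conj: "\<exists>a\<in>Auts V col. conj_by a P' = P"
proof -
  obtain y y' where y: "y \<in> P" "y \<notin> Z" and y': "y' \<in> P'" "\<And>v. v \<in> V \<Longrightarrow> y' v \<in> orb Z (y v)"
    and yR: "\<And>r v. r \<in> R \<Longrightarrow> v \<in> V \<Longrightarrow> r (y v) \<in> orb Z (y (r v))" and yD: "card D = p ^ 2 \<Longrightarrow> y \<in> D"
    using second_central by blast
  note G = regD(1)[OF P] and G' = regD(1)[OF P']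
  define U where "U = {f. \<exists>i j. f = z ^^ i \<circ> y ^^ j}"
  note U = gen2[OF P r_pos zP(1) y(1), folded U_def]
  have fin: "\<exists>a\<in>Auts V col. conj_by a P' = P"
    if b: "b \<in> Auts V col" "b \<circ> z = z \<circ> b" and t: "t \<in> P'" "b \<circ> y = t \<circ> b"
      and bU: "\<And>v. v \<in> V \<Longrightarrow> b v \<in> orb U v" for b t
    by (rule finish[where y = y and b = b and y'' = t]) (fact y yR b t bU[unfolded U_def])+
  have yinR: "y \<in> R" "y' \<in> R" using y(1) y'(1) PR P'R by auto
  have PA: "P \<subseteq> Auts V col" "P' \<subseteq> Auts V col" using PR P'R RA by blast+
  have iy: "pinv y \<in> P" by (rule perm_grp_inv[OF G y(1)])
  have y'E: "t \<circ> pinv y \<in> E" if t: "t \<in> P'" "\<And>v. v \<in> V \<Longrightarrow> t v \<in> orb Z (y v)" for t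
  proof -
    have "t \<circ> pinv y \<in> R" using perm_grp_comp[OF R(1) subsetD[OF P'R t(1)] subsetD[OF PR iy]] .
    moreover have "(t \<circ> pinv y) v \<in> orb Z v" if v: "v \<in> V" for v
      using t(2)[OF regD(5)[OF P iy v]] perm_grp_simps[OF G y(1)] by simp
    ultimately show ?thesis using zc RA by (auto simp: blockE_def)
  qed
  obtain m where m: "m \<in> {1, 2, 3}" "card D = p ^ m" by (rule card_D_pos)
  consider "m = 3" | "m = 2" | "m = 1" using m(1) by blast
  then show ?thesis
  proof cases
    \<comment> \<open>All points are similar, so \<open>y' \<circ> pinv y\<close> has one exponent
      everywhere and is a power of \<open>z\<close>; hence \<open>y\<close> is already in
      \<open>P'\<close>.\<close>
    case 1
    have "D = P" using card_subset_eq[OF card_reg(2)[OF P wV] D_sub] m(2) 1 card_reg(1)[OF P wV] cardV by simp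
    then have all: "sim w v" if "v \<in> V" for v
      using sim_D_iff[OF wV that] reg_orb[OF P wV] that by simp
    let ?t = "y' \<circ> pinv y"
    have tE: "?t \<in> E" by (rule y'E[OF y'])
    obtain c where c: "?t w = (z ^^ c) w" using E_pow[OF tE wV] .
    have "?t v = (z ^^ c) v" if "v \<in> V" for v by (rule sim_pow_eq[OF wV all[OF that] tE c])
    then have "?t = z ^^ c" using Auts_eqI[OF E_aut[OF tE] pow_aut] by blast
    then have "y' = z ^^ c \<circ> y" using perm_grp_simps(2)[OF G y(1)] by (metis comp_apply ext)
    then have "y = pinv (z ^^ c) \<circ> y'" using perm_grp_simps(2)[OF cyc_grp cyc_self(1)[of c]] by (simp add: fun_eq_iff)
    moreover have "z ^^ c \<in> P'" by (rule perm_grp_pow[OF G' zP(2)])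
    ultimately have yP': "y \<in> P'" using perm_grp_comp[OF G' perm_grp_inv[OF G'] y'(1)] by simp
    show ?thesis
      by (rule fin[OF perm_grp_id[OF perm_grp_Auts] _ yP']) (use orb_refl[OF U(1)] in auto)
  next
    case 2
    then have yD: "y \<in> D" using yD m(2) by simp
    \<comment> \<open>Correcting \<open>y'\<close> by a power of \<open>z\<close> makes it agree
      with \<open>y\<close> at \<open>w\<close>, and then on the whole class of
      \<open>w\<close>.\<close>
    obtain c where c: "y' w = (z ^^ c) (y w)" using y'(2)[OF wV] by (auto simp: orb_cyc_iff)
    define y'' where "y'' = pinv (z ^^ c) \<circ> y'"
    have zcP: "pinv (z ^^ c) \<in> P'" "pinv (z ^^ c) \<in> Z"
      using perm_grp_inv[OF G' perm_grp_pow[OF G' zP(2)]] perm_grp_inv[OF cyc_grp cyc_self(1)] by auto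
    have y''P: "y'' \<in> P'" unfolding y''_def by (rule perm_grp_comp[OF G' zcP(1) y'(1)])
    have y''o: "y'' v \<in> orb Z (y v)" if "v \<in> V" for v
      unfolding y''_def using orb_moved[OF cyc_grp zcP(2)] y'(2)[OF that] by simp
    have y''w: "y'' w = y w" unfolding y''_def using c perm_grp_simps(2)[OF cyc_grp cyc_self(1)[of c]] by simp
    let ?t = "y'' \<circ> pinv y"
    have tE: "?t \<in> E" by (rule y'E[OF y''P y''o])
    have yw: "y w \<in> V" using regD(5)[OF P y(1) wV] .
    have tyw: "?t (y w) = y w" using y''w perm_grp_simps[OF G y(1)] by simp
    have y''eq: "y'' v = y v" if v: "v \<in> V" "sim w v" for v
    proof -
      have "sim (y w) w" using sim_sym[OF wV yw D_sim[OF yD wV]] .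
      then have "sim (y w) (y v)" using sim_trans sim_trans[OF v(2) D_sim[OF yD v(1)]] by blast
      then have "?t (y v) = y v" using tE tyw unfolding sim_def by blast
      then show ?thesis using perm_grp_simps[OF G y(1)] by simp
    qed
    have cC0: "card C0 \<le> p * card Z" using card_C0 m(2) 2 card_Z by (simp add: power2_eq_square)
    have P'N: "P' \<subseteq> N" using P'R R(2) by blast
    \<comment> \<open>The \<open>p\<close> orbits of \<open>Z\<close> in a class are blocks, so the
      candidate stays in \<open>Z\<close>-orbits, and points of one \<open>Z\<close>-orbit are
      twins.\<close>
    have key: "g' (pinv g x) \<in> orb Z x \<and> pinv g x \<in> C0"
      if x: "x \<in> V" and g: "g \<in> P" "g' \<in> P'" "g w = g' w" "sim x (g w)" for x g g'
    proof -
      have gR: "g \<in> R" "g' \<in> R" using g PR P'R by auto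
      note cs = class_shift[OF g(1) gR(2) g(3) x g(4)]
      have "(pinv g \<circ> g') (pinv g x) \<in> orb Z (pinv g x)"
      proof (rule C0_block_fix[OF cyc_grp Z_D cC0 _ cs(1-3)])
        show "h (k v) \<in> orb Z (h v)" if "h \<in> S" "k \<in> Z" "v \<in> C0" for h k v
          using R_orb[of h v "k v"] orbI[OF that(2)] that(1,3) S_sub C0_V by blast
      qed
      then have "g ((pinv g \<circ> g') (pinv g x)) \<in> orb Z (g (pinv g x))"
        by (rule R_orb[OF gR(1) C0_V[OF cs(3)]])
      then show ?thesis using perm_grp_simps[OF R(1) gR(1)] cs(3) by simp
    qed
    have rep: "\<exists>g\<in>P. \<exists>g'\<in>P'. g w = g' w \<and> sim x (g w)" if x: "x \<in> V" for x
      using regD(6)[OF P wV x] regD(6)[OF P' wV x] sim_refl by metis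
    obtain b where b: "b \<in> Auts V col"
      "\<And>x. x \<in> V \<Longrightarrow> \<exists>g\<in>P. \<exists>g'\<in>P'. g w = g' w \<and> sim x (g w) \<and> (\<forall>u\<in>V. sim x u \<longrightarrow> b u = g' (pinv g u))"
      by (rule class_glue[OF wV PN P'N rep]) (use key twin_orb in blast)+
    have out: "f v = v" if "f \<in> Auts V col" "v \<notin> V" for f v
      using permutes_not_in[OF Auts_permutes[OF that(1)] that(2)] .
    \<comment> \<open>As \<open>y \<in> D\<close> preserves classes, a single pair \<open>g\<close>,
      \<open>g'\<close> computes both \<open>b x\<close> and \<open>b (y x)\<close>. Pulled back to
      the class of \<open>w\<close>, \<open>y\<close> and \<open>y''\<close> coincide.\<close>
    have bx: "b (z x) = z (b x) \<and> b (y x) = y'' (b x) \<and> b x \<in> orb Z x" if x: "x \<in> V" for x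
    proof -
      obtain g g' where g: "g \<in> P" "g' \<in> P'" "g w = g' w" "sim x (g w)"
        and bg: "\<And>u. u \<in> V \<Longrightarrow> sim x u \<Longrightarrow> b u = g' (pinv g u)" using b(2)[OF x] by blast
      have ig: "pinv g \<in> P" by (rule perm_grp_inv[OF G g(1)])
      have bxg: "b x = g' (pinv g x)" by (rule bg[OF x sim_refl])
      have "b (z x) = g' (pinv g (z x))" by (rule bg) (use pow_in[of 1] sim_pow[OF x, of 1] x in auto)
      then have "b (z x) = z (b x)"
        unfolding bxg using regD(3)[OF P ig zP(1)] regD(3)[OF P' g(2) zP(2)] by simp
      moreover have "b (y x) = g' (pinv g (y x))" by (rule bg) (use regD(5)[OF P y(1) x] D_sim[OF yD x] in auto)
      then have "b (y x) = g' (y (pinv g x))" using regD(3)[OF P ig y(1)] by simp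
      then have "b (y x) = g' (y'' (pinv g x))" using y''eq key[OF x g] by (simp add: C0_def)
      then have "b (y x) = y'' (b x)" unfolding bxg using regD(3)[OF P' g(2) y''P] by simp
      ultimately show ?thesis unfolding bxg using key[OF x g] by simp
    qed
    have bz: "b \<circ> z = z \<circ> b"
    proof
      fix x show "(b \<circ> z) x = (z \<circ> b) x" using bx out[OF b(1)] out[OF z_aut] by (cases "x \<in> V") auto
    qed
    have by'': "b \<circ> y = y'' \<circ> b"
    proof
      fix x show "(b \<circ> y) x = (y'' \<circ> b) x"
        using bx out[OF b(1)] out[OF subsetD[OF PA(1) y(1)]] out[OF subsetD[OF PA(2) y''P]] by (cases "x \<in> V") auto
    qed
    have "b v \<in> orb U v" if "v \<in> V" for v
      using bx[OF that] perm_grp_cyc_sub[OF U(1,4)] by (auto simp: orb_def)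
    then show ?thesis by (rule fin[OF b(1) bz y''P by''])
  next
    case 3
    \<comment> \<open>Classes are single \<open>Z\<close>-orbits, which may therefore be rotated
      independently of each other.\<close>
    have "D = Z" using card_subset_eq[OF finite_subset[OF D_sub card_reg(2)[OF P wV]] Z_D] m(2) 3 card_Z by simp
    then have simZ: "sim v u \<longleftrightarrow> u \<in> orb Z v" if "v \<in> V" "u \<in> V" for u v using sim_D_iff[OF that] by simp
    have yj: "y ^^ j \<in> P" "y' ^^ j \<in> P'" for j using perm_grp_pow[OF G y(1)] perm_grp_pow[OF G' y'(1)] by auto
    have zi: "z ^^ i \<in> P" "z ^^ i \<in> P'" "z ^^ i \<in> Z" for i
      using perm_grp_pow[OF G zP(1)] perm_grp_pow[OF G' zP(2)] cyc_self(1) by auto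
    have y'j: "(y' ^^ j) v \<in> orb Z ((y ^^ j) v)" if v: "v \<in> V" for j v
    proof (induction j)
      case 0
      then show ?case using orb_refl[OF cyc_grp] by simp
    next
      case (Suc j)
      have yv: "(y ^^ j) v \<in> V" using regD(5)[OF P yj(1) v] .
      have "y' ((y' ^^ j) v) \<in> orb Z (y' ((y ^^ j) v))" by (rule R_orb[OF yinR(2) yv Suc])
      then show ?case using y'(2)[OF yv] orb_trans[OF cyc_grp] by simp
    qed
    \<comment> \<open>A base point for each orbit of \<open>U\<close>. The rotations are arranged so
      that \<open>(y ^^ j) (rho x)\<close> goes to \<open>(y' ^^ j) (rho x)\<close>.\<close>
    define rho where "rho x = (SOME v. v \<in> orb U x)" for x
    have rho: "rho x \<in> orb U x" for x unfolding rho_def by (rule someI[of _ x]) (rule orb_refl[OF U(1)])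
    have rho_eq: "rho x = rho v" if "x \<in> orb U v" for x v unfolding rho_def using orb_eq[OF U(1) that] by simp
    have UV: "u \<in> V" if "v \<in> V" "u \<in> orb U v" for u v using that U(2) regD(5)[OF P] by (auto simp: orb_def)
    have rhoV: "rho x \<in> V" if "x \<in> V" for x by (rule UV[OF that rho])
    have xrep: "\<exists>i j. x = (z ^^ i) ((y ^^ j) (rho x))" for x
    proof -
      obtain u where u: "u \<in> U" "x = u (rho x)" using orb_sym[OF U(1) rho[of x]] unfolding orb_def by blast
      obtain i j where "u = z ^^ i \<circ> y ^^ j" using u(1) unfolding U_def by blast
      then show ?thesis using u(2) by (metis comp_apply)
    qed
    define Q where "Q B v f \<longleftrightarrow> f \<in> Z \<and> (\<exists>j. (y ^^ j) v \<in> B \<and> (y' ^^ j) v = f ((y ^^ j) v))" for B v f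
    define F where "F x = (SOME f. Q (orb Z x) (rho x) f)" for x
    have FQ: "Q (orb Z x) (rho x) (F x)" if x: "x \<in> V" for x
    proof -
      obtain i j where ij: "x = (z ^^ i) ((y ^^ j) (rho x))" using xrep by blast
      have "x \<in> orb Z ((y ^^ j) (rho x))" by (rule orbI[OF zi(3) ij])
      then have 1: "(y ^^ j) (rho x) \<in> orb Z x" by (rule orb_sym[OF cyc_grp])
      obtain f where "f \<in> Z" "(y' ^^ j) (rho x) = f ((y ^^ j) (rho x))"
        using y'j[OF rhoV[OF x], of j] by (auto simp: orb_def)
      then have "Q (orb Z x) (rho x) f" using 1 unfolding Q_def by blast
      then show ?thesis unfolding F_def by (rule someI[of "Q (orb Z x) (rho x)"])
    qed
    have FZ: "F x \<in> Z" if "x \<in> V" for x using FQ[OF that] by (simp add: Q_def)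
    have Zcomm: "f ((z ^^ i) v) = (z ^^ i) (f v)" if "f \<in> Z" for f i v
      using regD(3)[OF P _ zi(1)] that Z_sub by blast
    define b where "b = (\<lambda>x. if x \<in> V then F x x else x)"
    have bA: "b \<in> Auts V col" unfolding b_def
    proof (rule glue[where F = F and sim = "\<lambda>x y. y \<in> orb Z x"])
      show "finite V" by (rule finX)
      show "F x \<in> Auts V col" if "x \<in> V" for x using FZ[OF that] Z_sub PA by blast
      show "F x = F v" if "v \<in> orb Z x" for x v
        unfolding F_def using orb_eq[OF cyc_grp that] rho_eq[of v x] that perm_grp_cyc_sub[OF U(1,4)]
        by (auto simp: orb_def)
      show "F x x \<in> orb Z x" if "x \<in> V" for x by (rule orbI[OF FZ[OF that]]) simp
      show "x \<in> orb Z v" if "v \<in> orb Z x" for x v by (rule orb_sym[OF cyc_grp that])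
      show "u \<in> orb Z x" if "v \<in> orb Z x" "u \<in> orb Z v" for x v u by (rule orb_trans[OF cyc_grp that(2,1)])
      show "col (F x x) (F v v) = col x v" if xv: "x \<in> V" "v \<in> V" "v \<notin> orb Z x" for x v
        by (rule col_nsim_orb) (use xv simZ orbI[OF FZ[OF xv(1)] refl] orbI[OF FZ[OF xv(2)] refl] in auto)
    qed
    \<comment> \<open>The choice of exponent in \<open>F\<close> does not matter: by
      \<open>index_key\<close>, exponents leading to the same \<open>Z\<close>-orbit give equal
      powers of both \<open>y\<close> and \<open>y'\<close>.\<close>
    have b_rep: "b ((z ^^ i) ((y ^^ j) (rho x))) = (z ^^ i) ((y' ^^ j) (rho x))" if x: "x \<in> V" for x i j
    proof -
      let ?v = "(z ^^ i) ((y ^^ j) (rho x))"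
      have yr: "(y ^^ j) (rho x) \<in> V" using regD(5)[OF P yj(1) rhoV[OF x]] .
      have vV: "?v \<in> V" using pow_in yr by simp
      have "?v \<in> orb U (rho x)"
        by (rule orbI[of "z ^^ i \<circ> y ^^ j"]) (auto simp: U_def)
      then have rv: "rho ?v = rho x" using rho_eq[of ?v x] orb_trans[OF U(1) _ rho[of x]] by blast
      obtain k where k: "(y ^^ k) (rho x) \<in> orb Z ?v" "(y' ^^ k) (rho x) = F ?v ((y ^^ k) (rho x))"
        using FQ[OF vV] unfolding Q_def rv by blast
      have "(y ^^ k) (rho x) \<in> orb Z ((y ^^ j) (rho x))"
        using orb_trans[OF cyc_grp k(1) orbI[OF zi(3)]] by blast
      then obtain u where u: "u \<in> Z" "(y ^^ k) (rho x) = u ((y ^^ j) (rho x))" by (auto simp: orb_def)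
      note ik = index_key[OF P prime_r cyc_grp Z_sub(1) y u(1) rhoV[OF x] u(2)]
      have "y' ^^ k = y' ^^ j" "y ^^ k = y ^^ j" using ik(2) regD(4)[OF P' y'(1)] regD(4)[OF P y(1)] by blast+
      then have "F ?v ((y ^^ j) (rho x)) = (y' ^^ j) (rho x)" using k(2) by simp
      then have "F ?v ?v = (z ^^ i) ((y' ^^ j) (rho x))" using Zcomm[OF FZ[OF vV]] by simp
      then show ?thesis using vV by (simp add: b_def)
    qed
    have out: "f v = v" if "f \<in> Auts V col" "v \<notin> V" for f v
      using permutes_not_in[OF Auts_permutes[OF that(1)] that(2)] .
    have main: "b (z x) = z (b x) \<and> b (y x) = y' (b x) \<and> b x \<in> orb Z x" if x: "x \<in> V" for x
    proof -
      obtain i j where ij: "x = (z ^^ i) ((y ^^ j) (rho x))" using xrep by blast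
      have bx: "b x = (z ^^ i) ((y' ^^ j) (rho x))" using b_rep[OF x, of i j] ij by simp
      have "z x = (z ^^ Suc i) ((y ^^ j) (rho x))" using ij by simp
      then have "b (z x) = (z ^^ Suc i) ((y' ^^ j) (rho x))" using b_rep[OF x, of "Suc i" j] by simp
      moreover have "y x = (z ^^ i) ((y ^^ Suc j) (rho x))"
        using arg_cong[OF ij, of y] regD(3)[OF P y(1) zi(1)] by simp
      then have "b (y x) = (z ^^ i) ((y' ^^ Suc j) (rho x))" using b_rep[OF x, of i "Suc j"] by simp
      then have "b (y x) = y' (b x)" unfolding bx using regD(3)[OF P' y'(1) zi(2)] by simp
      moreover have "b x \<in> orb Z x" using x orbI[OF FZ[OF x], of _ x] by (simp add: b_def)
      ultimately show ?thesis using bx by simp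
    qed
    have bz: "b \<circ> z = z \<circ> b"
    proof
      fix x show "(b \<circ> z) x = (z \<circ> b) x" using main out[OF bA] out[OF z_aut] by (cases "x \<in> V") auto
    qed
    have by': "b \<circ> y = y' \<circ> b"
    proof
      fix x show "(b \<circ> y) x = (y' \<circ> b) x"
        using main out[OF bA] out[OF subsetD[OF PA(1) y(1)]] out[OF subsetD[OF PA(2) y'(1)]] by (cases "x \<in> V") auto
    qed
    have "b v \<in> orb U v" if "v \<in> V" for v
      using main[OF that] perm_grp_cyc_sub[OF U(1,4)] by (auto simp: orb_def)
    then show ?thesis by (rule fin[OF bA bz y'(1) by'])
  qed
qed

end

lemma elementary_abelian_conj:
  assumes p: "prime p" and V: "finite V" "card V = p ^ 3"
    and P: "reg p V P" "P \<subseteq> Auts V col" and P': "reg p V P'" "P' \<subseteq> Auts V col"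
  shows "\<exists>a\<in>Auts V col. conj_by a P' = P"
proof -
  have "card V \<noteq> 0" using V(2) prime_gt_0_nat[OF p] by simp
  then obtain w where w: "w \<in> V" by fastforce
  let ?A = "Auts V col"
  have cP: "card P = p ^ 3" "card P' = p ^ 3" using card_reg(1)[OF P(1) w] card_reg(1)[OF P'(1) w] V(2) by simp_all
  obtain g R n where g: "g \<in> ?A" and R: "perm_grp R" "R \<subseteq> ?A" "card R = p ^ n" and PR: "P \<subseteq> R"
    and P'R: "\<And>y. y \<in> P' \<Longrightarrow> g \<circ> y \<circ> pinv g \<in> R"
    using sylow_conj[OF perm_grp_Auts finite_Auts[OF V(1)] p regD(1)[OF P(1)] P(2) cP(1) regD(1)[OF P'(1)] P'(2) cP(2)]
    by blast
  note bg = perm_grp_bij[OF perm_grp_Auts g]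
  define P1 where "P1 = conj_by g P'"
  have P1: "reg p V P1" unfolding P1_def by (rule reg_conj_Auts[OF P'(1) g])
  have P1R: "P1 \<subseteq> R" unfolding P1_def using P'R by blast
  have finR: "finite R" by (rule finite_subset[OF R(2) finite_Auts[OF V(1)]])
  have RV: "f v \<in> V" if "f \<in> R" "v \<in> V" for f v using Auts_in[OF subsetD[OF R(2) that(1)]] that(2) by simp
  have one: "perm_grp {id}" by (rule perm_grpI) auto
  have idR: "{id} \<subseteq> R" using perm_grp_id[OF R(1)] by simp
  have ne: "{id} \<noteq> R"
  proof
    assume "{id} = R"
    then have "P \<subseteq> {id}" using PR by simp
    then have "card P \<le> 1" using card_mono[of "{id}" P] by simp
    moreover have "p ^ 0 < p ^ 3" using prime_gt_1_nat[OF p] by (intro power_strict_increasing) auto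
    ultimately show False using cP by simp
  qed
  have cR: "r \<circ> f \<circ> pinv r \<in> R" if "r \<in> R" "f \<in> R" for r f
    using perm_grp_comp[OF R(1) perm_grp_comp[OF R(1) that] perm_grp_inv[OF R(1) that(1)]] .
  have c1: "r \<circ> f \<circ> pinv r \<in> {id}" if "r \<in> R" "f \<in> {id}" for r f
    using pinv_simps[OF perm_grp_bij[OF R(1) that(1)]] that(2) by simp
  have "\<exists>f\<in>R. f \<notin> {id} \<and> (\<forall>r\<in>R. \<exists>e\<in>{id}. r \<circ> f = e \<circ> f \<circ> r)"
    by (rule central_mod[where R = R and N = R and K = "{id}"])
      (fact R(1) finR R(3) p cR one idR ne c1 | blast)+
  then obtain z where z: "z \<in> R" "z \<noteq> id" "\<And>r. r \<in> R \<Longrightarrow> r \<circ> z = z \<circ> r" by (metis id_comp singletonD singletonI)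
  \<comment> \<open>\<open>z\<close> commutes with \<open>Q\<close>, and a regular abelian group is
    its own centraliser.\<close>
  have zQ: "z \<in> Q" if Q: "reg p V Q" "Q \<subseteq> R" for Q
  proof -
    have zf: "z (f x) = f (z x)" if "f \<in> Q" "x \<in> V" for f x using z(3)[of f] Q(2) that(1) by (metis comp_apply subsetD)
    have "\<exists>h\<in>Q. \<forall>x\<in>V. z x = h x"
      by (rule reg_central[where P = Q and X = V and n = z and w = w]) (fact Q(1) w RV[OF z(1) w] zf | blast)+
    then obtain h where h: "h \<in> Q" "\<And>x. x \<in> V \<Longrightarrow> z x = h x" by blast
    have "z = h" by (rule Auts_eqI[of _ V col]) (use h z(1) Q(2) R(2) in auto)
    then show ?thesis using h(1) by simp
  qed
  have zP: "z \<in> P" "z \<in> P1" using zQ P(1) PR P1 P1R by auto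
  interpret block_perm V col z p
    by unfold_locales (use V p z(1) R(2) regD(4)[OF P(1) zP(1)] regD(7)[OF P(1) zP(1)] z(2) in auto)
  have RN: "R \<subseteq> N" using comm_N z(3) R(2) by blast
  interpret elem_pair V col z p P R w n P1
    by unfold_locales (use w P(1) V R(1,3) RN RV PR P1 P1R zP z(3) p in auto)
  obtain a where a: "a \<in> ?A" "conj_by a P1 = P" using elem_pair_conj by blast
  have "conj_by (a \<circ> g) P' = P"
    using conj_conj[OF perm_grp_bij[OF perm_grp_Auts a(1)] bg, of P'] a(2) unfolding P1_def by simp
  then show ?thesis using perm_grp_comp[OF perm_grp_Auts a(1) g] by blast
qed

subsection \<open>Adding the cyclic factor\<close>

text \<open>The group generated by \<open>P\<close> and \<open>z\<close> is a regular copy of \<open>P \<times> \<langle>z\<rangle>\<close>.\<close>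

definition pq_reg :: "nat \<Rightarrow> nat \<Rightarrow> 'a set \<Rightarrow> ('a \<Rightarrow> 'a) set \<Rightarrow> ('a \<Rightarrow> 'a) \<Rightarrow> bool" where
  "pq_reg p q X P z \<longleftrightarrow> perm_grp P \<and> (\<forall>f\<in>P. \<forall>g\<in>P. f \<circ> g = g \<circ> f) \<and> (\<forall>f\<in>P. f ^^ p = id) \<and> card P = p ^ 3 \<and>
     (\<forall>f\<in>P. f \<circ> z = z \<circ> f) \<and> z ^^ q = id \<and> (\<forall>x\<in>X. z x \<noteq> x) \<and>
     (\<forall>f\<in>P. \<forall>x\<in>X. f x \<in> orb (cyc z) x \<longrightarrow> f = id) \<and> (\<forall>x\<in>X. \<forall>y\<in>X. \<exists>f\<in>P. y \<in> orb (cyc z) (f x))"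

lemma pq_regD:
  assumes "pq_reg p q X P z"
  shows "perm_grp P" "\<And>f g. f \<in> P \<Longrightarrow> g \<in> P \<Longrightarrow> f \<circ> g = g \<circ> f" "\<And>f. f \<in> P \<Longrightarrow> f ^^ p = id" "card P = p ^ 3"
    "\<And>f. f \<in> P \<Longrightarrow> f \<circ> z = z \<circ> f" "z ^^ q = id" "\<And>x. x \<in> X \<Longrightarrow> z x \<noteq> x"
    "\<And>f x. f \<in> P \<Longrightarrow> x \<in> X \<Longrightarrow> f x \<in> orb (cyc z) x \<Longrightarrow> f = id"
    "\<And>x y. x \<in> X \<Longrightarrow> y \<in> X \<Longrightarrow> \<exists>f\<in>P. y \<in> orb (cyc z) (f x)"
  using assms by (auto simp: pq_reg_def)

lemma pq_reg_conj:
  assumes P: "pq_reg p q X P z" and a: "a permutes X"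
  shows "pq_reg p q X (conj_by a P) (a \<circ> z \<circ> pinv a)"
proof -
  have b: "bij a" by (rule permutes_bij[OF a])
  note i = pinv_simps[OF b]
  note D = pq_regD[OF P]
  have inX: "a x \<in> X \<longleftrightarrow> x \<in> X" "pinv a x \<in> X \<longleftrightarrow> x \<in> X" for x
    using permutes_in_image[OF a] permutes_in_image[OF permutes_inv[OF a]] by auto
  have pw: "((a \<circ> z \<circ> pinv a) ^^ n) x = a ((z ^^ n) (pinv a x))" for n x
    using conj_pow[OF b, where f = z and n = n] by simp
  have orb: "y \<in> orb (cyc (a \<circ> z \<circ> pinv a)) x \<longleftrightarrow> pinv a y \<in> orb (cyc z) (pinv a x)" for x y
    unfolding orb_cyc_iff pw using i by metis
  show ?thesis unfolding pq_reg_def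
  proof (intro conjI ballI impI)
    show "perm_grp (conj_by a P)" by (rule perm_grp_conj[OF D(1) b])
    show "card (conj_by a P) = p ^ 3" using card_conj[OF b] D(4) by simp
    show "(a \<circ> z \<circ> pinv a) ^^ q = id" using conj_pow[OF b, where f = z and n = q] D(6) i by simp
    show "(a \<circ> z \<circ> pinv a) x \<noteq> x" if x: "x \<in> X" for x
    proof
      assume "(a \<circ> z \<circ> pinv a) x = x"
      then have "z (pinv a x) = pinv a x" using i(2)[of "z (pinv a x)"] by simp
      then show False using D(7) inX x by blast
    qed
    fix f assume "f \<in> conj_by a P"
    then obtain f' where f': "f' \<in> P" "f = a \<circ> f' \<circ> pinv a" by blast
    show "f ^^ p = id" using conj_pow[OF b, where f = f' and n = p] D(3)[OF f'(1)] i f'(2) by simp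
    have "f' (z y) = z (f' y)" for y using D(5)[OF f'(1)] by (metis comp_apply)
    then show "f \<circ> (a \<circ> z \<circ> pinv a) = (a \<circ> z \<circ> pinv a) \<circ> f" using f'(2) i by (simp add: fun_eq_iff)
    show "f \<circ> g = g \<circ> f" if g: "g \<in> conj_by a P" for g
    proof -
      obtain g' where g': "g' \<in> P" "g = a \<circ> g' \<circ> pinv a" using g by blast
      have "f' (g' y) = g' (f' y)" for y using D(2)[OF f'(1) g'(1)] by (metis comp_apply)
      then show ?thesis using f'(2) g'(2) i by (simp add: fun_eq_iff)
    qed
    show "f = id" if x: "x \<in> X" "f x \<in> orb (cyc (a \<circ> z \<circ> pinv a)) x" for x
    proof -
      have "f' (pinv a x) \<in> orb (cyc z) (pinv a x)" using x(2) f'(2) i(2)[of "f' (pinv a x)"] unfolding orb by simp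
      then have "f' = id" using D(8)[OF f'(1)] inX x(1) by blast
      then show ?thesis using f'(2) i by simp
    qed
  next
    show "\<exists>f\<in>conj_by a P. y \<in> orb (cyc (a \<circ> z \<circ> pinv a)) (f x)" if xy: "x \<in> X" "y \<in> X" for x y
    proof -
      have "pinv a x \<in> X" "pinv a y \<in> X" using inX xy by simp_all
      from D(9)[OF this] obtain f where f: "f \<in> P" "pinv a y \<in> orb (cyc z) (f (pinv a x))" by blast
      have "y \<in> orb (cyc (a \<circ> z \<circ> pinv a)) ((a \<circ> f \<circ> pinv a) x)"
        unfolding orb using f(2) i(2)[of "f (pinv a x)"] by simp
      then show ?thesis using f(1) by blast
    qed
  qed
qed

context block_perm
begin

text \<open>Exponents giving the same point are congruent modulo \<open>r\<close>, which any
  \<open>t\<close> with \<open>t ^^ r = id\<close> respects; \<open>(r - 1) * k\<close> stands for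
  \<open>-k\<close>.\<close>

lemma pow_eq_transfer:
  assumes v: "v \<in> X" and e: "(z ^^ m) v = (z ^^ k) v" and t: "t ^^ r = id"
  shows "t ^^ m = t ^^ k"
proof -
  have rk: "k + (r - 1) * k = r * k" using r_pos by (simp add: algebra_simps)
  have zz: "z ^^ m = z ^^ k" by (rule pow_eqD[OF v e])
  have "z ^^ (m + (r - 1) * k) = z ^^ (k + (r - 1) * k)" unfolding funpow_add zz ..
  then have "z ^^ (m + (r - 1) * k) = id" using rk pow_mod_period(1)[OF z_pow] by simp
  then obtain c where c: "m + (r - 1) * k = r * c" using pow_fixD(1)[OF v] by (metis dvdE id_apply)
  have "t ^^ m = t ^^ (m + r * k)" using pow_mod_period(2)[OF t] by simp
  also have "m + r * k = k + r * c" using c rk by linarith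
  also have "t ^^ (k + r * c) = t ^^ k" by (rule pow_mod_period(2)[OF t])
  finally show ?thesis .
qed

lemma orb_E_eq:
  assumes t: "t \<in> E" and free: "\<And>v. v \<in> X \<Longrightarrow> t v \<noteq> v" and v: "v \<in> X"
  shows "orb (cyc t) v = orb (cyc z) v"
proof -
  interpret t: block_perm X col t r by (rule block_perm_E(1)[OF t free])
  have "z \<in> blockE X col t" using block_perm_E(3)[OF t free] pow_E[of 1] by auto
  then have "orb (cyc z) v \<subseteq> orb (cyc t) v"
    using perm_grp_pow[OF t.E_grp] t.E_orb[OF _ v] by (auto simp: orb_cyc_iff[of _ z])
  moreover have "orb (cyc t) v \<subseteq> orb (cyc z) v"
    using perm_grp_pow[OF E_grp t] E_orb[OF _ v] by (auto simp: orb_cyc_iff[of _ t])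
  ultimately show ?thesis by blast
qed

text \<open>Each point is \<open>(z ^^ n) v\<close> for a unique \<open>v \<in> V\<close> and an
  \<open>n\<close> unique modulo \<open>r\<close>, so the map is well defined; it is injective
  because \<open>t\<close> has the same orbits as \<open>z\<close>. It is used with
  \<open>t = z\<close> to extend a permutation of \<open>V\<close>, and with \<open>F = id\<close>
  to turn \<open>z\<close> into another cycle.\<close>

lemma transversal_ext:
  assumes V: "V \<subseteq> X" "\<And>x. x \<in> X \<Longrightarrow> \<exists>v\<in>V. x \<in> orb (cyc z) v" "\<And>u v. u \<in> V \<Longrightarrow> v \<in> V \<Longrightarrow> u \<in> orb (cyc z) v \<Longrightarrow> u = v"
    and t: "t \<in> E" "\<And>v. v \<in> X \<Longrightarrow> t v \<noteq> v" and F: "F permutes V"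
  obtains a where "a permutes X" "\<And>v n. v \<in> V \<Longrightarrow> a ((z ^^ n) v) = (t ^^ n) (F v)"
proof -
  interpret t: block_perm X col t r by (rule block_perm_E(1)[OF t])
  have ex: "\<forall>x. \<exists>vn. x \<in> X \<longrightarrow> fst vn \<in> V \<and> x = (z ^^ snd vn) (fst vn)"
    using V(2) by (fastforce simp: orb_cyc_iff)
  then obtain c where c: "\<And>x. x \<in> X \<Longrightarrow> fst (c x) \<in> V \<and> x = (z ^^ snd (c x)) (fst (c x))" by metis
  define a where "a = (\<lambda>x. if x \<in> X then (t ^^ snd (c x)) (F (fst (c x))) else x)"
  have FV: "F v \<in> V \<longleftrightarrow> v \<in> V" for v by (rule permutes_in_image[OF F])
  have az: "a ((z ^^ n) v) = (t ^^ n) (F v)" if v: "v \<in> V" for v n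
  proof -
    let ?x = "(z ^^ n) v"
    have xX: "?x \<in> X" using V(1) v pow_in by blast
    obtain u m where um: "c ?x = (u, m)" by fastforce
    have u: "u \<in> V" "?x = (z ^^ m) u" using c[OF xX] um by auto
    have "?x \<in> orb (cyc z) u" using u(2) by (auto simp: orb_cyc_iff)
    moreover have "?x \<in> orb (cyc z) v" by (auto simp: orb_cyc_iff)
    ultimately have "u = v" using V(3)[OF u(1) v] orb_sym[OF cyc_grp] orb_trans[OF cyc_grp] by blast
    then have "t ^^ n = t ^^ m" using pow_eq_transfer[OF _ _ t.z_pow, of v n m] u V(1) by auto
    then show ?thesis using xX um \<open>u = v\<close> by (simp add: a_def)
  qed
  have "inj_on a X"
  proof (rule inj_onI)
    fix x y assume x: "x \<in> X" and y: "y \<in> X" and e: "a x = a y"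
    obtain v n where v: "v \<in> V" "x = (z ^^ n) v" using c[OF x] by blast
    obtain u m where u: "u \<in> V" "y = (z ^^ m) u" using c[OF y] by blast
    have e': "(t ^^ n) (F v) = (t ^^ m) (F u)" using e az v u by simp
    have FvX: "F v \<in> X" "F u \<in> X" using FV v u V(1) by blast+
    have "(t ^^ n) (F v) \<in> orb (cyc z) (F v)" "(t ^^ m) (F u) \<in> orb (cyc z) (F u)"
      using perm_grp_pow[OF E_grp t(1)] E_orb FvX by blast+
    then have "F v \<in> orb (cyc z) (F u)" using e' orb_sym[OF cyc_grp] orb_trans[OF cyc_grp] by metis
    then have "F v = F u" using V(3) FV v u by blast
    then have uv: "u = v" using permutes_inj[OF F] by (auto dest: injD)
    then have "z ^^ n = z ^^ m" using t.pow_eq_transfer[OF FvX(1) _ z_pow, of n m] e' by simp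
    then show "x = y" using v u uv by simp
  qed
  moreover have "a x \<in> X" if x: "x \<in> X" for x
    using t.pow_in FV c[OF x] V(1) x unfolding a_def by auto
  ultimately have "bij_betw a X X" using endo_inj_surj[OF finX, of a] unfolding bij_betw_def by blast
  then have "a permutes X" by (rule bij_imp_permutes) (simp add: a_def)
  then show ?thesis using that az by blast
qed

text \<open>The elements of \<open>R\<close> preserving one orbit of \<open>z\<close> form a
  \<open>p\<close>-group acting on \<open>r\<close> points. As \<open>p\<close> does not divide
  \<open>r\<close>, they fix some \<open>w\<close> there, and the \<open>R\<close>-orbit of
  \<open>w\<close> meets every orbit of \<open>z\<close> exactly once.\<close>

lemma ex_transversal:
  assumes X: "X \<noteq> {}" and R: "perm_grp R" "R \<subseteq> N" "card R = p ^ n" "prime (p::nat)" "\<not> p dvd r"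
    and P: "P \<subseteq> R" "\<And>x y. x \<in> X \<Longrightarrow> y \<in> X \<Longrightarrow> \<exists>f\<in>P. y \<in> orb (cyc z) (f x)"
  obtains V where "V \<subseteq> X" "V \<noteq> {}" "\<And>x. x \<in> X \<Longrightarrow> \<exists>v\<in>V. x \<in> orb (cyc z) v"
    "\<And>u v. u \<in> V \<Longrightarrow> v \<in> V \<Longrightarrow> u \<in> orb (cyc z) v \<Longrightarrow> u = v" "\<And>h v. h \<in> R \<Longrightarrow> v \<in> V \<Longrightarrow> h v \<in> V"
proof -
  obtain x0 where x0: "x0 \<in> X" using X by blast
  let ?B = "orb (cyc z) x0"
  define S where "S = {h \<in> R. h x0 \<in> ?B}"
  have RX: "h x \<in> X \<longleftrightarrow> x \<in> X" if "h \<in> R" for h x using Auts_in[OF N_aut] R(2) that by blast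
  have finR: "finite R" using finite_subset[OF _ finite_Auts[OF finX]] R(2) N_aut by blast
  have BX: "x \<in> X" if "x \<in> ?B" for x by (rule orb_in[OF that x0])
  have R_orb: "h y \<in> orb (cyc z) (h x)" if "h \<in> R" "x \<in> X" "y \<in> orb (cyc z) x" for h x y
    using N_orb R(2) that by blast
  have R_orb_inv: "y \<in> orb (cyc z) x" if h: "h \<in> R" "x \<in> X" "h y \<in> orb (cyc z) (h x)" for h x y
    using R_orb[OF perm_grp_inv[OF R(1) h(1)] _ h(3)] RX[OF h(1)] h(2) perm_grp_simps[OF R(1) h(1)] by simp
  have SB: "h x \<in> ?B" if "h \<in> S" "x \<in> ?B" for h x
  proof -
    have "h x \<in> orb (cyc z) (h x0)" using R_orb[OF _ x0 that(2)] that(1) by (simp add: S_def)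
    then show ?thesis using that(1) orb_trans[OF cyc_grp] by (auto simp: S_def)
  qed
  have S_grp: "perm_grp S"
  proof (rule finite_subgroupI[OF R(1) finR])
    show "S \<subseteq> R" by (auto simp: S_def)
    show "id \<in> S" using perm_grp_id[OF R(1)] orb_refl[OF cyc_grp] by (simp add: S_def)
    show "f \<circ> g \<in> S" if f: "f \<in> S" and g: "g \<in> S" for f g
      using SB[OF f, of "g x0"] perm_grp_comp[OF R(1), of f g] f g unfolding S_def by simp
  qed
  obtain l where l: "card S = p ^ l"
    using card_subgroup_prime_power[OF R(1) S_grp _ R(3,4)] by (auto simp: S_def)
  have cB: "card ?B = r"
    using card_orb_free[OF _ cyc_grp, of x0] cyc_free[OF _ x0] card_cyc(1)[OF x0] by simp
  interpret finite_action S "\<lambda>h x. h x" ?B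
  proof
    show "perm_grp S" by (rule S_grp)
    show "finite S" by (rule finite_subset[OF _ finR]) (auto simp: S_def)
    show "finite ?B" by (rule finite_subset[OF _ finX]) (use BX in blast)
    show "h x \<in> ?B" if "h \<in> S" "x \<in> ?B" for h x by (rule SB[OF that])
  qed simp_all
  have nd: "\<not> p dvd card ?B" using cB R(5) by simp
  have "\<exists>w\<in>?B. \<forall>h\<in>S. h w = w" by (rule ex_fixed[OF R(4) l nd]) blast
  then obtain w where w: "w \<in> ?B" "\<And>h. h \<in> S \<Longrightarrow> h w = w" by blast
  have wX: "w \<in> X" by (rule BX[OF w(1)])
  have Bw: "orb (cyc z) w = ?B" by (rule orb_eq[OF cyc_grp w(1)])
  have fixw: "h w = w" if h: "h \<in> R" "h w \<in> orb (cyc z) w" for h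
  proof -
    have "x0 \<in> orb (cyc z) w" using Bw orb_refl[OF cyc_grp] by blast
    then have "h x0 \<in> orb (cyc z) (h w)" by (rule R_orb[OF h(1) wX])
    then have "h x0 \<in> ?B" using orb_trans[OF cyc_grp _ h(2)] Bw by simp
    then show ?thesis using w(2) h(1) by (simp add: S_def)
  qed
  show ?thesis
  proof (rule that[of "orb R w"])
    show "orb R w \<subseteq> X" using RX wX by (auto simp: orb_def)
    show "orb R w \<noteq> {}" using orb_refl[OF R(1), of w] by blast
    show "\<exists>v\<in>orb R w. x \<in> orb (cyc z) v" if x: "x \<in> X" for x
    proof -
      obtain f where "f \<in> P" "x \<in> orb (cyc z) (f w)" using P(2)[OF wX x] by blast
      then show ?thesis using P(1) orbI[of f R] by blast
    qed
    show "u = v" if uv: "u \<in> orb R w" "v \<in> orb R w" "u \<in> orb (cyc z) v" for u v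
    proof -
      obtain f where f: "f \<in> R" "u = f w" using uv(1) by (auto simp: orb_def)
      obtain g where g: "g \<in> R" "v = g w" using uv(2) by (auto simp: orb_def)
      note gs = perm_grp_simps[OF R(1) g(1)]
      have "g ((pinv g \<circ> f) w) \<in> orb (cyc z) (g w)" using uv(3) f g gs by simp
      then have "(pinv g \<circ> f) w \<in> orb (cyc z) w" by (rule R_orb_inv[OF g(1) wX])
      then have "(pinv g \<circ> f) w = w" using fixw perm_grp_comp[OF R(1) perm_grp_inv[OF R(1) g(1)] f(1)] by blast
      then have "g ((pinv g \<circ> f) w) = g w" by simp
      then show ?thesis using f g gs by simp
    qed
    show "h v \<in> orb R w" if "h \<in> R" "v \<in> orb R w" for h v using that orb_moved[OF R(1)] by blast
  qed
qed

lemma pq_reg_transversal: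
  assumes V: "V \<subseteq> X" "\<And>u v. u \<in> V \<Longrightarrow> v \<in> V \<Longrightarrow> u \<in> orb (cyc z) v \<Longrightarrow> u = v" "\<And>h v. h \<in> P \<Longrightarrow> v \<in> V \<Longrightarrow> h v \<in> V"
    and P: "pq_reg p q X P t" and t: "t \<in> E"
  shows "reg p V P"
  unfolding reg_def
proof (intro conjI ballI impI)
  note D = pq_regD[OF P]
  have o: "orb (cyc t) v = orb (cyc z) v" if "v \<in> X" for v by (rule orb_E_eq[OF t D(7) that])
  show "perm_grp P" by (rule D(1))
  show "finite V" by (rule finite_subset[OF V(1) finX])
  show "f \<circ> g = g \<circ> f" if "f \<in> P" "g \<in> P" for f g by (rule D(2)[OF that])
  show "f ^^ p = id" if "f \<in> P" for f by (rule D(3)[OF that])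
  show "f x \<in> V" if "f \<in> P" "x \<in> V" for f x by (rule V(3)[OF that])
  show "\<exists>f\<in>P. b = f a" if ab: "a \<in> V" "b \<in> V" for a b
  proof -
    obtain f where f: "f \<in> P" "b \<in> orb (cyc t) (f a)" using D(9) ab V(1) by blast
    have fa: "f a \<in> V" by (rule V(3)[OF f(1) ab(1)])
    then have "b = f a" using V(2)[OF ab(2)] f(2) o V(1) by blast
    then show ?thesis using f(1) by blast
  qed
  show "f = id" if f: "f \<in> P" "x \<in> V" "f x = x" for f x
  proof -
    have "x \<in> orb (cyc t) x" by (auto simp: orb_cyc_iff intro: exI[of _ 0])
    then show ?thesis using D(8)[OF f(1)] f V(1) by auto
  qed
qed

end

text \<open>Cutting the elements off outside \<open>V\<close> turns them into permutations of
  \<open>V\<close>, as membership in \<open>Auts V col2\<close> demands.\<close>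

lemma restrict_reg:
  assumes P: "reg p V P" "P \<subseteq> Auts X col" and VX: "V \<subseteq> X"
    and col2: "\<And>f a b. f \<in> P \<Longrightarrow> a \<in> V \<Longrightarrow> b \<in> V \<Longrightarrow> col2 (f a) (f b) = col2 a b"
  defines "rs \<equiv> (\<lambda>f v. if v \<in> V then f v else v)"
  shows "reg p V (rs ` P)" "rs ` P \<subseteq> Auts V col2"
proof -
  note D = regD[OF P(1)]
  have rsV: "rs f v = f v" if "v \<in> V" for f v using that by (simp add: rs_def)
  have rs_comp: "rs f \<circ> rs g = rs (f \<circ> g)" if "g \<in> P" for f g using D(5)[OF that] by (auto simp: rs_def fun_eq_iff)
  have rs_id: "rs id = id" by (auto simp: rs_def fun_eq_iff)
  have rs_pow: "rs f ^^ n = rs (f ^^ n)" if "f \<in> P" for f n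
  proof (induction n)
    case (Suc n)
    have "rs f ^^ Suc n = rs f \<circ> rs (f ^^ n)" by (simp only: funpow.simps Suc)
    also have "\<dots> = rs (f \<circ> f ^^ n)" by (rule rs_comp[OF perm_grp_pow[OF D(1) that]])
    finally show ?case by (simp only: funpow.simps)
  qed (simp only: funpow.simps rs_id)
  have rs_inv: "rs f \<circ> rs (pinv f) = id" "rs (pinv f) \<circ> rs f = id" if f: "f \<in> P" for f
    using rs_comp[OF perm_grp_inv[OF D(1) f], of f] rs_comp[OF f, of "pinv f"]
      pinv_simps(3,4)[OF perm_grp_bij[OF D(1) f]] rs_id by simp_all
  have bij: "bij (rs f)" if "f \<in> P" for f using o_bij[OF rs_inv(2,1)[OF that]] .
  show "rs ` P \<subseteq> Auts V col2"
  proof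
    fix h assume "h \<in> rs ` P"
    then obtain f where f: "f \<in> P" "h = rs f" by blast
    have "rs f permutes V" unfolding permutes_altdef
    proof
      have "inj_on (rs f) V" using bij[OF f(1)] by (auto simp: bij_def inj_on_def)
      moreover have "rs f ` V \<subseteq> V" using D(5)[OF f(1)] rsV by auto
      ultimately show "bij_betw (rs f) V V" using endo_inj_surj[OF D(2)] unfolding bij_betw_def by blast
      show "{x. rs f x \<noteq> x} \<subseteq> V" by (auto simp: rs_def)
    qed
    then show "h \<in> Auts V col2" using col2[OF f(1)] rsV f(2) by (auto simp: Auts_def)
  qed
  show "reg p V (rs ` P)" unfolding reg_def
  proof (intro conjI ballI impI)
    show "perm_grp (rs ` P)"
    proof (rule perm_grpI)
      show "id \<in> rs ` P" using perm_grp_id[OF D(1)] rs_id by (metis image_eqI)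
      show "f \<circ> g \<in> rs ` P" if "f \<in> rs ` P" "g \<in> rs ` P" for f g
        using that rs_comp perm_grp_comp[OF D(1)] by auto
      show "bij f" if "f \<in> rs ` P" for f using that bij by auto
      show "pinv f \<in> rs ` P" if "f \<in> rs ` P" for f
      proof -
        obtain g where g: "g \<in> P" "f = rs g" using \<open>f \<in> rs ` P\<close> by blast
        have "pinv f = rs (pinv g)" unfolding g(2) by (rule pinv_unique[OF bij[OF g(1)] rs_inv(1)[OF g(1)]])
        then show ?thesis using perm_grp_inv[OF D(1) g(1)] by blast
      qed
    qed
    show "finite V" by (rule D(2))
    show "f \<circ> g = g \<circ> f" if "f \<in> rs ` P" "g \<in> rs ` P" for f g
    proof -
      obtain f' g' where fg: "f' \<in> P" "g' \<in> P" "f = rs f'" "g = rs g'" using \<open>f \<in> rs ` P\<close> \<open>g \<in> rs ` P\<close> by blast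
      then show ?thesis using rs_comp reg_comm[OF P(1) fg(1,2)] by simp
    qed
    show "f ^^ p = id" if "f \<in> rs ` P" for f using \<open>f \<in> rs ` P\<close> rs_pow D(4) rs_id by auto
    show "f x \<in> V" if "f \<in> rs ` P" "x \<in> V" for f x using that rsV D(5) by auto
    show "\<exists>f\<in>rs ` P. b = f a" if "a \<in> V" "b \<in> V" for a b using D(6)[OF that] rsV[OF that(1)] by auto
    show "f = id" if f: "f \<in> rs ` P" and x: "x \<in> V" "f x = x" for f x
    proof -
      obtain g where g: "g \<in> P" "f = rs g" using f by blast
      then have "g = id" using D(7)[OF g(1) x(1)] x(2) rsV[OF x(1)] by simp
      then show ?thesis using g(2) rs_id by simp
    qed
  qed
qed

context block_perm
begin

text \<open>Shifting both points back by \<open>z ^^ m\<close> shows that only the difference of the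
  exponents matters, written without subtraction.\<close>

lemma col_pow:
  assumes "u \<in> X" "v \<in> X"
  shows "col ((z ^^ m) u) ((z ^^ k) v) = col u ((z ^^ (k + (r - 1) * m)) v)"
proof -
  let ?t = "z ^^ ((r - 1) * m)"
  have i: "(z ^^ m) u \<in> X" "(z ^^ k) v \<in> X" using assms pow_in by auto
  have "col ((z ^^ m) u) ((z ^^ k) v) = col (?t ((z ^^ m) u)) (?t ((z ^^ k) v))"
    by (rule Auts_col[OF pow_aut i, symmetric])
  moreover have "(r - 1) * m + m = r * m" using r_pos by (simp add: algebra_simps)
  then have "?t ((z ^^ m) u) = u" using pow_mod_period(1)[OF z_pow, of m] by (metis comp_apply funpow_add id_apply)
  moreover have "?t ((z ^^ k) v) = (z ^^ (k + (r - 1) * m)) v" by (metis add.commute comp_apply funpow_add)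
  ultimately show ?thesis by simp
qed

text \<open>Sylow's theorem is applied in the centraliser of \<open>z\<close>, so that conjugation
  leaves \<open>z\<close> alone. A solution on an invariant transversal then extends to a
  permutation of \<open>X\<close> commuting with \<open>z\<close>.\<close>

lemma conj_same_cycle:
  assumes X: "X \<noteq> {}" and p: "prime p" "\<not> p dvd r"
    and P: "pq_reg p r X P z" "P \<subseteq> Auts X col" and P': "pq_reg p r X P' z" "P' \<subseteq> Auts X col"
  shows "\<exists>a\<in>Auts X col. a \<circ> z = z \<circ> a \<and> conj_by a P' = P"
proof -
  note D = pq_regD[OF P(1)] and D' = pq_regD[OF P'(1)]
  define C where "C = {h \<in> Auts X col. h \<circ> z = z \<circ> h}"
  have CA: "C \<subseteq> Auts X col" by (auto simp: C_def)
  have finC: "finite C" by (rule finite_subset[OF CA finite_Auts[OF finX]])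
  have C_grp: "perm_grp C"
  proof (rule finite_subgroupI[OF perm_grp_Auts finite_Auts[OF finX] CA])
    show "id \<in> C" using perm_grp_id[OF perm_grp_Auts] by (simp add: C_def)
    show "f \<circ> g \<in> C" if f: "f \<in> C" and g: "g \<in> C" for f g
    proof -
      have "f (z x) = z (f x)" "g (z x) = z (g x)" for x using f g by (auto simp: C_def fun_eq_iff)
      then show ?thesis using f g perm_grp_comp[OF perm_grp_Auts, of f X col g] by (auto simp: C_def fun_eq_iff)
    qed
  qed
  have PC: "P \<subseteq> C" "P' \<subseteq> C" using P(2) P'(2) D(5) D'(5) by (auto simp: C_def)
  obtain g R n where g: "g \<in> C" and R: "perm_grp R" "R \<subseteq> C" "card R = p ^ n" and PR: "P \<subseteq> R"
    and P'R: "\<And>y. y \<in> P' \<Longrightarrow> g \<circ> y \<circ> pinv g \<in> R"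
    using sylow_conj[OF C_grp finC p(1) D(1) PC(1) D(4) D'(1) PC(2) D'(4)] by blast
  have gA: "g \<in> Auts X col" using g CA by blast
  note bg = perm_grp_bij[OF perm_grp_Auts gA]
  have gz: "g \<circ> z \<circ> pinv g = z"
  proof
    fix x
    have "g (z y) = z (g y)" for y using g by (auto simp: C_def fun_eq_iff)
    then show "(g \<circ> z \<circ> pinv g) x = z x" using pinv_simps[OF bg] by simp
  qed
  define P1 where "P1 = conj_by g P'"
  have P1: "pq_reg p r X P1 z" unfolding P1_def using pq_reg_conj[OF P'(1) Auts_permutes[OF gA]] gz by simp
  have P1R: "P1 \<subseteq> R" unfolding P1_def using P'R by blast
  have RN: "R \<subseteq> N" using R(2) comm_N by (auto simp: C_def)
  have rz: "h ((z ^^ k) x) = (z ^^ k) (h x)" if "h \<in> R" for h k x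
    by (rule comm_pow) (use R(2) that in \<open>auto simp: C_def\<close>)
  obtain V where V: "V \<subseteq> X" "V \<noteq> {}" "\<And>x. x \<in> X \<Longrightarrow> \<exists>v\<in>V. x \<in> orb (cyc z) v"
    "\<And>u v. u \<in> V \<Longrightarrow> v \<in> V \<Longrightarrow> u \<in> orb (cyc z) v \<Longrightarrow> u = v" "\<And>h v. h \<in> R \<Longrightarrow> v \<in> V \<Longrightarrow> h v \<in> V"
    using ex_transversal[OF X R(1) RN R(3) p PR D(9)] by blast
  have zE: "z \<in> E" using pow_E[of 1] by simp
  have rP: "reg p V P" by (rule pq_reg_transversal[OF V(1) V(4) _ P(1) zE]) (use V(5) PR in blast)+
  have rP1: "reg p V P1" by (rule pq_reg_transversal[OF V(1) V(4) _ P1 zE]) (use V(5) P1R in blast)+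
  obtain w where w: "w \<in> V" using V(2) by blast
  have cV: "card V = p ^ 3" using card_reg(1)[OF rP w] D(4) by simp
  define col2 where "col2 a b = (\<lambda>k. col a ((z ^^ k) b))" for a b
  have RA: "R \<subseteq> Auts X col" using R(2) CA by blast
  have c2: "col2 (f a) (f b) = col2 a b" if f: "f \<in> R" and ab: "a \<in> V" "b \<in> V" for f a b
  proof
    fix k
    have "col (f a) (f ((z ^^ k) b)) = col a ((z ^^ k) b)"
      by (rule Auts_col[OF subsetD[OF RA f]]) (use ab V(1) pow_in in auto)
    then show "col2 (f a) (f b) k = col2 a b k" using rz[OF f] by (simp add: col2_def)
  qed
  define rs where "rs = (\<lambda>f v. if v \<in> V then f v else v :: 'a)"
  have QR: "reg p V (rs ` Q) \<and> rs ` Q \<subseteq> Auts V col2" if Q: "reg p V Q" "Q \<subseteq> R" for Q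
  proof -
    have QA: "Q \<subseteq> Auts X col" using Q(2) RA by blast
    have c2Q: "col2 (f a) (f b) = col2 a b" if "f \<in> Q" "a \<in> V" "b \<in> V" for f a b
      by (rule c2[OF subsetD[OF Q(2) that(1)] that(2,3)])
    show ?thesis unfolding rs_def
      by (rule conjI; rule restrict_reg[where P = Q and X = X and V = V and col = col]; fact Q(1) QA V(1) c2Q)
  qed
  note rs1 = conjunct1[OF QR[OF rP PR]] conjunct2[OF QR[OF rP PR]]
  note rs2 = conjunct1[OF QR[OF rP1 P1R]] conjunct2[OF QR[OF rP1 P1R]]
  obtain b where b: "b \<in> Auts V col2" "conj_by b (rs ` P1) = rs ` P"
    using elementary_abelian_conj[OF p(1) regD(2)[OF rP] cV rs1 rs2] by blast
  note bp = Auts_permutes[OF b(1)]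
  have bV: "b v \<in> V \<longleftrightarrow> v \<in> V" for v by (rule permutes_in_image[OF bp])
  obtain a where a: "a permutes X" "\<And>v k. v \<in> V \<Longrightarrow> a ((z ^^ k) v) = (z ^^ k) (b v)"
    using transversal_ext[OF V(1,3,4) zE z_free bp] by blast
  have xrep: "\<exists>v\<in>V. \<exists>k. x = (z ^^ k) v" if "x \<in> X" for x using V(3)[OF that] by (auto simp: orb_cyc_iff)
  have "col (a x) (a y) = col x y" if xy: "x \<in> X" "y \<in> X" for x y
  proof -
    obtain v k where v: "v \<in> V" "x = (z ^^ k) v" using xrep xy(1) by blast
    obtain u m where u: "u \<in> V" "y = (z ^^ m) u" using xrep xy(2) by blast
    have "col (a x) (a y) = col2 (b v) (b u) (m + (r - 1) * k)"
      unfolding v(2) u(2) a(2)[OF v(1)] a(2)[OF u(1)] col2_def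
      by (rule col_pow) (use bV v u V(1) in auto)
    also have "\<dots> = col2 v u (m + (r - 1) * k)" using Auts_col[OF b(1) v(1) u(1)] by simp
    also have "\<dots> = col x y" unfolding v(2) u(2) col2_def
      by (rule col_pow[symmetric]) (use v u V(1) in auto)
    finally show ?thesis .
  qed
  then have aA: "a \<in> Auts X col" using a(1) by (simp add: Auts_def)
  have out: "f x = x" if "f \<in> Auts X col" "x \<notin> X" for f x
    using permutes_not_in[OF Auts_permutes[OF that(1)] that(2)] .
  have az: "a \<circ> z = z \<circ> a"
  proof
    fix x show "(a \<circ> z) x = (z \<circ> a) x"
    proof (cases "x \<in> X")
      case True
      then obtain v k where v: "v \<in> V" "x = (z ^^ k) v" using xrep by blast
      then show ?thesis using a(2)[OF v(1), of k] a(2)[OF v(1), of "Suc k"] by simp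
    next
      case False
      then show ?thesis using out[OF aA] out[OF z_aut] by simp
    qed
  qed
  note ba = perm_grp_bij[OF perm_grp_Auts aA]
  have sub: "a \<circ> f \<circ> pinv a \<in> P" if f: "f \<in> P1" for f
  proof -
    obtain h where h: "h \<in> P" "b \<circ> rs f \<circ> pinv b = rs h" using b(2) f by blast
    have bf: "b (f v) = h (b v)" if v: "v \<in> V" for v
      using fun_cong[OF h(2), of "b v"] v bV permutes_inverses[OF bp] by (simp add: rs_def)
    have "a (f x) = h (a x)" for x
    proof (cases "x \<in> X")
      case True
      then obtain v k where v: "v \<in> V" "x = (z ^^ k) v" using xrep by blast
      have fR: "f \<in> R" "h \<in> R" using f P1R h(1) PR by auto
      have "a (f x) = a ((z ^^ k) (f v))" using v(2) rz[OF fR(1)] by simp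
      also have "\<dots> = (z ^^ k) (b (f v))" by (rule a(2)[OF V(5)[OF fR(1) v(1)]])
      also have "\<dots> = h ((z ^^ k) (b v))" using bf[OF v(1)] rz[OF fR(2)] by simp
      finally show ?thesis using a(2)[OF v(1)] v(2) by simp
    next
      case False
      have "f \<in> Auts X col" "h \<in> Auts X col" using f P1R h(1) PR RA by auto
      then have "f x = x" "h x = x" using False out by blast+
      then show ?thesis using False out[OF aA] by simp
    qed
    then have "a \<circ> f \<circ> pinv a = h" using pinv_simps[OF ba] by (simp add: fun_eq_iff)
    then show ?thesis using h(1) by simp
  qed
  have finP: "finite P" using finite_subset[OF _ finite_Auts[OF finX]] P(2) by blast
  have sub': "conj_by a P1 \<subseteq> P" using sub by blast
  have "card (conj_by a P1) = card P" using card_conj[OF ba] pq_regD(4)[OF P1] D(4) by simp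
  then have im: "conj_by a P1 = P" by (rule card_subset_eq[OF finP sub'])
  have "conj_by (a \<circ> g) P' = P"
    using conj_conj[OF ba bg, of P'] im unfolding P1_def by simp
  moreover have "(a \<circ> g) \<circ> z = z \<circ> (a \<circ> g)" using az g by (auto simp: C_def fun_eq_iff)
  ultimately show ?thesis using perm_grp_comp[OF perm_grp_Auts aA gA] by blast
qed

end

section \<open>Conjugating one cycle into the other\<close>

locale twisted = class_group X col z r p V P R w n
  for X :: "'a set" and col :: "'a \<Rightarrow> 'a \<Rightarrow> 'c" and z r p V P R w n +
  fixes P' :: "('a \<Rightarrow> 'a) set" and z' :: "'a \<Rightarrow> 'a"
  assumes V_cover: "x \<in> X \<Longrightarrow> \<exists>v\<in>V. x \<in> orb Z v"
    and V_unique: "u \<in> V \<Longrightarrow> v \<in> V \<Longrightarrow> u \<in> orb Z v \<Longrightarrow> u = v"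
    and P_comm: "f \<in> P \<Longrightarrow> f \<circ> z = z \<circ> f"
    and P': "reg p V P'" and P'R: "P' \<subseteq> R" and P'_comm: "f \<in> P' \<Longrightarrow> f \<circ> z' = z' \<circ> f"
    and z'E: "z' \<in> E" and z'_free: "x \<in> X \<Longrightarrow> z' x \<noteq> x" and z'w: "z' w = z w"
begin

text \<open>The normalisation \<open>z' w = z w\<close> propagates because similar points share the
  exponent of \<open>z'\<close>.\<close>

lemma z'_class: "sim w x \<Longrightarrow> z' x = z x"
  using sim_pow_eq[OF wX _ z'E, of x 1] z'w by simp

lemma z'_pow_class: "sim w x \<Longrightarrow> (z' ^^ j) x = (z ^^ j) x"
proof (induction j)
  case (Suc j)
  have "sim w ((z ^^ j) x)"
    using Suc.prems sim_trans sim_pow[of x j] permutes_not_in[OF Auts_permutes[OF pow_aut[of j]], of x]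
    by (cases "x \<in> X") auto
  then show ?case using Suc z'_class by simp
qed simp

lemma sim_sym': "v \<in> X \<Longrightarrow> u \<in> X \<Longrightarrow> sim v u \<longleftrightarrow> sim u v"
  using sim_sym by blast

lemma shift_sim:
  assumes g: "g \<in> P" "g' \<in> P'" "g w = g' w" and x: "x \<in> X" "sim x (g w)"
  shows "sim x (g' (pinv g x))" "g' \<circ> pinv g \<in> R"
proof -
  have gR: "g \<in> R" "g' \<in> R" using g PR P'R by auto
  show hR: "g' \<circ> pinv g \<in> R" by (rule perm_grp_comp[OF R(1) gR(2) perm_grp_inv[OF R(1) gR(1)]])
  have gw: "g w \<in> X" using RV[OF gR(1) wV] VX by blast
  have "(g' \<circ> pinv g) (g w) = g w" using g(3) perm_grp_simps(2)[OF R(1) gR(1), of w] by simp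
  then have "sim (g' (pinv g x)) (g w)" using R_sim[OF hR x(2)] by simp
  moreover have "g' (pinv g x) \<in> X" using Auts_in[OF subsetD[OF RA hR], of x] x(1) by simp
  ultimately show "sim x (g' (pinv g x))" using sim_sym' gw sim_trans[OF x(2)] by blast
qed

text \<open>On the class of \<open>g w\<close> the candidate \<open>g' \<circ> pinv g\<close> turns
  \<open>z\<close> into \<open>z'\<close>: \<open>pinv g\<close> commutes with \<open>z\<close>, the
  two cycles agree on the class of \<open>w\<close>, and \<open>g'\<close> commutes with
  \<open>z'\<close>. Only colours between classes remain, and testing them on \<open>V\<close>
  suffices since points of one \<open>Z\<close>-orbit are twins.\<close>

lemma untwist:
  assumes tw: "\<And>v g g'. v \<in> V \<Longrightarrow> g \<in> P \<Longrightarrow> g' \<in> P' \<Longrightarrow> g w = g' w \<Longrightarrow> sim v (g w) \<Longrightarrow> twin v (g' (pinv g v))"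
  shows "\<exists>a\<in>Auts X col. a \<circ> z = z' \<circ> a"
proof -
  have P'N: "P' \<subseteq> N" using P'R R(2) by blast
  have rep: "\<exists>g\<in>P. \<exists>g'\<in>P'. g w = g' w \<and> sim x (g w)" if x: "x \<in> X" for x
  proof -
    obtain v where v: "v \<in> V" "x \<in> orb Z v" using V_cover[OF x] by blast
    obtain g where g: "g \<in> P" "v = g w" using regD(6)[OF P wV v(1)] by blast
    obtain g' where g': "g' \<in> P'" "v = g' w" using regD(6)[OF P' wV v(1)] by blast
    have "sim x v" using sim_orb[OF x orb_sym[OF cyc_grp v(2)]] .
    then show ?thesis using g g' by (intro bexI[of _ g] bexI[of _ g'] conjI) auto
  qed
  have twX: "twin x (g' (pinv g x))"
    if x: "x \<in> X" and g: "g \<in> P" "g' \<in> P'" "g w = g' w" "sim x (g w)" for x g g'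
  proof -
    obtain v where v: "v \<in> V" "x \<in> orb Z v" using V_cover[OF x] by blast
    have vX: "v \<in> X" using v VX by blast
    have vx: "v \<in> orb Z x" by (rule orb_sym[OF cyc_grp v(2)])
    have xv: "sim x v" by (rule sim_orb[OF x vx])
    have vg: "sim v (g w)" using sim_trans[OF sim_sym[OF x vX xv] g(4)] .
    note s = shift_sim[OF g(1-3) vX vg]
    have hv: "g' (pinv g v) \<in> X" using Auts_in[OF subsetD[OF RA s(2)], of v] vX by simp
    have "g' (pinv g x) \<in> orb Z (g' (pinv g v))" using R_orb[OF s(2) vX v(2)] by simp
    then have t3: "twin (g' (pinv g v)) (g' (pinv g x))" by (rule twin_orb[OF hv])
    have "twin v (g' (pinv g x))" by (rule twin_trans[OF vX hv s(1) tw[OF v(1) g(1-3) vg] t3])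
    then show ?thesis by (rule twin_trans[OF x vX xv twin_orb[OF x vx]])
  qed
  have "\<exists>a\<in>Auts X col. \<forall>x\<in>X. \<exists>g\<in>P. \<exists>g'\<in>P'. g w = g' w \<and> sim x (g w) \<and> (\<forall>u\<in>X. sim x u \<longrightarrow> a u = g' (pinv g u))"
    by (rule class_glue[where P = P and P' = P' and w = w]) (fact wX PN P'N rep twX | blast)+
  then obtain a where a: "a \<in> Auts X col"
    "\<And>x. x \<in> X \<Longrightarrow> \<exists>g\<in>P. \<exists>g'\<in>P'. g w = g' w \<and> sim x (g w) \<and> (\<forall>u\<in>X. sim x u \<longrightarrow> a u = g' (pinv g u))" by blast
  have "a (z x) = z' (a x)" for x
  proof (cases "x \<in> X")
    case True
    obtain g g' where g: "g \<in> P" "g' \<in> P'" "g w = g' w" "sim x (g w)"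
      and ag: "\<And>u. u \<in> X \<Longrightarrow> sim x u \<Longrightarrow> a u = g' (pinv g u)" using a(2)[OF True] by blast
    note G = regD(1)[OF P]
    have gR: "g \<in> R" using g(1) PR by blast
    have iR: "pinv g \<in> R" by (rule perm_grp_inv[OF R(1) gR])
    have "sim (pinv g x) w" using R_sim[OF iR g(4)] perm_grp_simps[OF R(1) gR] by simp
    then have wx: "sim w (pinv g x)" using sim_sym'[OF wX] Auts_in[OF subsetD[OF RA iR]] True by blast
    have "a (z x) = g' (pinv g (z x))" by (rule ag) (use pow_in[of 1] sim_pow[OF True, of 1] True in auto)
    also have "pinv g (z x) = z (pinv g x)" using P_comm[OF perm_grp_inv[OF G g(1)]] by (simp add: fun_eq_iff)
    also have "\<dots> = z' (pinv g x)" using z'_class[OF wx] by simp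
    also have "g' \<dots> = z' (g' (pinv g x))" using P'_comm[OF g(2)] by (simp add: fun_eq_iff)
    also have "g' (pinv g x) = a x" by (rule ag[OF True sim_refl, symmetric])
    finally show ?thesis .
  next
    case False
    then show ?thesis using permutes_not_in[OF Auts_permutes[OF a(1)]] permutes_not_in[OF Auts_permutes[OF z_aut]]
        permutes_not_in[OF Auts_permutes[OF E_aut[OF z'E]]] by simp
  qed
  then show ?thesis using a(1) by (auto simp: fun_eq_iff)
qed

text \<open>An element of the \<open>p\<close>-group \<open>S\<close> fixing one of at most
  \<open>p\<close> points of \<open>C0\<close> fixes them all, so the candidate fixes
  \<open>V\<close> pointwise.\<close>

lemma untwist_trivial:
  assumes "card D \<le> p"
  shows "\<exists>a\<in>Auts X col. a \<circ> z = z' \<circ> a"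
proof (rule untwist)
  fix v g g' assume v: "v \<in> V" and g: "g \<in> P" "g' \<in> P'" "g w = g' w" "sim v (g w)"
  have g'R: "g' \<in> R" using g(2) P'R by blast
  note cs = class_shift[OF g(1) g'R g(3) v g(4)]
  have one: "perm_grp {id}" by (rule perm_grpI) auto
  have "(pinv g \<circ> g') (pinv g v) \<in> orb {id} (pinv g v)"
    by (rule C0_block_fix[OF one _ _ _ cs(1-3)]) (use perm_grp_id[OF D_grp] assms card_C0 in \<open>auto simp: orb_def\<close>)
  then have "(pinv g \<circ> g') (pinv g v) = pinv g v" by (simp add: orb_def)
  then have "g ((pinv g \<circ> g') (pinv g v)) = g (pinv g v)" by (rule arg_cong)
  with cs(4) have "g' (pinv g v) = g (pinv g v)" by (rule trans)
  then show "twin v (g' (pinv g v))" using perm_grp_simps(1)[OF regD(1)[OF P] g(1)] by (simp add: twin_def)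
qed

text \<open>With a single class there are no colours between classes to preserve.\<close>

lemma untwist_full:
  assumes "D = P"
  shows "\<exists>a\<in>Auts X col. a \<circ> z = z' \<circ> a"
proof (rule untwist)
  fix v g g' assume v: "v \<in> V"
  have "sim v y" if y: "y \<in> X" for y
  proof -
    obtain u where u: "u \<in> V" "y \<in> orb Z u" using V_cover[OF y] by blast
    have "u \<in> orb D v" using reg_orb[OF P v] u(1) assms by simp
    then have "sim v u" using sim_D_iff[OF v u(1)] by simp
    then show ?thesis using sim_trans sim_orb[OF _ u(2)] u(1) VX by blast
  qed
  then show "twin v (g' (pinv g v))" by (simp add: twin_def)
qed

text \<open>If the automorphisms commuting with \<open>z\<close> on the class of \<open>w\<close> act regularly on that class, then an element of
  \<open>P'\<close> preserving the classes acts on each of them as an element of \<open>D\<close>, so that shift invariance applies to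
  its quotient by an element of \<open>D\<close>.\<close>

definition "K1 = {h \<in> S. \<forall>x\<in>X. sim w x \<longrightarrow> h (z x) = z (h x)}"

lemma untwist_regular:
  assumes idx: "card V = p * card D"
    and K1: "\<And>t v. t \<in> K1 \<Longrightarrow> t w = w \<Longrightarrow> v \<in> C0 \<Longrightarrow> t v = v"
  shows "\<exists>a\<in>Auts X col. a \<circ> z = z' \<circ> a"
proof (rule untwist)
  fix v g g' assume v: "v \<in> V" and g: "g \<in> P" "g' \<in> P'" "g w = g' w" "sim v (g w)"
  note G = regD(1)[OF P]
  have gR: "g \<in> R" "g' \<in> R" using g PR P'R by auto
  define \<rho> where "\<rho> = g w"
  have rV: "\<rho> \<in> V" unfolding \<rho>_def by (rule RV[OF gR(1) wV])
  have vX: "v \<in> X" "\<rho> \<in> X" using v rV VX by auto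
  have "sim \<rho> v" using sim_sym[OF vX] g(4) unfolding \<rho>_def by simp
  then have "v \<in> orb D \<rho>" using sim_D_iff[OF rV v] by simp
  then obtain h where h: "h \<in> D" "v = h \<rho>" by (auto simp: orb_def)
  have hP: "h \<in> P" using h(1) D_sub by blast
  have hw: "h w \<in> V" using regD(5)[OF P hP wV] .
  \<comment> \<open>\<open>k\<close> is the counterpart in \<open>P'\<close> of \<open>h\<close>;
    the candidate will turn out to map \<open>v\<close> to \<open>k \<rho>\<close>.\<close>
  obtain k where k: "k \<in> P'" "h w = k w" using regD(6)[OF P' wV hw] by blast
  have kR: "k \<in> R" using k(1) P'R by blast
  have sim_k: "sim y (k y)" if y: "y \<in> X" for y
  proof -
    obtain u where u: "u \<in> V" "y \<in> orb Z u" using V_cover[OF y] by blast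
    have uX: "u \<in> X" using u VX by blast
    obtain f where f: "f \<in> P'" "u = f w" using regD(6)[OF P' wV u(1)] by blast
    have fR: "f \<in> R" using f(1) P'R by blast
    have "sim w (k w)" using D_sim[OF h(1) wV] k(2) by simp
    then have "sim (f w) (f (k w))" by (rule R_sim[OF fR])
    then have "sim u (k u)" using regD(3)[OF P' f(1) k(1)] f(2) by simp
    moreover have "sim (k u) (k y)" using sim_orb[OF uX u(2)] by (rule R_sim[OF kR])
    moreover have "sim y u" by (rule sim_orb[OF y orb_sym[OF cyc_grp u(2)]])
    ultimately show ?thesis using sim_trans by blast
  qed
  interpret z': block_perm X col z' r by (rule block_perm_E(1)[OF z'E z'_free])
  have E': "blockE X col z' = E" by (rule blockE_eq[OF z'E z'_free])
  have sim': "z'.sim a b = sim a b" for a b unfolding z'.sim_def sim_def E' ..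
  \<comment> \<open>\<open>k\<close> commutes with \<open>z'\<close>. At the similar points
    \<open>y\<close> and \<open>k y\<close> the cycle \<open>z\<close> is the same power of
    \<open>z'\<close>, so \<open>k\<close> commutes with \<open>z\<close> too.\<close>
  have kz: "k (z y) = z (k y)" if y: "y \<in> X" for y
  proof -
    have zE: "z \<in> blockE X col z'" using E' pow_E[of 1] by simp
    obtain m where m: "z y = (z' ^^ m) y" using z'.E_pow[OF zE y] .
    have "z (k y) = (z' ^^ m) (k y)" by (rule z'.sim_pow_eq[OF y _ zE m]) (use sim' sim_k[OF y] in simp)
    then show ?thesis using m comm_pow[OF P'_comm[OF k(1)]] by simp
  qed
  \<comment> \<open>Moved to the class of \<open>w\<close>, \<open>k\<close> differs by an element
    of \<open>D\<close> from an element of \<open>K1\<close> fixing \<open>w\<close>, which acts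
    trivially on \<open>C0\<close> by hypothesis.\<close>
  have loc: "\<exists>d\<in>D. \<forall>y'\<in>V. sim y y' \<longrightarrow> k y' = d y'" if y: "y \<in> V" for y
  proof -
    obtain f where f: "f \<in> P" "y = f w" using regD(6)[OF P wV y] by blast
    have fR: "f \<in> R" using f(1) PR by blast
    note fs = perm_grp_simps[OF R(1) fR]
    have ifP: "pinv f \<in> P" by (rule perm_grp_inv[OF G f(1)])
    have iR: "pinv f \<in> R" using ifP PR by blast
    let ?t = "pinv f \<circ> k \<circ> f"
    have tR: "?t \<in> R" using perm_grp_comp[OF R(1) perm_grp_comp[OF R(1) iR kR] fR] .
    have yX: "y \<in> X" using y VX by blast
    have "sim (pinv f y) (pinv f (k y))" by (rule R_sim[OF iR sim_k[OF yX]])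
    then have simt: "sim w (?t w)" using f(2) fs by simp
    have tz: "?t (z x) = z (?t x)" if x: "x \<in> X" for x
    proof -
      have "f x \<in> X" using Auts_in[OF subsetD[OF RA fR]] x by simp
      then show ?thesis using P_comm[OF f(1)] P_comm[OF ifP] kz by (simp add: fun_eq_iff)
    qed
    obtain d where d: "d \<in> P" "?t w = d w" using regD(6)[OF P wV RV[OF tR wV]] by blast
    have dD: "d \<in> D" using d simt by (simp add: D_def)
    have dR: "d \<in> R" using d(1) PR by blast
    note ds = perm_grp_simps[OF R(1) dR]
    have idP: "pinv d \<in> P" by (rule perm_grp_inv[OF G d(1)])
    have "pinv d \<circ> ?t \<in> R" using perm_grp_comp[OF R(1) _ tR] idP PR by blast
    moreover have fixw: "(pinv d \<circ> ?t) w = w" using d(2) ds by simp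
    moreover have "(pinv d \<circ> ?t) (z x) = z ((pinv d \<circ> ?t) x)" if "x \<in> X" for x
      using tz[OF that] P_comm[OF idP] by (simp add: fun_eq_iff)
    ultimately have "pinv d \<circ> ?t \<in> K1" using sim_refl unfolding K1_def S_def by simp
    from K1[OF this fixw] have "(pinv d \<circ> ?t) u = u" if "u \<in> C0" for u using that by blast
    then have td: "?t u = d u" if "u \<in> C0" for u using that ds(1)[of "?t u"] by (metis comp_apply)
    have "k y' = d y'" if y': "y' \<in> V" "sim y y'" for y'
    proof -
      have "sim (pinv f y) (pinv f y')" by (rule R_sim[OF iR y'(2)])
      then have "pinv f y' \<in> C0" using f(2) fs RV[OF iR y'(1)] by (simp add: C0_def)
      then have "pinv f (k (f (pinv f y'))) = d (pinv f y')" using td[of "pinv f y'"] by simp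
      then have "k y' = f (d (pinv f y'))" using fs by metis
      then show ?thesis using regD(3)[OF P f(1) d(1)] fs by simp
    qed
    then show ?thesis using dD by blast
  qed
  \<comment> \<open>\<open>s\<close> fixes \<open>w\<close> and acts at \<open>\<rho>\<close> as
    \<open>c = pinv h \<circ> d\<close>, which are the two points fed to
    \<open>shift_invariance\<close>.\<close>
  define s where "s = pinv h \<circ> k"
  have ihD: "pinv h \<in> D" by (rule perm_grp_inv[OF D_grp h(1)])
  have ihP: "pinv h \<in> P" using ihD D_sub by blast
  have sR: "s \<in> R" unfolding s_def by (rule perm_grp_comp[OF R(1) _ kR]) (use ihP PR in blast)
  have sw: "s w = w" unfolding s_def using k(2)[symmetric] perm_grp_simps(2)[OF G hP] by simp
  obtain d where d: "d \<in> D" "\<And>y'. y' \<in> V \<Longrightarrow> sim \<rho> y' \<Longrightarrow> k y' = d y'" using loc[OF rV] by blast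
  have dP: "d \<in> P" using d(1) D_sub by blast
  define c where "c = pinv h \<circ> d"
  have cD: "c \<in> D" unfolding c_def by (rule perm_grp_comp[OF D_grp ihD d(1)])
  have cP: "c \<in> P" using cD D_sub by blast
  have srho: "s \<rho> = c \<rho>" unfolding s_def c_def using d(2)[OF rV sim_refl] by simp
  have PA: "f \<in> Auts X col" if "f \<in> P" for f using that PR RA by blast
  have sD: "s (u y) = u (s y)" if u: "u \<in> D" and y: "y \<in> V" for u y
  proof -
    obtain e where e: "e \<in> D" "\<And>y'. y' \<in> V \<Longrightarrow> sim y y' \<Longrightarrow> k y' = e y'" using loc[OF y] by blast
    have uP: "u \<in> P" "e \<in> P" using u e(1) D_sub by auto
    have "k (u y) = e (u y)" by (rule e(2)) (use regD(5)[OF P uP(1) y] D_sim[OF u y] in auto)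
    moreover have "k y = e y" by (rule e(2)[OF y sim_refl])
    ultimately show ?thesis unfolding s_def using regD(3)[OF P uP(1)] uP(2) ihP by simp
  qed
  have so: "s y \<in> orb D y" if y: "y \<in> V" for y
  proof -
    obtain e where e: "e \<in> D" "k y = e y" using loc[OF y] sim_refl y by blast
    show ?thesis unfolding s_def by (rule orbI[OF perm_grp_comp[OF D_grp ihD e(1)]]) (use e(2) in simp)
  qed
  have inv1: "col a (c b) = col a b" if ab: "a \<in> V" "b \<in> V" "b \<notin> orb D a" for a b
  proof (rule shift_invariance[where P = P and U = D and X = V and s = s and ?v1.0 = w and ?v2.0 = \<rho>])
    show "prime p" "reg p V P" "perm_grp D" "D \<subseteq> P" "card V = p * card D" by (fact prime_p P D_grp D_sub idx)+
    show "col (f a) (f b) = col a b" if "f \<in> P" "a \<in> V" "b \<in> V" for f a b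
      using Auts_col[OF PA[OF that(1)]] that VX by blast
    show "col (s a) (s b) = col a b" if "a \<in> V" "b \<in> V" for a b
      using Auts_col[OF subsetD[OF RA sR]] that VX by blast
    show "s (u a) = u (s a)" if "u \<in> D" "a \<in> V" for u a by (rule sD[OF that])
    show "s a \<in> orb D a" if "a \<in> V" for a by (rule so[OF that])
  qed (fact wV sw rV cD srho ab)+
  \<comment> \<open>Colours are directed, so invariance is also needed with the arguments
    exchanged.\<close>
  have inv2: "col (c b) a = col b a" if ab: "a \<in> V" "b \<in> V" "b \<notin> orb D a" for a b
  proof (rule shift_invariance[where P = P and U = D and X = V and s = s and ?v1.0 = w and ?v2.0 = \<rho>
        and col = "\<lambda>a b. col b a"])
    show "prime p" "reg p V P" "perm_grp D" "D \<subseteq> P" "card V = p * card D" by (fact prime_p P D_grp D_sub idx)+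
    show "col (f b) (f a) = col b a" if "f \<in> P" "a \<in> V" "b \<in> V" for f a b
      using Auts_col[OF PA[OF that(1)]] that VX by blast
    show "col (s b) (s a) = col b a" if "a \<in> V" "b \<in> V" for a b
      using Auts_col[OF subsetD[OF RA sR]] that VX by blast
    show "s (u a) = u (s a)" if "u \<in> D" "a \<in> V" for u a by (rule sD[OF that])
    show "s a \<in> orb D a" if "a \<in> V" for a by (rule so[OF that])
  qed (fact wV sw rV cD srho ab)+
  have cv: "c v \<in> V" "c v \<in> X" "sim v (c v)" using regD(5)[OF P cP v] VX D_sim[OF cD v] by auto
  have "twin v (c v)" unfolding twin_def
  proof (intro ballI impI)
    fix y assume y: "y \<in> X" "\<not> sim v y"
    obtain u where u: "u \<in> V" "y \<in> orb Z u" using V_cover[OF y(1)] by blast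
    have uX: "u \<in> X" using u VX by blast
    have nu: "\<not> sim v u" using y(2) sim_trans sim_orb[OF uX u(2)] by blast
    have nu': "\<not> sim (c v) u" using nu sim_trans[OF cv(3)] by blast
    have nuv: "\<not> sim u v" "\<not> sim u (c v)" using nu nu' sim_sym' uX vX(1) cv(2) by blast+
    have nD: "v \<notin> orb D u" using nuv(1) sim_D_iff[OF u(1) v] by simp
    note o = orb_refl[OF cyc_grp]
    have "col v y = col v u" by (rule col_nsim_orb[OF vX(1) uX nu o u(2)])
    also have "\<dots> = col (c v) u" using inv2[OF u(1) v nD] by simp
    also have "\<dots> = col (c v) y" by (rule col_nsim_orb[OF cv(2) uX nu' o u(2), symmetric])
    finally have 1: "col v y = col (c v) y" .
    have "col y v = col u v" by (rule col_nsim_orb[OF uX vX(1) nuv(1) u(2) o])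
    also have "\<dots> = col u (c v)" using inv1[OF u(1) v nD] by simp
    also have "\<dots> = col y (c v)" by (rule col_nsim_orb[OF uX cv(2) nuv(2) u(2) o, symmetric])
    finally show "col v y = col (c v) y \<and> col y v = col y (c v)" using 1 by simp
  qed
  moreover have "g' (pinv g v) = c v"
  proof -
    have "pinv g v = h w" using h(2) regD(3)[OF P hP g(1), of w] perm_grp_simps(2)[OF G g(1)] unfolding \<rho>_def by simp
    then have "g' (pinv g v) = k (g' w)" using k(2) regD(3)[OF P' g(2) k(1)] by simp
    also have "\<dots> = d \<rho>" using d(2)[OF rV sim_refl] g(3) unfolding \<rho>_def by simp
    also have "\<dots> = c v" unfolding c_def h(2) using regD(3)[OF P hP dP] perm_grp_simps(2)[OF G hP]
      by (metis comp_apply)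
    finally show ?thesis .
  qed
  ultimately show "twin v (g' (pinv g v))" by simp
qed

end

context twisted
begin

text \<open>The glued map need not preserve colours between classes here. But \<open>t\<close> makes the colours inside
  the class of \<open>w\<close> invariant under the centre of the \<open>p\<close>-group acting on it, whence the map that fixes the
  transversal \<open>V\<close> and turns \<open>z\<close> into \<open>z'\<close> preserves all colours.\<close>

lemma untwist_central:
  assumes cD: "card D = p ^ 2" and t: "t \<in> K1" "t w = w" and v0: "v0 \<in> C0" "t v0 \<noteq> v0"
  shows "\<exists>a\<in>Auts X col. a \<circ> z = z' \<circ> a"
proof -
  define K where "K = {h \<in> S. \<forall>v\<in>C0. v = h v}"
  have e1: "v = v" if "v \<in> C0" for v :: 'a ..
  have e2: "u = v" if "v \<in> C0" "u \<in> C0" "v = u" for v u :: 'a using that by simp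
  have e3: "v = x" if "v \<in> C0" "u \<in> C0" "x \<in> C0" "v = u" "u = x" for v u x :: 'a using that by simp
  have e4: "h v = h u" if "h \<in> S" "v \<in> C0" "u \<in> C0" "v = u" for h v u using that by simp
  have KG: "perm_grp K" unfolding K_def
    by (rule rel_kernel(1)[where R = S and X = C0 and e = "(=)"]) (fact S_grp finS S_C0 e1 e2 e3 e4)+
  have Kn: "h \<circ> f \<circ> pinv h \<in> K" if "h \<in> S" "f \<in> K" for h f unfolding K_def
    by (rule rel_kernel(2)[where R = S and X = C0 and e = "(=)"])
      (fact S_grp finS S_C0 e1 e2 e3 e4 that(1) that(2)[unfolded K_def])+
  have Sn: "h \<circ> f \<circ> pinv h \<in> S" if "h \<in> S" "f \<in> S" for h f
    using perm_grp_comp[OF S_grp perm_grp_comp[OF S_grp that] perm_grp_inv[OF S_grp that(1)]] .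
  have KS: "K \<subseteq> S" by (auto simp: K_def)
  have p1: "p > 1" by (rule prime_gt_1_nat[OF prime_p])
  have KneS: "K \<noteq> S"
  proof
    assume "K = S"
    then have "D \<subseteq> {id}" using D_S w_C0 regD(7)[OF reg_C0 _ w_C0] unfolding K_def by force
    then have "card D \<le> 1" using card_mono[of "{id}" D] by simp
    moreover have "p ^ 0 < p ^ 2" using p1 by (intro power_strict_increasing) auto
    ultimately show False using cD by simp
  qed
  obtain l where l: "card S = p ^ l" by (rule card_S)
  have SS: "S \<subseteq> S" ..
  \<comment> \<open>An element central modulo the kernel of \<open>S\<close> on \<open>C0\<close>
    acts there as an element \<open>z1\<close> of the regular abelian group
    \<open>D\<close>.\<close>
  have "\<exists>f\<in>S. f \<notin> K \<and> (\<forall>h\<in>S. \<exists>e\<in>K. h \<circ> f = e \<circ> f \<circ> h)"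
    by (rule central_mod[where R = S and N = S and K = K]) (fact S_grp finS l prime_p SS Sn KG KS KneS Kn | blast)+
  then obtain f where f: "f \<in> S" "f \<notin> K" "\<And>h. h \<in> S \<Longrightarrow> \<exists>e\<in>K. h \<circ> f = e \<circ> f \<circ> h" by blast
  have hf: "h (f v) = f (h v)" if h: "h \<in> S" and v: "v \<in> C0" for h v
  proof -
    obtain e where e: "e \<in> K" "h \<circ> f = e \<circ> f \<circ> h" using f(3)[OF h] by blast
    have "f (h v) \<in> C0" using S_C0 f(1) h v by blast
    then have "f (h v) = e (f (h v))" using e(1) unfolding K_def by blast
    then show ?thesis using fun_cong[OF e(2), of v] by simp
  qed
  have fD: "f (d v) = d (f v)" if "d \<in> D" "v \<in> C0" for d v using hf[OF subsetD[OF D_S that(1)] that(2)] by simp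
  have "\<exists>g\<in>D. \<forall>x\<in>C0. f x = g x"
    by (rule reg_central[where P = D and X = C0 and n = f and w = w])
      (fact reg_C0 w_C0 S_C0[OF f(1) w_C0] fD | blast)+
  then obtain z1 where z1: "z1 \<in> D" "\<And>v. v \<in> C0 \<Longrightarrow> f v = z1 v" by blast
  have z1ne: "z1 \<noteq> id" using f(1,2) z1(2) by (auto simp: K_def)
  have z1p: "z1 ^^ p = id" by (rule regD(4)[OF reg_C0 z1(1)])
  note z1G = perm_grp_cyc[OF z1p p_pos]
  have z1D: "cyc z1 \<subseteq> D" by (rule perm_grp_cyc_sub[OF D_grp z1(1)])
  have c1: "card (cyc z1) = p" by (rule card_cyc_prime(1)[OF prime_p z1p z1ne])
  have z1C: "(z1 ^^ j) v \<in> C0" if "v \<in> C0" for j v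
    using regD(5)[OF reg_C0 perm_grp_pow[OF D_grp z1(1)] that] .
  have hz1: "h ((z1 ^^ j) v) = (z1 ^^ j) (h v)" if h: "h \<in> S" and v: "v \<in> C0" for h j v
  proof (induction j)
    case (Suc j)
    have "h (z1 ((z1 ^^ j) v)) = z1 (h ((z1 ^^ j) v))"
      using hf[OF h z1C[OF v]] z1(2) z1C[OF v] S_C0[OF h z1C[OF v]] by simp
    then show ?case using Suc by simp
  qed simp
  have idx: "card C0 = p * card (cyc z1)" using card_C0 cD c1 by (simp add: power2_eq_square)
  \<comment> \<open>The \<open>p\<close> orbits of \<open>z1\<close> on \<open>C0\<close> are blocks
    for \<open>S\<close>, as \<open>z1\<close> is central there.\<close>
  have bf: "h v \<in> orb (cyc z1) v" if h: "h \<in> S" "h w = w" "v \<in> C0" for h v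
  proof (rule C0_block_fix[OF z1G z1D _ _ h])
    show "card C0 \<le> p * card (cyc z1)" using idx by simp
    show "h (k v) \<in> orb (cyc z1) (h v)" if hk: "h \<in> S" "k \<in> cyc z1" "v \<in> C0" for h k v
    proof -
      obtain j where "k = z1 ^^ j" using hk(2) by (auto simp: cyc_def)
      then show ?thesis using hz1[OF hk(1,3)] by (auto simp: orb_cyc_iff)
    qed
  qed
  have tS: "t \<in> S" and tz: "\<And>x. x \<in> X \<Longrightarrow> sim w x \<Longrightarrow> t (z x) = z (t x)" using t(1) by (auto simp: K1_def)
  have CX: "v \<in> X" if "v \<in> C0" for v using C0_V[OF that] VX by blast
  have zC: "(z ^^ k) v \<in> X" "sim w ((z ^^ k) v)" if "v \<in> C0" for k v
    using pow_in CX[OF that] sim_trans[OF C0_sim[OF that] sim_pow[OF CX[OF that]]] by auto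
  have tzk: "t ((z ^^ k) v) = (z ^^ k) (t v)" if v: "v \<in> C0" for k v
  proof (induction k)
    case (Suc k)
    then show ?case using tz[OF zC[OF v]] by simp
  qed simp
  define col2 where "col2 a b = (\<lambda>k. col a ((z ^^ k) b))" for a b
  have c2: "col2 (h a) (h b) = col2 a b"
    if h: "h \<in> Auts X col" "\<And>k. h ((z ^^ k) b) = (z ^^ k) (h b)" and ab: "a \<in> C0" "b \<in> C0" for h a b
  proof
    fix k
    have "col (h a) (h ((z ^^ k) b)) = col a ((z ^^ k) b)" by (rule Auts_col[OF h(1) CX[OF ab(1)] zC(1)[OF ab(2)]])
    then show "col2 (h a) (h b) k = col2 a b k" using h(2) by (simp add: col2_def)
  qed
  have SA: "h \<in> Auts X col" if "h \<in> S" for h using that S_sub RA by blast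
  obtain m where m: "t v0 = (z1 ^^ m) v0" using bf[OF tS t(2) v0(1)] by (auto simp: orb_cyc_iff)
  have mp: "\<not> p dvd m"
  proof
    assume "p dvd m"
    then obtain c where "m = p * c" by (elim dvdE)
    then have "z1 ^^ m = id" using pow_mod_period(1)[OF z1p] by simp
    then show False using m v0(2) by simp
  qed
  have sh: "col2 a ((z1 ^^ m) b) = col2 a b" if ab: "a \<in> C0" "b \<in> C0" "b \<notin> orb (cyc z1) a" for a b
  proof (rule shift_invariance[where P = D and U = "cyc z1" and X = C0 and s = t and ?v1.0 = w and ?v2.0 = v0])
    show "prime p" "reg p C0 D" "perm_grp (cyc z1)" "cyc z1 \<subseteq> D" "card C0 = p * card (cyc z1)"
      by (fact prime_p reg_C0 z1G z1D idx)+
    show "col2 (h a) (h b) = col2 a b" if h: "h \<in> D" and ab: "a \<in> C0" "b \<in> C0" for h a b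
    proof (rule c2[OF SA[OF subsetD[OF D_S h]] _ ab])
      show "h ((z ^^ k) b) = (z ^^ k) (h b)" for k by (rule comm_pow[OF P_comm]) (use h D_sub in blast)
    qed
    show "col2 (t a) (t b) = col2 a b" if "a \<in> C0" "b \<in> C0" for a b by (rule c2[OF SA[OF tS] tzk[OF that(2)] that])
    show "t (u a) = u (t a)" if u: "u \<in> cyc z1" "a \<in> C0" for u a
    proof -
      obtain j where "u = z1 ^^ j" using u(1) by (auto simp: cyc_def)
      then show ?thesis using hz1[OF tS u(2)] by simp
    qed
    show "t a \<in> orb (cyc z1) a" if "a \<in> C0" for a by (rule bf[OF tS t(2) that])
  qed (fact w_C0 t(2) v0(1) cyc_self(1) m ab)+
  obtain k where k: "(z1 ^^ m) ^^ k = z1" using pow_generates[OF prime_p z1p mp] .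
  \<comment> \<open>\<open>t\<close> fixes \<open>w\<close> and acts at \<open>v0\<close> as
    \<open>z1 ^^ m\<close> with \<open>m\<close> prime to \<open>p\<close>. Invariance under this
    power gives invariance under all powers of \<open>z1\<close>.\<close>
  have inv: "col2 a ((z1 ^^ j) b) = col2 a b" if ab: "a \<in> C0" "b \<in> C0" "b \<notin> orb (cyc z1) a" for a b j
  proof -
    have "col2 a (((z1 ^^ m) ^^ i) b) = col2 a b" for i
    proof (induction i)
      case (Suc i)
      let ?b = "((z1 ^^ m) ^^ i) b"
      have e: "?b = (z1 ^^ (m * i)) b" by (simp add: funpow_mult)
      have "?b \<in> C0" unfolding e by (rule z1C[OF ab(2)])
      moreover have "?b \<notin> orb (cyc z1) a" unfolding e using orb_moved[OF z1G cyc_self(1)] ab(3) by simp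
      ultimately have "col2 a ((z1 ^^ m) ?b) = col2 a ?b" by (rule sh[OF ab(1)])
      then show ?case using Suc by simp
    qed simp
    from this[of "k * j"] show ?thesis using k by (metis funpow_mult)
  qed
  \<comment> \<open>Pull both sides back to the class of \<open>w\<close>, the left one by
    \<open>g'\<close>, which commutes with \<open>z'\<close>, the right one by \<open>g\<close>,
    which commutes with \<open>z\<close>. There the cycles agree, and the results differ by
    \<open>pinv g \<circ> g'\<close>, which fixes \<open>w\<close> and moves points only within
    orbits of \<open>z1\<close>.\<close>
  have same: "col ((z' ^^ i) v) ((z' ^^ j) u) = col ((z ^^ i) v) ((z ^^ j) u)"
    if v: "v \<in> V" "u \<in> V" "sim v u" for v u i j
  proof -
    obtain g where g: "g \<in> P" "v = g w" using regD(6)[OF P wV v(1)] by blast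
    obtain g' where g': "g' \<in> P'" "v = g' w" using regD(6)[OF P' wV v(1)] by blast
    have gR: "g \<in> R" "g' \<in> R" using g g' PR P'R by auto
    note gs = perm_grp_simps[OF R(1) gR(1)] and g's = perm_grp_simps[OF R(1) gR(2)]
    have uX: "u \<in> X" "v \<in> X" using v VX by auto
    have su: "sim u (g w)" using sim_sym[OF uX(2,1) v(3)] g(2) by simp
    have gg: "g w = g' w" using g(2) g'(2) by simp
    note cs = class_shift[OF g(1) gR(2) gg v(2) su]
    have iR: "pinv g' \<in> R" by (rule perm_grp_inv[OF R(1) gR(2)])
    have "sim (pinv g' v) (pinv g' u)" by (rule R_sim[OF iR v(3)])
    then have "sim w (pinv g' u)" using g'(2) g's by simp
    then have uC: "pinv g' u \<in> C0" using RV[OF iR v(2)] by (simp add: C0_def)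
    have "col ((z' ^^ i) v) ((z' ^^ j) u) = col (g' ((z' ^^ i) w)) (g' ((z' ^^ j) (pinv g' u)))"
      using comm_pow[OF P'_comm[OF g'(1)]] g'(2) g's(1) by simp
    also have "\<dots> = col ((z ^^ i) w) ((z ^^ j) (pinv g' u))"
      unfolding z'_pow_class[OF C0_sim[OF w_C0]] z'_pow_class[OF C0_sim[OF uC]]
      by (rule Auts_col[OF subsetD[OF RA gR(2)] zC(1)[OF w_C0] zC(1)[OF uC]])
    also have "\<dots> = col2 w (pinv g' u) (j + (r - 1) * i)"
      unfolding col2_def by (rule col_pow[OF wX CX[OF uC]])
    finally have 1: "col ((z' ^^ i) v) ((z' ^^ j) u) = col2 w (pinv g' u) (j + (r - 1) * i)" .
    have "col ((z ^^ i) v) ((z ^^ j) u) = col (g ((z ^^ i) w)) (g ((z ^^ j) (pinv g u)))"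
      using comm_pow[OF P_comm[OF g(1)]] g(2) gs(1) by simp
    also have "\<dots> = col ((z ^^ i) w) ((z ^^ j) (pinv g u))"
      by (rule Auts_col[OF subsetD[OF RA gR(1)] zC(1)[OF w_C0] zC(1)[OF cs(3)]])
    also have "\<dots> = col2 w (pinv g u) (j + (r - 1) * i)"
      unfolding col2_def by (rule col_pow[OF wX CX[OF cs(3)]])
    finally have 2: "col ((z ^^ i) v) ((z ^^ j) u) = col2 w (pinv g u) (j + (r - 1) * i)" .
    let ?h = "pinv g \<circ> g'"
    have hu: "?h (pinv g' u) = pinv g u" using g's(1) by simp
    have "col2 w (pinv g u) = col2 w (pinv g' u)"
    proof (cases "pinv g' u \<in> orb (cyc z1) w")
      case True
      then obtain j where j: "pinv g' u = (z1 ^^ j) w" by (auto simp: orb_cyc_iff)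
      have "?h (pinv g' u) = pinv g' u" unfolding j using hz1[OF cs(1) w_C0] cs(2) by simp
      then show ?thesis using hu by simp
    next
      case False
      obtain j where "?h (pinv g' u) = (z1 ^^ j) (pinv g' u)" using bf[OF cs(1,2) uC] by (auto simp: orb_cyc_iff)
      then show ?thesis using inv[OF w_C0 uC False, of j] hu by simp
    qed
    then show ?thesis using 1 2 by simp
  qed
  have idV: "id permutes V" by (rule permutes_id)
  obtain a where a: "a permutes X" "\<And>v k. v \<in> V \<Longrightarrow> a ((z ^^ k) v) = (z' ^^ k) (id v)"
    using transversal_ext[OF VX V_cover V_unique z'E z'_free idV] by blast
  have xrep: "\<exists>v\<in>V. \<exists>k. x = (z ^^ k) v" if "x \<in> X" for x using V_cover[OF that] by (auto simp: orb_cyc_iff)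
  have z'o: "(z' ^^ k) v \<in> orb Z v" if "v \<in> V" for v k
    using E_orb[OF perm_grp_pow[OF E_grp z'E]] that VX by blast
  have "col (a x) (a y) = col x y" if xy: "x \<in> X" "y \<in> X" for x y
  proof -
    obtain v i where v: "v \<in> V" "x = (z ^^ i) v" using xrep xy(1) by blast
    obtain u j where u: "u \<in> V" "y = (z ^^ j) u" using xrep xy(2) by blast
    have vu: "v \<in> X" "u \<in> X" using u v VX by auto
    have e: "a x = (z' ^^ i) v" "a y = (z' ^^ j) u" using a(2) u v by simp_all
    show ?thesis
    proof (cases "sim v u")
      case True
      then show ?thesis using same[OF v(1) u(1) True] v u e by simp
    next
      case False
      have "col (a x) (a y) = col v u" unfolding e by (rule col_nsim_orb[OF vu False z'o[OF v(1)] z'o[OF u(1)]])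
      moreover have "col x y = col v u" by (rule col_nsim_orb[OF vu False]) (use v u in \<open>auto simp: orb_cyc_iff\<close>)
      ultimately show ?thesis by simp
    qed
  qed
  then have aA: "a \<in> Auts X col" using a(1) by (simp add: Auts_def)
  have "a (z x) = z' (a x)" for x
  proof (cases "x \<in> X")
    case True
    then obtain v k where v: "v \<in> V" "x = (z ^^ k) v" using xrep by blast
    then show ?thesis using a(2)[OF v(1), of k] a(2)[OF v(1), of "Suc k"] by simp
  next
    case False
    then show ?thesis using permutes_not_in[OF a(1)] permutes_not_in[OF Auts_permutes[OF z_aut]]
        permutes_not_in[OF Auts_permutes[OF E_aut[OF z'E]]] by simp
  qed
  then show ?thesis using aA by (auto simp: fun_eq_iff)
qed

lemma untwist_all: "\<exists>a\<in>Auts X col. a \<circ> z = z' \<circ> a"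
proof -
  obtain m where m: "m \<le> 3" "card D = p ^ m" by (rule card_D)
  consider "m \<le> 1" | "m = 2" | "m = 3" using m(1) by linarith
  then show ?thesis
  proof cases
    case 1
    then have "p ^ m \<le> p ^ 1" using p_pos by (intro power_increasing) auto
    then show ?thesis using untwist_trivial m(2) by simp
  next
    case 2
    then have cD: "card D = p ^ 2" using m(2) by simp
    then have idx: "card V = p * card D" using cardV by (simp add: power_numeral_reduce)
    show ?thesis
    proof (cases "\<exists>t\<in>K1. t w = w \<and> (\<exists>v\<in>C0. t v \<noteq> v)")
      case True
      then show ?thesis using untwist_central[OF cD] by blast
    next
      case False
      then show ?thesis using untwist_regular[OF idx] by blast
    qed
  next
    case 3
    have "D = P" by (rule card_subset_eq[OF card_P(2) D_sub]) (use m(2) 3 card_P(1) in simp)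
    then show ?thesis by (rule untwist_full)
  qed
qed

end

text \<open>In a Sylow \<open>q\<close>-subgroup \<open>Y\<close> containing \<open>z\<close> and
  the conjugate \<open>t\<close> of \<open>z'\<close>, orbits have size a power of \<open>q\<close>
  below \<open>q ^ 2\<close>. They are therefore the orbits of \<open>z\<close>, and on
  \<open>q\<close> points \<open>t\<close> can only act as a power of \<open>z\<close>.\<close>

lemma align_cycles:
  assumes X: "finite X" "X \<noteq> {}" and q: "prime q" "card X < q * q"
    and z: "z \<in> Auts X col" "z ^^ q = id" "\<And>x. x \<in> X \<Longrightarrow> z x \<noteq> x"
    and z': "z' \<in> Auts X col" "z' ^^ q = id" "\<And>x. x \<in> X \<Longrightarrow> z' x \<noteq> x"
  shows "\<exists>g\<in>Auts X col. g \<circ> z' \<circ> pinv g \<in> blockE X col z"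
proof -
  interpret z: block_perm X col z q by unfold_locales (use X q z in auto)
  interpret z': block_perm X col z' q by unfold_locales (use X q z' in auto)
  obtain x0 where x0: "x0 \<in> X" using X(2) by blast
  have cz: "card (cyc z) = q ^ 1" "card (cyc z') = q ^ 1" using z.card_cyc(1)[OF x0] z'.card_cyc(1)[OF x0] by simp_all
  have sub: "cyc z \<subseteq> Auts X col" "cyc z' \<subseteq> Auts X col"
    using perm_grp_cyc_sub[OF perm_grp_Auts] z(1) z'(1) by auto
  obtain g Y n where g: "g \<in> Auts X col" and Y: "perm_grp Y" "Y \<subseteq> Auts X col" "card Y = q ^ n" "cyc z \<subseteq> Y"
    and gY: "\<And>f. f \<in> cyc z' \<Longrightarrow> g \<circ> f \<circ> pinv g \<in> Y"
    using sylow_conj[OF perm_grp_Auts finite_Auts[OF X(1)] q(1) z.cyc_grp sub(1) cz(1) z'.cyc_grp sub(2) cz(2)]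
    by blast
  define t where "t = g \<circ> z' \<circ> pinv g"
  have tY: "t \<in> Y" unfolding t_def by (rule gY[OF cyc_self(2)])
  have finY: "finite Y" by (rule finite_subset[OF Y(2) finite_Auts[OF X(1)]])
  have YX: "h x \<in> X" if "h \<in> Y" "x \<in> X" for h x using Auts_in[OF subsetD[OF Y(2) that(1)]] that(2) by simp
  interpret finite_action Y "\<lambda>h x. h x" X by unfold_locales (use Y(1) finY X(1) YX in auto)
  have orbY: "orb Y v = orb (cyc z) v" if v: "v \<in> X" for v
  proof -
    have "card (orb Y v) dvd q ^ n" using card_orbit_dvd[OF v] Y(3) by (simp add: orb_def)
    then obtain k where k: "card (orb Y v) = q ^ k" using divides_primepow_nat[OF q(1)] by blast
    have sX: "orb Y v \<subseteq> X" using YX v by (auto simp: orb_def)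
    have "q ^ k \<le> card X" using card_mono[OF X(1) sX] k by simp
    then have "q ^ k < q ^ 2" using q(2) by (simp add: power2_eq_square)
    then have "k < 2" using power_less_imp_less_exp[OF prime_gt_1_nat[OF q(1)]] by blast
    then have "q ^ k \<le> q ^ 1" using prime_gt_0_nat[OF q(1)] by (intro power_increasing) auto
    moreover have "card (orb (cyc z) v) = q"
      using card_orb_free[OF _ z.cyc_grp, of v] z.cyc_free[OF _ v] cz(1) by simp
    moreover have so: "orb (cyc z) v \<subseteq> orb Y v" using Y(4) by (auto simp: orb_def)
    moreover have "finite (orb Y v)" by (rule finite_subset[OF sX X(1)])
    ultimately have "orb (cyc z) v = orb Y v" using k by (intro card_seteq) auto
    then show ?thesis ..
  qed
  have tA: "t \<in> Auts X col" using tY Y(2) by blast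
  have one: "perm_grp {id}" by (rule perm_grpI) auto
  have "t (z v) = z (t v)" if v: "v \<in> X" for v
  proof -
    have "t v \<in> orb (cyc z) v" using orbI[OF tY] orbY[OF v] by blast
    then obtain c where c: "t v = (z ^^ c) v" by (auto simp: orb_cyc_iff)
    have zc: "z ^^ c \<in> Y" using Y(4) cyc_self(1) by blast
    note zs = perm_grp_simps[OF Y(1) zc]
    \<comment> \<open>\<open>s\<close> belongs to a \<open>q\<close>-group and fixes one of the
      \<open>q\<close> points of the orbit, so it fixes \<open>z v\<close> as well.\<close>
    define s where "s = pinv (z ^^ c) \<circ> t"
    have sY: "s \<in> Y" unfolding s_def by (rule perm_grp_comp[OF Y(1) perm_grp_inv[OF Y(1) zc] tY])
    have oX: "orb Y v \<subseteq> X" using YX v by (auto simp: orb_def)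
    have "s (z v) \<in> orb {id} (z v)"
    proof (rule block_fix[where R = Y and X = "orb Y v" and w = v and p = q])
      show "perm_grp Y" "finite Y" "card Y = q ^ n" "prime q" "perm_grp {id}" by (fact Y(1) finY Y(3) q(1) one)+
      show "finite (orb Y v)" by (rule finite_subset[OF oX X(1)])
      show "card (orb Y v) \<le> q * card {id :: 'a \<Rightarrow> 'a}"
        using card_orb_free[OF _ z.cyc_grp, of v] z.cyc_free[OF _ v] cz(1) orbY[OF v] by simp
      show "h x \<in> orb Y v" if "h \<in> Y" "x \<in> orb Y v" for h x using orb_moved[OF Y(1) that(1)] that(2) by simp
      show "s \<in> Y" by (rule sY)
      show "v \<in> orb Y v" by (rule orb_refl[OF Y(1)])
      show "s v \<in> orb {id} v" using c zs by (simp add: s_def orb_def)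
      show "z v \<in> orb Y v" by (rule orbI[of z]) (use Y(4) cyc_self(2) in auto)
    qed (auto simp: orb_def)
    then have "s (z v) = z v" by (simp add: orb_def)
    then have "t (z v) = (z ^^ c) (z v)" using zs(1)[of "t (z v)"] unfolding s_def by simp
    also have "\<dots> = z (t v)" unfolding c by (simp add: funpow_swap1)
    finally show ?thesis .
  qed
  moreover have "t (z v) = z (t v)" if "v \<notin> X" for v
    using permutes_not_in[OF Auts_permutes[OF tA] that] permutes_not_in[OF Auts_permutes[OF z(1)] that] by simp
  ultimately have "t \<circ> z = z \<circ> t" by (auto simp: fun_eq_iff)
  moreover have "t v \<in> orb (cyc z) v" if "v \<in> X" for v using orbI[OF tY] orbY[OF that] by blast
  ultimately have "t \<in> blockE X col z" using tA by (simp add: blockE_def)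
  then show ?thesis using g unfolding t_def by blast
qed

lemma pq_reg_change_cycle:
  assumes "pq_reg p q X P z" "t ^^ q = id" "\<And>x. x \<in> X \<Longrightarrow> t x \<noteq> x" "\<And>f. f \<in> P \<Longrightarrow> f \<circ> t = t \<circ> f"
    "\<And>x. x \<in> X \<Longrightarrow> orb (cyc t) x = orb (cyc z) x" "\<And>f x. f \<in> P \<Longrightarrow> x \<in> X \<Longrightarrow> f x \<in> X"
  shows "pq_reg p q X P t"
  using assms unfolding pq_reg_def by simp

text \<open>The conjugate of \<open>z'\<close> is only placed among the powers of \<open>z\<close>,
  because a power of the second cycle is used to normalise it at a base point. This is enough, as
  the generated groups still coincide.\<close>

lemma conj_pq:
  assumes X: "finite X" "X \<noteq> {}" and p: "prime p" and q: "prime q" "card X < q * q" "p \<noteq> q"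
    and P: "pq_reg p q X P z" "P \<subseteq> Auts X col" "z \<in> Auts X col"
    and P': "pq_reg p q X P' z'" "P' \<subseteq> Auts X col" "z' \<in> Auts X col"
  shows "\<exists>a\<in>Auts X col. conj_by a P' = P \<and> a \<circ> z' \<circ> pinv a \<in> cyc z"
proof -
  let ?A = "Auts X col"
  note AA = perm_grp_Auts[of X col]
  note D = pq_regD[OF P(1)] and D' = pq_regD[OF P'(1)]
  have npq: "\<not> p dvd q" using primes_dvd_imp_eq[OF p q(1)] q(3) by blast
  obtain g1 where g1: "g1 \<in> ?A" "g1 \<circ> z' \<circ> pinv g1 \<in> blockE X col z"
    using align_cycles[OF X q(1,2) P(3) D(6,7) P'(3) D'(6,7)] by blast
  define z1 where "z1 = g1 \<circ> z' \<circ> pinv g1"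
  define P1 where "P1 = conj_by g1 P'"
  have P1: "pq_reg p q X P1 z1" unfolding P1_def z1_def by (rule pq_reg_conj[OF P'(1) Auts_permutes[OF g1(1)]])
  note D1 = pq_regD[OF P1]
  interpret block_perm X col z q by unfold_locales (use X q P(3) D(6,7) in auto)
  have z1E: "z1 \<in> E" unfolding z1_def by (rule g1(2))
  have conjA: "a \<circ> f \<circ> pinv a \<in> ?A" if "a \<in> ?A" "f \<in> ?A" for a f
    by (rule perm_grp_comp[OF AA perm_grp_comp[OF AA that] perm_grp_inv[OF AA that(1)]])
  have P1A: "P1 \<subseteq> ?A" unfolding P1_def using conjA[OF g1(1)] P'(2) by blast
  interpret z1: block_perm X col z1 q by (rule block_perm_E(1)[OF z1E D1(7)])
  have E1: "blockE X col z1 = E" by (rule blockE_eq[OF z1E D1(7)])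
  \<comment> \<open>Both cycles define the same \<open>E\<close>, so \<open>P1\<close>, which
    centralises \<open>z1\<close>, lies in the same normaliser as \<open>P\<close>, and Sylow's
    theorem applies there.\<close>
  have N1: "z1.N = N" unfolding z1.N_def N_def E1 ..
  have PN: "P \<subseteq> N" using comm_N D(5) P(2) by blast
  have P1N: "P1 \<subseteq> N" using z1.comm_N D1(5) P1A unfolding N1 by blast
  have finN: "finite N" by (rule finite_subset[OF _ finite_Auts[OF X(1)]]) (auto simp: N_def)
  obtain h R n where h: "h \<in> N" and R: "perm_grp R" "R \<subseteq> N" "card R = p ^ n" and PR: "P \<subseteq> R"
    and hR: "\<And>f. f \<in> P1 \<Longrightarrow> h \<circ> f \<circ> pinv h \<in> R"
    using sylow_conj[OF N_grp finN p D(1) PN D(4) D1(1) P1N D1(4)] by blast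
  have hA: "h \<in> ?A" by (rule N_aut[OF h])
  define z2 where "z2 = h \<circ> z1 \<circ> pinv h"
  define P2 where "P2 = conj_by h P1"
  have P2: "pq_reg p q X P2 z2" unfolding P2_def z2_def by (rule pq_reg_conj[OF P1 Auts_permutes[OF hA]])
  note D2 = pq_regD[OF P2]
  have P2R: "P2 \<subseteq> R" unfolding P2_def using hR by blast
  have RA: "R \<subseteq> ?A" using R(2) N_aut by blast
  have z2E: "z2 \<in> E" unfolding z2_def using h z1E by (simp add: N_def)
  obtain V where V: "V \<subseteq> X" "V \<noteq> {}" "\<And>x. x \<in> X \<Longrightarrow> \<exists>v\<in>V. x \<in> orb (cyc z) v"
    "\<And>u v. u \<in> V \<Longrightarrow> v \<in> V \<Longrightarrow> u \<in> orb (cyc z) v \<Longrightarrow> u = v" "\<And>f v. f \<in> R \<Longrightarrow> v \<in> V \<Longrightarrow> f v \<in> V"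
    using ex_transversal[OF X(2) R p npq PR D(9)] by blast
  have zE: "z \<in> E" using pow_E[of 1] by simp
  have rP: "reg p V P" by (rule pq_reg_transversal[OF V(1) V(4) _ P(1) zE]) (use V(5) PR in blast)+
  have rP2: "reg p V P2" by (rule pq_reg_transversal[OF V(1) V(4) _ P2 z2E]) (use V(5) P2R in blast)+
  obtain w where w: "w \<in> V" using V(2) by blast
  have wX: "w \<in> X" using w V(1) by blast
  have cV: "card V = p ^ 3" using card_reg(1)[OF rP w] D(4) by simp
  interpret z2: block_perm X col z2 q by (rule block_perm_E(1)[OF z2E D2(7)])
  \<comment> \<open>The power \<open>z3\<close> of \<open>z2\<close> is chosen to agree with
    \<open>z\<close> at \<open>w\<close>, as \<open>twisted\<close> requires; \<open>z2\<close> is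
    recovered as \<open>z3 ^^ l\<close>.\<close>
  obtain k where k: "z w = (z2 ^^ k) w" using block_perm_E(2)[OF z2E D2(7) wX] by (auto simp: orb_cyc_iff)
  define z3 where "z3 = z2 ^^ k"
  have z3E: "z3 \<in> E" unfolding z3_def by (rule perm_grp_pow[OF E_grp z2E])
  have z3ne: "z3 \<noteq> id" using k z_free[OF wX] unfolding z3_def by auto
  have z3f: "z3 x \<noteq> x" if "x \<in> X" for x
    using z2.pow_fixD(2)[OF that] z3ne unfolding z3_def by blast
  have kq: "\<not> q dvd k"
  proof
    assume "q dvd k"
    then obtain c where "k = q * c" by (elim dvdE)
    then show False using z3ne pow_mod_period(1)[OF D2(6)] unfolding z3_def by simp
  qed
  obtain l where l: "z3 ^^ l = z2" using pow_generates[OF q(1) D2(6) kq] unfolding z3_def .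
  have P2z3: "f \<circ> z3 = z3 \<circ> f" if "f \<in> P2" for f
    unfolding z3_def using comm_pow[OF D2(5)[OF that]] by (auto simp: fun_eq_iff)
  have z3p: "z3 ^^ q = id" using block_perm.z_pow[OF block_perm_E(1)[OF z3E z3f]] .
  have P2': "pq_reg p q X P2 z3"
  proof (rule pq_reg_change_cycle[OF P2 z3p z3f P2z3])
    show "orb (cyc z3) x = orb (cyc z2) x" if "x \<in> X" for x
      using orb_E_eq[OF z3E z3f that] orb_E_eq[OF z2E D2(7) that] by simp
    show "f x \<in> X" if "f \<in> P2" "x \<in> X" for f x using Auts_in[of f X col x] P2R RA that by blast
  qed
  interpret twisted X col z q p V P R w n P2 z3
    by unfold_locales (use p V w rP cV R PR D(5) rP2 P2R P2z3 z3E z3f k in \<open>auto simp: z3_def\<close>)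
  obtain a where a: "a \<in> ?A" "a \<circ> z = z3 \<circ> a" using untwist_all by blast
  note ba = perm_grp_bij[OF AA a(1)]
  have ia: "pinv a \<in> ?A" by (rule perm_grp_inv[OF AA a(1)])
  note bia = perm_grp_bij[OF AA ia]
  have iia: "pinv (pinv a) = a" by (rule inv_inv_eq[OF ba])
  have az: "pinv a \<circ> z3 \<circ> pinv (pinv a) = z"
  proof
    fix x show "(pinv a \<circ> z3 \<circ> pinv (pinv a)) x = z x"
      unfolding iia using fun_cong[OF a(2), of x] pinv_simps(2)[OF ba, of "z x"] by simp
  qed
  define P3 where "P3 = conj_by (pinv a) P2"
  have P3: "pq_reg p q X P3 z" using pq_reg_conj[OF P2' Auts_permutes[OF ia]] unfolding az P3_def .
  have P3A: "P3 \<subseteq> ?A" unfolding P3_def using conjA[OF ia] P2R RA by blast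
  obtain b where b: "b \<in> ?A" "b \<circ> z = z \<circ> b" "conj_by b P3 = P"
    using conj_same_cycle[OF X(2) p npq assms(7,8) P3 P3A] by blast
  note bb = perm_grp_bij[OF AA b(1)] and bh = perm_grp_bij[OF AA hA] and bg = perm_grp_bij[OF AA g1(1)]
  define c where "c = b \<circ> (pinv a \<circ> (h \<circ> g1))"
  have hg: "h \<circ> g1 \<in> ?A" "pinv a \<circ> (h \<circ> g1) \<in> ?A" "c \<in> ?A"
    unfolding c_def using perm_grp_comp[OF AA] hA g1(1) ia b(1) by blast+
  note bhg = perm_grp_bij[OF AA hg(1)] perm_grp_bij[OF AA hg(2)]
  have "conj_by c P' = P"
    using conj_conj[OF bb bhg(2), of P'] conj_conj[OF bia bhg(1), of P'] conj_conj[OF bh bg, of P'] b(3)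
    unfolding c_def P3_def P2_def P1_def by simp
  moreover have "c \<circ> z' \<circ> pinv c = z ^^ l"
  proof -
    have "c \<circ> z' \<circ> pinv c = b \<circ> (pinv a \<circ> z2 \<circ> pinv (pinv a)) \<circ> pinv b"
      unfolding c_def z2_def z1_def pinv_comp[OF bb bhg(2)] pinv_comp[OF bia bhg(1)] pinv_comp[OF bh bg]
      by (simp add: comp_assoc)
    also have "pinv a \<circ> z2 \<circ> pinv (pinv a) = z ^^ l"
      using conj_pow[OF bia, where f = z3 and n = l] unfolding az l ..
    also have "b \<circ> z ^^ l \<circ> pinv b = z ^^ l"
      using comm_pow[OF b(2)] pinv_simps[OF bb] by (simp add: fun_eq_iff)
    finally show ?thesis .
  qed
  ultimately show ?thesis using hg(3) cyc_self(1) by metis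
qed

subsection \<open>From regular subgroups to group automorphisms\<close>

definition trl :: "('a, 'b) monoid_scheme \<Rightarrow> 'a \<Rightarrow> 'a \<Rightarrow> 'a" where
  "trl G g = (\<lambda>x. if x \<in> carrier G then g \<otimes>\<^bsub>G\<^esub> x else x)"

context comm_group
begin

lemma trl_comp:
  assumes "g \<in> carrier G" "h \<in> carrier G"
  shows "trl G g \<circ> trl G h = trl G (g \<otimes> h)"
  using assms by (auto simp: trl_def fun_eq_iff m_assoc)

lemma trl_one: "trl G \<one> = id"
  by (auto simp: trl_def fun_eq_iff)

lemma trl_inv:
  assumes "g \<in> carrier G"
  shows "trl G g \<circ> trl G (m_inv G g) = id" "trl G (m_inv G g) \<circ> trl G g = id"
  using assms trl_comp trl_one by simp_all

lemma trl_bij: "g \<in> carrier G \<Longrightarrow> bij (trl G g)"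
  using trl_inv o_bij by blast

lemma trl_pinv: "g \<in> carrier G \<Longrightarrow> pinv (trl G g) = trl G (m_inv G g)"
  by (rule pinv_unique[OF trl_bij trl_inv(1)])

lemma trl_pow: "g \<in> carrier G \<Longrightarrow> trl G g ^^ n = trl G (g [^] n)"
proof (induction n)
  case (Suc n)
  have "trl G g ^^ Suc n = trl G g \<circ> trl G (g [^] n)" using Suc by (simp only: funpow.simps)
  also have "\<dots> = trl G (g \<otimes> g [^] n)" using Suc.prems by (intro trl_comp) simp_all
  also have "g \<otimes> g [^] n = g [^] Suc n" using Suc.prems by (simp add: m_comm)
  finally show ?case .
qed (simp only: funpow.simps nat_pow_0 trl_one)

lemma trl_permutes: "g \<in> carrier G \<Longrightarrow> trl G g permutes carrier G"
  unfolding permutes_def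
proof (intro conjI allI impI)
  fix y assume g: "g \<in> carrier G"
  have "trl G g (trl G (m_inv G g) y) = y" using fun_cong[OF trl_inv(1)[OF g], of y] by simp
  moreover have "x = trl G (m_inv G g) y" if "trl G g x = y" for x
    using fun_cong[OF trl_inv(2)[OF g], of x] that by simp
  ultimately show "\<exists>!x. trl G g x = y" by blast
qed (simp add: trl_def)

lemma trl_eq_id: "g \<in> carrier G \<Longrightarrow> x \<in> carrier G \<Longrightarrow> trl G g x = x \<Longrightarrow> g = \<one>"
  by (simp add: trl_def)

text \<open>Left multiplication preserves \<open>a \<otimes> m_inv G b\<close> because the group is
  abelian.\<close>

lemma trl_Auts:
  assumes g: "g \<in> carrier G"
  shows "trl G g \<in> Auts (carrier G) (\<lambda>a b. a \<otimes> m_inv G b \<in> S)"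
proof -
  have "(g \<otimes> a) \<otimes> m_inv G (g \<otimes> b) = a \<otimes> m_inv G b" if "a \<in> carrier G" "b \<in> carrier G" for a b
    using g that by (simp add: inv_mult_group m_ac r_inv_ex)
  then show ?thesis using trl_permutes[OF g] by (simp add: Auts_def trl_def)
qed

end

context comm_group
begin

lemma pq_reg_trl:
  assumes K: "subgroup K G" "card K = p ^ 3" "\<And>k. k \<in> K \<Longrightarrow> k [^] p = \<one>"
    and c: "c \<in> carrier G" "c [^] q = \<one>" "c \<noteq> \<one>"
    and disj: "\<And>k (n::nat). k \<in> K \<Longrightarrow> k = c [^] n \<Longrightarrow> k = \<one>"
    and gen: "\<And>x. x \<in> carrier G \<Longrightarrow> \<exists>k\<in>K. \<exists>n::nat. x = k \<otimes> c [^] n"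
  shows "pq_reg p q (carrier G) (trl G ` K) (trl G c)"
proof -
  have KG: "k \<in> carrier G" if "k \<in> K" for k using subgroup.subset[OF K(1)] that by blast
  have cn: "c [^] n \<in> carrier G" for n :: nat using c(1) by simp
  have tc: "(trl G c ^^ n) x = c [^] n \<otimes> x" if "x \<in> carrier G" for n x
    using that by (simp add: trl_pow[OF c(1)]) (simp add: trl_def)
  have inj: "inj_on (trl G) (carrier G)"
  proof (rule inj_onI)
    fix g h assume gh: "g \<in> carrier G" "h \<in> carrier G" "trl G g = trl G h"
    then have "trl G g \<one> = trl G h \<one>" by simp
    then show "g = h" using gh by (simp add: trl_def)
  qed
  show ?thesis unfolding pq_reg_def
  proof (intro conjI ballI impI)
    show "perm_grp (trl G ` K)"
    proof (rule perm_grpI)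
      show "id \<in> trl G ` K" using subgroup.one_closed[OF K(1)] trl_one by (metis image_eqI)
      show "f \<circ> g \<in> trl G ` K" if fg: "f \<in> trl G ` K" "g \<in> trl G ` K" for f g
      proof -
        obtain k l where kl: "k \<in> K" "l \<in> K" "f = trl G k" "g = trl G l" using fg by blast
        then have "f \<circ> g = trl G (k \<otimes> l)" using trl_comp KG by simp
        then show ?thesis using subgroup.m_closed[OF K(1) kl(1,2)] by blast
      qed
      show "bij f" if "f \<in> trl G ` K" for f using that trl_bij KG by blast
      show "pinv f \<in> trl G ` K" if f: "f \<in> trl G ` K" for f
      proof -
        obtain k where k: "k \<in> K" "f = trl G k" using f by blast
        then show ?thesis using trl_pinv[OF KG[OF k(1)]] subgroup.m_inv_closed[OF K(1) k(1)] by simp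
      qed
    qed
    show "card (trl G ` K) = p ^ 3"
      using card_image[OF inj_on_subset[OF inj subgroup.subset[OF K(1)]]] K(2) by simp
    show "trl G c ^^ q = id" using trl_pow[OF c(1)] c(2) trl_one by simp
    show "trl G c x \<noteq> x" if "x \<in> carrier G" for x using trl_eq_id[OF c(1) that] c(3) by blast
    show "\<exists>f\<in>trl G ` K. y \<in> orb (cyc (trl G c)) (f x)" if xy: "x \<in> carrier G" "y \<in> carrier G" for x y
    proof -
      obtain k n where k: "k \<in> K" "y \<otimes> m_inv G x = k \<otimes> c [^] (n::nat)" using gen[of "y \<otimes> m_inv G x"] xy by auto
      have "y = (y \<otimes> m_inv G x) \<otimes> x" using xy by (simp add: m_assoc)
      also have "\<dots> = c [^] n \<otimes> (k \<otimes> x)" unfolding k(2) using KG[OF k(1)] cn xy by (simp add: m_ac)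
      also have "\<dots> = (trl G c ^^ n) (trl G k x)" using tc[of "k \<otimes> x"] KG[OF k(1)] xy(1) by (simp add: trl_def)
      finally show ?thesis using k(1) by (auto simp: orb_cyc_iff)
    qed
    fix f assume "f \<in> trl G ` K"
    then obtain k where k: "k \<in> K" "f = trl G k" by blast
    show "f ^^ p = id" using trl_pow[OF KG[OF k(1)]] K(3)[OF k(1)] trl_one k(2) by simp
    show "f \<circ> trl G c = trl G c \<circ> f"
      using trl_comp[OF KG[OF k(1)] c(1)] trl_comp[OF c(1) KG[OF k(1)]] m_comm[OF KG[OF k(1)] c(1)] k(2) by simp
    show "f \<circ> g = g \<circ> f" if g: "g \<in> trl G ` K" for g
    proof -
      obtain l where l: "l \<in> K" "g = trl G l" using g by blast
      show ?thesis using trl_comp[OF KG[OF k(1)] KG[OF l(1)]] trl_comp[OF KG[OF l(1)] KG[OF k(1)]]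
          m_comm[OF KG[OF k(1)] KG[OF l(1)]] k(2) l(2) by simp
    qed
    show "f = id" if x: "x \<in> carrier G" "f x \<in> orb (cyc (trl G c)) x" for x
    proof -
      obtain n where "f x = (trl G c ^^ n) x" using x(2) by (auto simp: orb_cyc_iff)
      then have "k \<otimes> x = c [^] n \<otimes> x" using tc[OF x(1)] k(2) x(1) by (simp add: trl_def)
      then have "k = c [^] n" using x(1) KG[OF k(1)] cn by simp
      then show ?thesis using disj[OF k(1)] k(2) trl_one by simp
    qed
  qed
qed

text \<open>Composing the isomorphism with the inverse of the conjugating automorphism gives an
  isomorphism \<open>H\<close> of the digraphs that normalises the translations. Such a permutation
  is a group automorphism followed by a translation, and translations do not affect
  adjacency.\<close>

lemma cayley_iso_automorphism:
  assumes fin: "finite (carrier G)" and pq: "prime p" "prime q" "p \<noteq> q" "card (carrier G) < q * q"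
    and K: "subgroup K G" "card K = p ^ 3" "\<And>k. k \<in> K \<Longrightarrow> k [^] p = \<one>"
    and c: "c \<in> carrier G" "c [^] q = \<one>" "c \<noteq> \<one>"
    and disj: "\<And>k (n::nat). k \<in> K \<Longrightarrow> k = c [^] n \<Longrightarrow> k = \<one>"
    and gen: "\<And>x. x \<in> carrier G \<Longrightarrow> \<exists>k\<in>K. \<exists>n::nat. x = k \<otimes> c [^] n"
    and S: "S \<subseteq> carrier G" and T: "T \<subseteq> carrier G"
    and f: "bij_betw f (carrier G) (carrier G)"
    and adj: "\<And>g h. g \<in> carrier G \<Longrightarrow> h \<in> carrier G \<Longrightarrow> g \<otimes> m_inv G h \<in> S \<longleftrightarrow> f g \<otimes> m_inv G (f h) \<in> T"
  shows "\<exists>\<mu>\<in>iso G G. \<mu> ` S = T"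
proof -
  let ?X = "carrier G"
  let ?cS = "\<lambda>a b. a \<otimes> m_inv G b \<in> S" and ?cT = "\<lambda>a b. a \<otimes> m_inv G b \<in> T"
  let ?P = "trl G ` K" and ?z = "trl G c"
  have KG: "k \<in> ?X" if "k \<in> K" for k using subgroup.subset[OF K(1)] that by blast
  have P: "pq_reg p q ?X ?P ?z" by (rule pq_reg_trl[OF K c disj gen])
  have PA: "?P \<subseteq> Auts ?X ?cS" "?z \<in> Auts ?X ?cS" using trl_Auts KG c(1) by blast+
  have PAT: "h \<in> Auts ?X ?cT" if "h \<in> ?P \<or> h = ?z" for h using that trl_Auts KG c(1) by blast
  define F where "F = (\<lambda>x. if x \<in> ?X then f x else x)"
  have "bij_betw F ?X ?X" using f by (rule bij_betw_cong[THEN iffD1, rotated]) (simp add: F_def)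
  then have Fp: "F permutes ?X" by (rule bij_imp_permutes) (simp add: F_def)
  have bF: "bij F" by (rule permutes_bij[OF Fp])
  note Fs = pinv_simps[OF bF]
  have iFp: "pinv F permutes ?X" by (rule permutes_inv[OF Fp])
  have iiF: "pinv (pinv F) = F" by (rule inv_inv_eq[OF bF])
  have inX: "F x \<in> ?X \<longleftrightarrow> x \<in> ?X" "pinv F x \<in> ?X \<longleftrightarrow> x \<in> ?X" for x
    using permutes_in_image[OF Fp] permutes_in_image[OF iFp] by auto
  have colF: "?cT (F a) (F b) = ?cS a b" if "a \<in> ?X" "b \<in> ?X" for a b using adj[OF that] that by (simp add: F_def)
  have pull: "pinv F \<circ> h \<circ> F \<in> Auts ?X ?cS" if h: "h \<in> Auts ?X ?cT" for h
  proof -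
    have hX: "h x \<in> ?X \<longleftrightarrow> x \<in> ?X" for x by (rule Auts_in[OF h])
    have "?cS (pinv F (h (F a))) (pinv F (h (F b))) = ?cS a b" if ab: "a \<in> ?X" "b \<in> ?X" for a b
    proof -
      have i: "pinv F (h (F x)) \<in> ?X" if "x \<in> ?X" for x using inX hX that by simp
      have "?cS (pinv F (h (F a))) (pinv F (h (F b))) = ?cT (F (pinv F (h (F a)))) (F (pinv F (h (F b))))"
        by (rule colF[OF i[OF ab(1)] i[OF ab(2)], symmetric])
      also have "\<dots> = ?cT (h (F a)) (h (F b))" by (simp only: Fs(1))
      also have "\<dots> = ?cT (F a) (F b)" by (rule Auts_col[OF h]) (use inX ab in auto)
      also have "\<dots> = ?cS a b" by (rule colF[OF ab])
      finally show ?thesis .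
    qed
    moreover have "pinv F \<circ> h \<circ> F permutes ?X"
      using permutes_compose[OF Fp permutes_compose[OF Auts_permutes[OF h] iFp]] by (simp add: comp_assoc)
    ultimately show ?thesis by (simp add: Auts_def)
  qed
  let ?P' = "conj_by (pinv F) ?P" and ?z' = "pinv F \<circ> ?z \<circ> pinv (pinv F)"
  have P': "pq_reg p q ?X ?P' ?z'" by (rule pq_reg_conj[OF P iFp])
  have P'A: "?P' \<subseteq> Auts ?X ?cS" "?z' \<in> Auts ?X ?cS" unfolding iiF using pull PAT by blast+
  have "?X \<noteq> {}" using one_closed by blast
  from conj_pq[OF fin this pq(1,2,4,3) P PA P' P'A]
  obtain a where a: "a \<in> Auts ?X ?cS" "conj_by a ?P' = ?P" "a \<circ> ?z' \<circ> pinv a \<in> cyc ?z" by blast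
  have ba: "bij a" by (rule perm_grp_bij[OF perm_grp_Auts a(1)])
  note as = pinv_simps[OF ba]
  have ia: "pinv a \<in> Auts ?X ?cS" by (rule perm_grp_inv[OF perm_grp_Auts a(1)])
  define H where "H = F \<circ> pinv a"
  have Hp: "H permutes ?X" unfolding H_def by (rule permutes_compose[OF Auts_permutes[OF ia] Fp])
  have HX: "H x \<in> ?X" if "x \<in> ?X" for x using permutes_in_image[OF Hp] that by simp
  have HK: "\<exists>g\<in>?X. H \<circ> trl G k = trl G g \<circ> H" if k: "k \<in> K" for k
  proof -
    have "trl G k \<in> conj_by a ?P'" unfolding a(2) using k by blast
    then obtain l where l: "l \<in> K" "trl G k = a \<circ> (pinv F \<circ> trl G l \<circ> F) \<circ> pinv a" unfolding iiF by blast
    have "H \<circ> trl G k = trl G l \<circ> H" unfolding H_def l(2) using as Fs by (simp add: fun_eq_iff)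
    then show ?thesis using KG[OF l(1)] by blast
  qed
  obtain l where l: "a \<circ> (pinv F \<circ> ?z \<circ> F) \<circ> pinv a = ?z ^^ l" using a(3) unfolding iiF cyc_def by blast
  have Hl: "H \<circ> ?z ^^ l = ?z \<circ> H" unfolding H_def l[symmetric] using as Fs by (simp add: fun_eq_iff)
  have zq: "?z ^^ q = id" by (rule pq_regD(6)[OF P])
  have "\<not> q dvd l"
  proof
    assume "q dvd l"
    then obtain d where "l = q * d" by (elim dvdE)
    then have "?z ^^ l = id" using pow_mod_period(1)[OF zq] by simp
    then have "?z (H \<one>) = H \<one>" using fun_cong[OF Hl, of \<one>] by simp
    then show False using pq_regD(7)[OF P HX[OF one_closed]] by blast
  qed
  \<comment> \<open>\<open>d\<close> inverts \<open>l\<close> modulo \<open>q\<close>, so that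
    moving \<open>H\<close> past the cycle raises it to the power \<open>d\<close>.\<close>
  then obtain d where d: "(?z ^^ l) ^^ d = ?z" using pow_generates[OF pq(2) zq] by blast
  have Hld: "H ((((?z ^^ l) ^^ i)) x) = (?z ^^ i) (H x)" for i x
  proof (induction i)
    case (Suc i)
    have "H ((?z ^^ l) (((?z ^^ l) ^^ i) x)) = ?z (H (((?z ^^ l) ^^ i) x))" using fun_cong[OF Hl] by simp
    then show ?case using Suc by simp
  qed simp
  have Hz: "H ((?z ^^ n) x) = (?z ^^ (d * n)) (H x)" for n x
    using Hld[of "d * n" x] d by (metis funpow_mult)
  have HG: "\<exists>g'\<in>?X. \<forall>x. H (trl G g x) = trl G g' (H x)" if g: "g \<in> ?X" for g
  proof -
    obtain k n where k: "k \<in> K" "g = k \<otimes> c [^] (n::nat)" using gen[OF g] by blast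
    have cn: "c [^] m \<in> ?X" for m :: nat using c(1) by simp
    obtain k' where k': "k' \<in> ?X" "H \<circ> trl G k = trl G k' \<circ> H" using HK[OF k(1)] by blast
    have "H (trl G g x) = trl G (k' \<otimes> c [^] (d * n)) (H x)" for x
    proof -
      have "trl G g x = trl G k ((?z ^^ n) x)"
        unfolding k(2) trl_pow[OF c(1)] using fun_cong[OF trl_comp[OF KG[OF k(1)] cn], of n x] by simp
      then have "H (trl G g x) = trl G k' ((?z ^^ (d * n)) (H x))" using fun_cong[OF k'(2)] Hz by simp
      then show ?thesis unfolding trl_pow[OF c(1)] using fun_cong[OF trl_comp[OF k'(1) cn], of "d * n" "H x"] by simp
    qed
    then show ?thesis using k'(1) cn by (intro bexI[of _ "k' \<otimes> c [^] (d * n)"]) auto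
  qed
  \<comment> \<open>Dividing by \<open>H \<one>\<close> makes \<open>\<mu>\<close> fix the identity;
    then \<open>\<mu> g\<close> is exactly the translation \<open>g'\<close> that \<open>H\<close>
    assigns to \<open>g\<close>.\<close>
  define \<mu> where "\<mu> x = H x \<otimes> m_inv G (H \<one>)" for x
  have H1: "H \<one> \<in> ?X" by (rule HX[OF one_closed])
  have muX: "\<mu> x \<in> ?X" if "x \<in> ?X" for x using HX[OF that] H1 by (simp add: \<mu>_def)
  have hom: "\<mu> (g \<otimes> x) = \<mu> g \<otimes> \<mu> x" if g: "g \<in> ?X" and x: "x \<in> ?X" for g x
  proof -
    obtain g' where g': "g' \<in> ?X" "\<And>x. H (trl G g x) = trl G g' (H x)" using HG[OF g] by blast
    have e: "H (g \<otimes> y) = g' \<otimes> H y" if "y \<in> ?X" for y using g'(2)[of y] that HX[OF that] by (simp add: trl_def)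
    have "H g = g' \<otimes> H \<one>" using e[OF one_closed] g by simp
    then have "\<mu> g = g'" using g'(1) H1 by (simp add: \<mu>_def m_assoc)
    then show ?thesis using e[OF x] g'(1) HX[OF x] H1 by (simp add: \<mu>_def m_assoc)
  qed
  have "inj_on \<mu> ?X"
  proof (rule inj_onI)
    fix x y assume xy: "x \<in> ?X" "y \<in> ?X" "\<mu> x = \<mu> y"
    then have "H x = H y" using HX H1 by (simp add: \<mu>_def)
    then show "x = y" using permutes_inj[OF Hp] by (auto dest: injD)
  qed
  moreover have "\<mu> ` ?X \<subseteq> ?X" using muX by blast
  ultimately have bmu: "bij_betw \<mu> ?X ?X" using endo_inj_surj[OF fin] unfolding bij_betw_def by blast
  have "\<mu> \<in> iso G G" using hom muX bmu by (auto simp: iso_def hom_def)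
  moreover have "\<mu> ` S = T"
  proof -
    have iff: "x \<in> S \<longleftrightarrow> \<mu> x \<in> T" if x: "x \<in> ?X" for x
    proof -
      \<comment> \<open>Membership in the connection set is adjacency to \<open>\<one>\<close>,
        which the isomorphism \<open>H\<close> carries to adjacency to
        \<open>H \<one>\<close>.\<close>
      have "x \<in> S \<longleftrightarrow> ?cS x \<one>" using x by simp
      also have "\<dots> \<longleftrightarrow> ?cS (pinv a x) (pinv a \<one>)" by (rule Auts_col[OF ia x one_closed, symmetric])
      also have "\<dots> \<longleftrightarrow> ?cT (H x) (H \<one>)" unfolding H_def comp_apply
        by (rule colF[symmetric]) (use Auts_in[OF ia] x in auto)
      finally show ?thesis by (simp add: \<mu>_def)
    qed
    show ?thesis
    proof (intro equalityI subsetI)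
      fix y assume "y \<in> \<mu> ` S" then show "y \<in> T" using iff S by blast
    next
      fix y assume y: "y \<in> T"
      then have "y \<in> \<mu> ` ?X" using T bmu by (auto simp: bij_betw_def)
      then show "y \<in> \<mu> ` S" using iff y by blast
    qed
  qed
  ultimately show ?thesis by blast
qed

lemma automorphism_cayley_iso:
  assumes mu: "\<mu> \<in> iso G G" "\<mu> ` S = T" and S: "S \<subseteq> carrier G"
  shows "bij_betw \<mu> (carrier G) (carrier G)"
    and "\<And>g h. g \<in> carrier G \<Longrightarrow> h \<in> carrier G \<Longrightarrow> g \<otimes> m_inv G h \<in> S \<longleftrightarrow> \<mu> g \<otimes> m_inv G (\<mu> h) \<in> T"
proof -
  show b: "bij_betw \<mu> (carrier G) (carrier G)" using mu(1) by (simp add: iso_def)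
  fix g h assume gh: "g \<in> carrier G" "h \<in> carrier G"
  interpret group_hom G G \<mu> by unfold_locales (use mu(1) in \<open>simp add: iso_def\<close>)
  have "\<mu> (g \<otimes> m_inv G h) = \<mu> g \<otimes> m_inv G (\<mu> h)" using gh by simp
  moreover have "g \<otimes> m_inv G h \<in> carrier G" using gh by simp
  ultimately show "g \<otimes> m_inv G h \<in> S \<longleftrightarrow> \<mu> g \<otimes> m_inv G (\<mu> h) \<in> T"
    using mu(2) inj_on_image_mem_iff[OF _ _ S] b by (metis bij_betw_def)
qed

end

section \<open>The group in coordinates\<close>

lemma pow_DirProd:
  assumes "group A" "group B" "a \<in> carrier A" "b \<in> carrier B"
  shows "(a, b) [^]\<^bsub>A \<times>\<times> B\<^esub> (n::nat) = (a [^]\<^bsub>A\<^esub> n, b [^]\<^bsub>B\<^esub> n)"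
proof (induction n)
  case 0
  then show ?case by (simp add: nat_pow_def)
next
  case (Suc n)
  then show ?case by (simp add: nat_pow_def)
qed

lemma comm_group_DirProd:
  assumes "comm_group A" "comm_group B"
  shows "comm_group (A \<times>\<times> B)"
proof -
  interpret A: comm_group A by fact
  interpret B: comm_group B by fact
  interpret AB: group "A \<times>\<times> B" by (rule DirProd_group[OF A.is_group B.is_group])
  show ?thesis by (rule AB.group_comm_groupI) (auto simp: A.m_comm B.m_comm)
qed

theorem theorem1:
  fixes p q :: nat
  assumes "prime p" and "p > 3" and "prime q" and "q > p ^ 3"
  shows "DCI_group
    ((integer_mod_group p \<times>\<times> integer_mod_group p \<times>\<times> integer_mod_group p) \<times>\<times> integer_mod_group q)"
proof -
  let ?Zp = "integer_mod_group p" and ?Zq = "integer_mod_group q"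
  let ?A = "?Zp \<times>\<times> ?Zp \<times>\<times> ?Zp"
  let ?G = "?A \<times>\<times> ?Zq"
  have p0: "p > 0" and q1: "q > 1" using assms(2) prime_gt_1_nat[OF assms(3)] by simp_all
  have A: "comm_group ?A" by (intro comm_group_DirProd abelian_integer_mod_group)
  interpret A: comm_group ?A by (rule A)
  interpret comm_group ?G by (intro comm_group_DirProd A abelian_integer_mod_group)
  have cp: "carrier ?Zp = {0..<int p}" and cq: "carrier ?Zq = {0..<int q}"
    using p0 q1 by (auto simp: carrier_integer_mod_group)
  have finA: "finite (carrier ?A)" and cardA: "card (carrier ?A) = p ^ 3"
    by (simp_all add: cp card_cartesian_product power3_eq_cube)
  have fin: "finite (carrier ?G)" and card: "card (carrier ?G) = p ^ 3 * q"
    using finA cardA by (simp_all add: cq card_cartesian_product)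
  \<comment> \<open>This is where \<open>q > p ^ 3\<close> enters: it keeps orbits of
    \<open>q\<close>-groups below length \<open>q ^ 2\<close>.\<close>
  have lt: "card (carrier ?G) < q * q" using assms(4) q1 unfolding card by simp
  have "p ^ 1 \<le> p ^ 3" using p0 by (intro power_increasing) auto
  then have pq: "p \<noteq> q" using assms(4) by simp
  define K where "K = carrier ?A \<times> {0::int}"
  define c where "c = (((0::int), (0::int), (0::int)), (1::int))"
  have K: "subgroup K ?G" unfolding K_def
  proof (rule DirProd_subgroups)
    show "group ?A" by (rule A.is_group)
    show "subgroup (carrier ?A) ?A" by (rule A.subgroup_self)
    show "group ?Zq" by simp
    show "subgroup {0} ?Zq" using group.triv_subgroup[OF group_integer_mod_group, of q] by simp
  qed
  have "card K = card (carrier ?A) * card {0::int}" unfolding K_def by (rule card_cartesian_product)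
  then have cardK: "card K = p ^ 3" using cardA by (simp only:) simp
  have pw: "((a1, a2, a3), b) [^]\<^bsub>?G\<^esub> (n::nat) =
      ((int n * a1 mod int p, int n * a2 mod int p, int n * a3 mod int p), int n * b mod int q)"
    if "a1 \<in> carrier ?Zp" "a2 \<in> carrier ?Zp" "a3 \<in> carrier ?Zp" "b \<in> carrier ?Zq" for a1 a2 a3 b n
  proof -
    have g: "group ?Zp" "group ?Zq" "group (?Zp \<times>\<times> ?Zp)" "group ?A" by (intro DirProd_group group_integer_mod_group)+
    show ?thesis
      using that pow_DirProd[OF g(4,2), of "(a1, a2, a3)" b n] pow_DirProd[OF g(1,3), of a1 "(a2, a3)" n]
        pow_DirProd[OF g(1,1), of a2 a3 n] by simp
  qed
  have one: "\<one>\<^bsub>?G\<^esub> = ((0, 0, 0), 0)" by simp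
  have Kp: "k [^]\<^bsub>?G\<^esub> p = \<one>\<^bsub>?G\<^esub>" if k: "k \<in> K" for k
  proof -
    obtain a1 a2 a3 where "k = ((a1, a2, a3), 0)" "a1 \<in> carrier ?Zp" "a2 \<in> carrier ?Zp" "a3 \<in> carrier ?Zp"
      using k unfolding K_def by auto
    then show ?thesis using pw[of a1 a2 a3 0 p] by simp
  qed
  have cG: "c \<in> carrier ?G" using q1 by (simp add: c_def)
  have cpow: "c [^]\<^bsub>?G\<^esub> (n::nat) = ((0, 0, 0), int n mod int q)" for n
    using pw[of 0 0 0 1 n] q1 by (simp add: c_def)
  have cqp: "c [^]\<^bsub>?G\<^esub> q = \<one>\<^bsub>?G\<^esub>" unfolding cpow by simp
  have c1: "c \<noteq> \<one>\<^bsub>?G\<^esub>" by (simp add: c_def)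
  have disj: "k = \<one>\<^bsub>?G\<^esub>" if "k \<in> K" "k = c [^]\<^bsub>?G\<^esub> n" for k and n :: nat
    using that unfolding cpow K_def by auto
  have gen: "\<exists>k\<in>K. \<exists>n::nat. x = k \<otimes>\<^bsub>?G\<^esub> c [^]\<^bsub>?G\<^esub> n" if x: "x \<in> carrier ?G" for x
  proof -
    obtain a1 a2 a3 b where x': "x = ((a1, a2, a3), b)" "a1 \<in> carrier ?Zp" "a2 \<in> carrier ?Zp" "a3 \<in> carrier ?Zp"
      "b \<in> carrier ?Zq" using x by auto
    then have "((a1, a2, a3), 0) \<in> K" by (simp add: K_def)
    \<comment> \<open>The last coordinate of \<open>c\<close> is 1, so the exponent is the last
      coordinate of \<open>x\<close> itself.\<close>
    moreover have "x = ((a1, a2, a3), 0) \<otimes>\<^bsub>?G\<^esub> c [^]\<^bsub>?G\<^esub> nat b"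
      using x' unfolding cpow by (simp add: cp cq)
    ultimately show ?thesis by blast
  qed
  have "cayley_CI ?G S" if S: "S \<subseteq> carrier ?G" for S
    unfolding cayley_CI_def digraph_iso_cayley_digraph_iff
  proof (intro allI impI iffI)
    fix T assume T: "T \<subseteq> carrier ?G"
    assume "\<exists>f. bij_betw f (carrier ?G) (carrier ?G) \<and>
      (\<forall>g\<in>carrier ?G. \<forall>h\<in>carrier ?G. g \<otimes>\<^bsub>?G\<^esub> inv\<^bsub>?G\<^esub> h \<in> S \<longleftrightarrow> f g \<otimes>\<^bsub>?G\<^esub> inv\<^bsub>?G\<^esub> f h \<in> T)"
    then obtain f where f: "bij_betw f (carrier ?G) (carrier ?G)"
      "\<And>g h. g \<in> carrier ?G \<Longrightarrow> h \<in> carrier ?G \<Longrightarrow>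
        g \<otimes>\<^bsub>?G\<^esub> inv\<^bsub>?G\<^esub> h \<in> S \<longleftrightarrow> f g \<otimes>\<^bsub>?G\<^esub> inv\<^bsub>?G\<^esub> f h \<in> T" by blast
    show "\<exists>\<mu>\<in>iso ?G ?G. \<mu> ` S = T"
      by (rule cayley_iso_automorphism[OF fin assms(1,3) pq lt K cardK Kp cG cqp c1 disj gen S T f])
  next
    fix T assume "\<exists>\<mu>\<in>iso ?G ?G. \<mu> ` S = T"
    then obtain \<mu> where mu: "\<mu> \<in> iso ?G ?G" "\<mu> ` S = T" by blast
    from automorphism_cayley_iso[OF mu S]
    show "\<exists>f. bij_betw f (carrier ?G) (carrier ?G) \<and>
      (\<forall>g\<in>carrier ?G. \<forall>h\<in>carrier ?G. g \<otimes>\<^bsub>?G\<^esub> inv\<^bsub>?G\<^esub> h \<in> S \<longleftrightarrow> f g \<otimes>\<^bsub>?G\<^esub> inv\<^bsub>?G\<^esub> f h \<in> T)" by blast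
  qed
  then show ?thesis unfolding DCI_group_def using fin is_group by blast
qed

end
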